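(* Let $\beta=\sigma+i\tau\in\mathbb{C}$ be such that $\sigma=\frac{\sigma_l}{2}$ and $\tau>\frac{\sigma_l}{2}$ for some $1\le l\le d$. Then there exists a deterministic complex normalizing sequence $r_n(\beta)$ such that, in distribution as $n\to\infty$, $$\frac{\mathcal{Z}_n(\beta)}{e^{r_n(\beta)}}\longrightarrow\frac1{\sqrt2}\sqrt{\zeta_P\left(\frac{2\sigma}{\sigma_1},\dots,\frac{2\sigma}{\sigma_{l-1}}\right)}\;N,$$ where $\zeta_P$ is the Poisson cascade zeta function with $l-1$ variables (equal to $1$ if $l=1$) and $N\sim N_{\mathbb{C}}(0,1)$ is independent of $\zeta_P$.
   Context: GREM. Fix $d\in\mathbb{N}$, variances $a_1,\dots,a_d>0$, branching exponents $\alpha_1,\dots,\alpha_d>1$, and sequences of natural numbers $N_{n,1},\dots,N_{n,d}$ with $\lim_{n\to\infty}N_{n,j}/\alpha_j^n=1$ for each $j$. Let $\mathbb{S}_n=\{\varepsilon=(\varepsilon_1,\dots,\varepsilon_d)\in\mathbb{N}^d:1\le\varepsilon_j\le N_{n,j},\ 1\le j\le d\}$. Let $\{\xi_{\varepsilon_1\dots\varepsilon_j}:1\le j\le d,\ 1\le\varepsilon_i\le N_{n,i}\}$ be independent real standard normal random variables, $X_\varepsilon=\sum_{j=1}^d\sqrt{a_j}\,\xi_{\varepsilon_1\dots\varepsilon_j}$, and $\mathcal{Z}_n(\beta)=\sum_{\varepsilon\in\mathbb{S}_n}e^{\beta\sqrt n X_\varepsilon}$, $\beta\in\mathbb{C}$.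 Put $\sigma_j=\sqrt{2\log\alpha_j/a_j}$; it is assumed throughout that $\sigma_1<\dots<\sigma_d$. Poisson cascade zeta function. For $m\in\mathbb{N}$, for every $0\le j\le m-1$ and $\varepsilon_1,\dots,\varepsilon_j\in\mathbb{N}$ let $(P_{\varepsilon_1\dots\varepsilon_j i})_{i\in\mathbb{N}}$ be the points, in increasing order, of a unit intensity Poisson point process on $(0,\infty)$, all these processes being independent. Then $\zeta_P(z_1,\dots,z_m)=\sum_{\varepsilon\in\mathbb{N}^m}P_{\varepsilon_1}^{-z_1}P_{\varepsilon_1\varepsilon_2}^{-z_2}\cdots P_{\varepsilon_1\dots\varepsilon_m}^{-z_m}$ for $\operatorname{Re}z_1>\dots>\operatorname{Re}z_m>1$ (almost surely absolutely convergent). $N_{\mathbb{C}}(0,1)$ is the law of $X+iY$ with $X,Y$ independent real centered Gaussian of variance $1/2$. *)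

theory Defs
  imports "HOL-Probability.Probability"
begin

text \<open>
  Multi-indices are lists: \<open>\<epsilon> = (\<epsilon>\<^sub>1,\<dots>,\<epsilon>\<^sub>j)\<close> is a list of length \<open>j\<close>, whose
  component \<open>\<epsilon>\<^sub>i\<close> is the list entry at position \<open>i - 1\<close>, and the prefix
  \<open>\<epsilon>\<^sub>1\<dots>\<epsilon>\<^sub>j\<close> is \<open>take j \<epsilon>\<close>. The level parameters \<open>a\<close>, \<open>\<alpha>\<close>, \<open>\<sigma>\<close>, \<open>N n\<close> are functions
  on the naturals of which only the values at \<open>1,\<dots>,d\<close> matter.
\<close>

definition grem_indices :: "(nat \<Rightarrow> nat \<Rightarrow> nat) \<Rightarrow> nat \<Rightarrow> nat \<Rightarrow> nat list set" where
  "grem_indices N n j = {e. length e = j \<and> (\<forall>i<j. e ! i \<in> {1..N n (Suc i)})}"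

definition grem_sigma :: "(nat \<Rightarrow> real) \<Rightarrow> (nat \<Rightarrow> real) \<Rightarrow> nat \<Rightarrow> real" where
  "grem_sigma a \<alpha> j = sqrt (2 * ln (\<alpha> j) / a j)"

text \<open>The underlying probability space is allowed to vary with \<open>n\<close>.\<close>

definition grem_disorder ::
  "nat \<Rightarrow> (nat \<Rightarrow> nat \<Rightarrow> nat) \<Rightarrow> nat \<Rightarrow> 'a measure \<Rightarrow> (nat list \<Rightarrow> 'a \<Rightarrow> real) \<Rightarrow> bool" where
  "grem_disorder d N n M \<xi> \<longleftrightarrow>
     prob_space M \<and>
     prob_space.indep_vars M (\<lambda>_. borel) \<xi> (\<Union>j\<in>{1..d}. grem_indices N n j) \<and>
     (\<forall>e\<in>(\<Union>j\<in>{1..d}. grem_indices N n j). distributed M lborel (\<xi> e) std_normal_density)"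

definition grem_energy ::
  "nat \<Rightarrow> (nat \<Rightarrow> real) \<Rightarrow> (nat list \<Rightarrow> 'a \<Rightarrow> real) \<Rightarrow> nat list \<Rightarrow> 'a \<Rightarrow> real" where
  "grem_energy d a \<xi> e \<omega> = (\<Sum>j=1..d. sqrt (a j) * \<xi> (take j e) \<omega>)"

definition grem_partition ::
  "nat \<Rightarrow> (nat \<Rightarrow> real) \<Rightarrow> (nat \<Rightarrow> nat \<Rightarrow> nat) \<Rightarrow> nat \<Rightarrow> (nat list \<Rightarrow> 'a \<Rightarrow> real) \<Rightarrow> complex \<Rightarrow> 'a \<Rightarrow> complex"
  where
  "grem_partition d a N n \<xi> \<beta> \<omega> =
     (\<Sum>e\<in>grem_indices N n d. exp (\<beta> * of_real (sqrt (real n) * grem_energy d a \<xi> e \<omega>)))"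

text \<open>
  A (simple) Poisson point process with intensity measure \<open>\<mu>\<close>, viewed as a random set
  \<open>S\<close> of points. Almost sure finiteness is required explicitly because \<open>card\<close> of an
  infinite set is \<open>0\<close>.
\<close>

definition poisson_point_process :: "'a measure \<Rightarrow> 'b measure \<Rightarrow> ('a \<Rightarrow> 'b set) \<Rightarrow> bool" where
  "poisson_point_process M \<mu> S \<longleftrightarrow>
     (AE \<omega> in M. S \<omega> \<subseteq> space \<mu>) \<and>
     (\<forall>A\<in>sets \<mu>. emeasure \<mu> A < \<infinity> \<longrightarrow>
        (AE \<omega> in M. finite (S \<omega> \<inter> A)) \<and>
        (\<forall>k. measure M {\<omega>\<in>space M. card (S \<omega> \<inter> A) = k}
              = exp (- measure \<mu> A) * measure \<mu> A ^ k / fact k)) \<and>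
     (\<forall>(A :: nat \<Rightarrow> 'b set) m.
        (\<forall>i<m. A i \<in> sets \<mu> \<and> emeasure \<mu> (A i) < \<infinity>) \<and> disjoint_family_on A {..<m} \<longrightarrow>
        prob_space.indep_vars M (\<lambda>_. count_space UNIV) (\<lambda>i \<omega>. card (S \<omega> \<inter> A i)) {..<m})"

text \<open>
  Points are numbered from \<open>0\<close>: for a list \<open>e\<close> of length \<open>< m\<close>, the sequence
  \<open>i \<mapsto> P (e @ [i])\<close> enumerates one unit intensity Poisson process on \<open>(0,\<infinity>)\<close>.
\<close>

definition poisson_cascade :: "nat \<Rightarrow> 'a measure \<Rightarrow> (nat list \<Rightarrow> 'a \<Rightarrow> real) \<Rightarrow> bool" where
  "poisson_cascade m M P \<longleftrightarrow>
     prob_space M \<and>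
     (\<forall>e. length e < m \<longrightarrow>
        poisson_point_process M (restrict_space lborel {0<..}) (\<lambda>\<omega>. range (\<lambda>i. P (e @ [i]) \<omega>)) \<and>
        (AE \<omega> in M. strict_mono (\<lambda>i. P (e @ [i]) \<omega>))) \<and>
     prob_space.indep_vars M (\<lambda>_. \<Pi>\<^sub>M i\<in>UNIV. borel) (\<lambda>e \<omega> i. P (e @ [i]) \<omega>) {e. length e < m}"

text \<open>For \<open>m = 0\<close> the only summand is the empty product, so the value is \<open>1\<close>.\<close>

definition poisson_cascade_zeta ::
  "nat \<Rightarrow> (nat list \<Rightarrow> 'a \<Rightarrow> real) \<Rightarrow> (nat \<Rightarrow> complex) \<Rightarrow> 'a \<Rightarrow> complex" where
  "poisson_cascade_zeta m P z \<omega> =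
     (\<Sum>\<^sub>\<infinity>e\<in>{e. length e = m}. \<Prod>j=1..m. of_real (P (take j e) \<omega>) powr (- z j))"

text \<open>The law of \<open>X + \<i> Y\<close> with \<open>X\<close>, \<open>Y\<close> independent centered Gaussian of variance \<open>1/2\<close>.\<close>

definition std_complex_normal :: "complex measure" where
  "std_complex_normal =
     (let g = density lborel (\<lambda>x. ennreal (normal_density 0 (sqrt (1/2)) x))
      in distr (g \<Otimes>\<^sub>M g) borel (\<lambda>(x, y). Complex x y))"

text \<open>
  Convergence in distribution of random variables with values in a topological space
  (the library's \<open>weak_conv_m\<close> is restricted to the real line).
\<close>

definition converges_in_distribution ::
  "(nat \<Rightarrow> 'a measure) \<Rightarrow> (nat \<Rightarrow> 'a \<Rightarrow> 'c::topological_space) \<Rightarrow> 'b measure \<Rightarrow> ('b \<Rightarrow> 'c) \<Rightarrow> bool" where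
  "converges_in_distribution M X M' Y \<longleftrightarrow>
     (\<forall>f :: 'c \<Rightarrow> real. continuous_on UNIV f \<and> bounded (range f) \<longrightarrow>
        (\<lambda>n. \<integral>\<omega>. f (X n \<omega>) \<partial>M n) \<longlonglongrightarrow> (\<integral>\<omega>. f (Y \<omega>) \<partial>M'))"

end

theory Submission
  imports Defs "HOL-Real_Asymp.Real_Asymp"
begin

text \<open>
  The characteristic function of the partition function is computed level by level from the leaves
  to the root. If \<open>g\<close> is the characteristic function of the (suitably normalized) subtree below a
  vertex, then passing to its parent replaces \<open>g\<close> by \<open>u \<mapsto> (E g (u c e\<^bsup>b \<xi>\<^esup>))\<^bsup>N\<^esup>\<close> with
  \<open>\<xi>\<close> standard normal.

  For the levels \<open>j > l\<close> this map preserves a second order expansion of \<open>g\<close> around its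
  mean with a scale-invariant error. The level \<open>l\<close> sits exactly at the edge of the central limit
  regime: tilting by \<open>e\<^bsup>2 Re b \<xi>\<^esup>\<close> moves the Gaussian to the boundary of the range
  that the \<open>N\<close> points reach, so only half of the variance survives (whence \<open>1 / \<surd>2\<close>),
  and the pseudo-variance is killed by the oscillation (Riemann--Lebesgue). For the levels \<open>j < l\<close> the
  extremal points converge to a Poisson process with intensity \<open>e\<^bsup>-y\<^esup> dy\<close>, while \<open>\<tau> > \<sigma>\<close> makes
  the mean terms negligible. The limit is a scale mixture of complex Gaussians, and the Laplace
  transform of its random variance obeys the same recursion as that of the cascade zeta function.
  Levy's continuity theorem on the complex plane concludes.
\<close>

section \<open>Levy's continuity theorem on the complex plane\<close>

text \<open>Pointwise convergence of subtree characteristic functions does not by itself pass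
  through a level: the displacements of the \<open>N\<close> points range over the whole line, so a
  bound near the origin that is uniform in \<open>n\<close> has to be carried along. On the Gaussian
  levels this is \<open>quad_expansion\<close>, with an error of order \<open>2 + e\<close>; the
  strict inequality between the \<open>\<sigma> j\<close> is what allows \<open>e > 0\<close>. From
  the critical level upwards only \<open>char_bound\<close> survives, a first-order expansion with
  error of order \<open>p\<close>. Level \<open>k\<close> retains every exponent
  \<open>p < 2 * \<sigma> k / \<sigma> l\<close>, whereas the step from \<open>k + 1\<close> to
  \<open>k\<close> consumes an exponent above that number; strict monotonicity again leaves the
  room. Since \<open>p\<close> may exceed 1, a mean has to be subtracted. It is exponentially small
  at level \<open>l\<close>, and every extremal level multiplies it by at most a constant times
  \<open>n\<close>, whence the class \<open>rapidly_decreasing\<close>. The uniform bound also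
  passes to the limit, where it gives continuity at 0 of the Laplace transform and thus almost sure
  finiteness of the cascade sum.\<close>

definition smoothed_density :: "real \<Rightarrow> complex measure \<Rightarrow> real \<times> real \<Rightarrow> real" where
  "smoothed_density h \<mu> p =
     (\<integral>z. normal_density 0 h (fst p - Re z) * normal_density 0 h (snd p - Im z) \<partial>\<mu>)"

text \<open>The pairing \<open>Re (u * z)\<close> replaces the inner product of the plane. It is
  chosen because a complex factor on the random variable then becomes the same factor on the
  argument \<open>u\<close>.\<close>

definition complex_char :: "complex measure \<Rightarrow> complex \<Rightarrow> complex" where
  "complex_char \<mu> u = (CLINT z|\<mu>. iexp (Re (u * z)))"

text \<open>The Gaussian density is, up to a constant, its own Fourier transform. Reading it as a
  characteristic function allows the density of a smoothed law to be expressed through the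
  characteristic function of that law.\<close>

lemma normal_density_eq_char:
  assumes "h > 0"
  shows "complex_of_real (normal_density 0 h x) =
    of_real (1 / (h * sqrt (2 * pi))) * char std_normal_distribution (x / h)"
proof -
  have "normal_density 0 h x = 1 / (h * sqrt (2 * pi)) * exp (- ((x / h)\<^sup>2) / 2)"
    using assms by (simp add: normal_density_def real_sqrt_mult power_divide field_simps)
  then show ?thesis
    by (simp only: char_std_normal_distribution of_real_mult exp_of_real)
qed

lemma smoothed_density_fourier:
  assumes h: "h > 0" and mu: "prob_space \<mu>" and sets: "sets \<mu> = sets borel"
  shows "complex_of_real (smoothed_density h \<mu> (x, y)) =
    of_real (1 / (h * sqrt (2 * pi)))^2 *
    (CLINT st|std_normal_distribution \<Otimes>\<^sub>M std_normal_distribution.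
       iexp (x / h * fst st + y / h * snd st) * complex_char \<mu> (Complex (- fst st / h) (snd st / h)))"
proof -
  note [measurable_cong] = sets
  interpret mu: prob_space \<mu> by fact
  let ?g = std_normal_distribution
  interpret g: prob_space ?g by (rule real_dist_normal_dist[THEN real_distribution.axioms(1)])
  interpret gg: pair_prob_space ?g ?g ..
  interpret P: pair_prob_space "?g \<Otimes>\<^sub>M ?g" \<mu> ..
  let ?c = "complex_of_real (1 / (h * sqrt (2 * pi)))"
  have "complex_of_real (smoothed_density h \<mu> (x, y)) =
      (CLINT z|\<mu>. of_real (normal_density 0 h (x - Re z)) * of_real (normal_density 0 h (y - Im z)))"
    by (simp add: smoothed_density_def flip: integral_complex_of_real)
  also have "\<dots> = (CLINT z|\<mu>. ?c^2 * (char ?g ((x - Re z) / h) * char ?g ((y - Im z) / h)))"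
    by (simp add: normal_density_eq_char[OF h] power2_eq_square mult_ac)
  also have "\<dots> = ?c^2 * (CLINT z|\<mu>. char ?g ((x - Re z) / h) * char ?g ((y - Im z) / h))"
    by simp
  also have "(CLINT z|\<mu>. char ?g ((x - Re z) / h) * char ?g ((y - Im z) / h)) =
      (CLINT z|\<mu>. CLINT st|?g \<Otimes>\<^sub>M ?g. iexp ((x - Re z) / h * fst st) * iexp ((y - Im z) / h * snd st))"
  proof (intro Bochner_Integration.integral_cong refl)
    fix z
    let ?a = "(x - Re z) / h" and ?b = "(y - Im z) / h"
    have "(CLINT st|?g \<Otimes>\<^sub>M ?g. iexp (?a * fst st) * iexp (?b * snd st)) =
        (CLINT st|?g \<Otimes>\<^sub>M ?g. (case st of (s, t) \<Rightarrow> iexp (?a * s) * iexp (?b * t)))"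
      by (simp add: case_prod_unfold)
    also have "\<dots> = (CLINT s|?g. CLINT t|?g. iexp (?a * s) * iexp (?b * t))"
      by (rule gg.integral_fst[symmetric])
        (auto intro!: gg.integrable_const_bound[of _ 1] simp: case_prod_unfold norm_mult)
    also have "\<dots> = char ?g ?a * char ?g ?b"
      unfolding char_def by simp
    finally show "char ?g ?a * char ?g ?b =
      (CLINT st|?g \<Otimes>\<^sub>M ?g. iexp (?a * fst st) * iexp (?b * snd st))" by simp
  qed
  also have "\<dots> = (CLINT st|?g \<Otimes>\<^sub>M ?g. CLINT z|\<mu>. iexp ((x - Re z) / h * fst st) * iexp ((y - Im z) / h * snd st))"
    by (rule P.Fubini_integral)
      (auto intro!: P.integrable_const_bound[of _ 1] simp: case_prod_unfold norm_mult)
  also have "\<dots> = (CLINT st|?g \<Otimes>\<^sub>M ?g.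
       iexp (x / h * fst st + y / h * snd st) * complex_char \<mu> (Complex (- fst st / h) (snd st / h)))"
  proof (intro Bochner_Integration.integral_cong refl)
    fix st :: "real \<times> real"
    \<comment> \<open>The real part of \<open>u * z\<close> is
      \<open>Re u * Re z - Im u * Im z\<close>, so the minus sign must be supplied in the first
      coordinate of the argument and is already present for the second.\<close>
    have "iexp ((x - Re z) / h * fst st) * iexp ((y - Im z) / h * snd st) =
      iexp (x / h * fst st + y / h * snd st) * iexp (Re (Complex (- fst st / h) (snd st / h) * z))" for z
      unfolding mult_exp_exp
      by (rule arg_cong[where f=exp]) (use h in \<open>simp add: complex_eq_iff field_simps\<close>)
    then show "(CLINT z|\<mu>. iexp ((x - Re z) / h * fst st) * iexp ((y - Im z) / h * snd st)) =
       iexp (x / h * fst st + y / h * snd st) * complex_char \<mu> (Complex (- fst st / h) (snd st / h))"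
      by (simp add: complex_char_def)
  qed
  finally show ?thesis .
qed

lemma complex_char_measurable [measurable]:
  assumes "prob_space \<mu>" "sets \<mu> = sets borel"
  shows "complex_char \<mu> \<in> borel_measurable borel"
proof -
  note [measurable_cong] = assms(2)
  interpret prob_space \<mu> by fact
  show ?thesis unfolding complex_char_def by measurable
qed

lemma norm_complex_char_le_1:
  assumes "prob_space \<mu>"
  shows "cmod (complex_char \<mu> u) \<le> 1"
proof -
  interpret prob_space \<mu> by fact
  have "cmod (complex_char \<mu> u) \<le> (LINT z|\<mu>. cmod (iexp (Re (u * z))))"
    unfolding complex_char_def by (rule integral_norm_bound)
  also have "\<dots> = 1" by (simp del: of_real_mult add: prob_space)
  finally show ?thesis .
qed

text \<open>In the Fourier representation the law enters only through its characteristic function,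
  integrated against a fixed probability measure; dominated convergence with the constant 1
  therefore applies.\<close>

lemma smoothed_density_tendsto:
  assumes h: "h > 0" and mu: "\<And>n. prob_space (\<mu> n)" and sets: "\<And>n. sets (\<mu> n) = sets borel"
    and mu': "prob_space \<mu>'" and sets': "sets \<mu>' = sets borel"
    and lim: "\<And>u. (\<lambda>n. complex_char (\<mu> n) u) \<longlonglongrightarrow> complex_char \<mu>' u"
  shows "(\<lambda>n. smoothed_density h (\<mu> n) p) \<longlonglongrightarrow> smoothed_density h \<mu>' p"
proof -
  obtain x y where p: "p = (x, y)" by force
  let ?g = std_normal_distribution
  interpret g: prob_space ?g by (rule real_dist_normal_dist[THEN real_distribution.axioms(1)])
  interpret gg: pair_prob_space ?g ?g ..
  note [measurable] = complex_char_measurable[OF mu sets] complex_char_measurable[OF mu' sets']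
  have [measurable]: "(\<lambda>st. Complex (- fst st / h) (snd st / h)) \<in> borel_measurable (?g \<Otimes>\<^sub>M ?g)"
    unfolding Complex_eq by measurable
  have m: "(\<lambda>st. iexp (x / h * fst st + y / h * snd st) * complex_char \<nu> (Complex (- fst st / h) (snd st / h)))
      \<in> borel_measurable (?g \<Otimes>\<^sub>M ?g)" if "prob_space \<nu>" "sets \<nu> = sets borel" for \<nu>
    using complex_char_measurable[OF that, measurable] by measurable
  have "(\<lambda>n. complex_of_real (smoothed_density h (\<mu> n) p)) \<longlonglongrightarrow> complex_of_real (smoothed_density h \<mu>' p)"
    unfolding p smoothed_density_fourier[OF h mu sets] smoothed_density_fourier[OF h mu' sets']
    by (intro tendsto_mult tendsto_const integral_dominated_convergence[where w="\<lambda>_. 1"] m mu sets mu' sets' AE_I2 lim)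
      (auto simp: norm_mult norm_complex_char_le_1 mu simp del: of_real_add of_real_mult of_real_divide)
  then show ?thesis by (simp add: tendsto_of_real_iff)
qed

section \<open>Effect of Gaussian smoothing on Lipschitz test functions\<close>

lemma nn_integral_normal_density_prod:
  assumes "h > 0"
  shows "(\<integral>\<^sup>+p. ennreal (normal_density 0 h (fst p - a) * normal_density 0 h (snd p - b)) \<partial>(lborel \<Otimes>\<^sub>M lborel)) = 1"
proof -
  have 1: "(\<integral>\<^sup>+x. ennreal (normal_density 0 h (x - c)) \<partial>lborel) = 1" for c
  proof -
    have "prob_space (density lborel (\<lambda>x. ennreal (normal_density c h x)))"
      using assms by (rule prob_space_normal_density)
    then have "emeasure (density lborel (\<lambda>x. ennreal (normal_density c h x))) UNIV = 1"
      using prob_space.emeasure_space_1 by fastforce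
    then show ?thesis by (simp add: emeasure_density normal_density_def)
  qed
  have "(\<integral>\<^sup>+p. ennreal (normal_density 0 h (fst p - a) * normal_density 0 h (snd p - b)) \<partial>(lborel \<Otimes>\<^sub>M lborel))
     = (\<integral>\<^sup>+x. \<integral>\<^sup>+y. ennreal (normal_density 0 h (x - a)) * ennreal (normal_density 0 h (y - b)) \<partial>lborel \<partial>lborel)"
    by (subst lborel.nn_integral_fst[symmetric]) (auto simp: ennreal_mult)
  then show ?thesis by (simp add: nn_integral_cmult nn_integral_multc 1)
qed

lemma smoothed_density_nn:
  assumes h: "h > 0" and mu: "prob_space \<mu>" and sets: "sets \<mu> = sets borel"
  shows "ennreal (smoothed_density h \<mu> p) =
    (\<integral>\<^sup>+z. ennreal (normal_density 0 h (fst p - Re z) * normal_density 0 h (snd p - Im z)) \<partial>\<mu>)"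
proof -
  note [measurable_cong] = sets
  interpret mu: prob_space \<mu> by fact
  have le: "normal_density 0 h x \<le> 1 / sqrt (2 * pi * h\<^sup>2)" for x
    unfolding normal_density_def using h by (simp add: divide_simps)
  show ?thesis
    unfolding smoothed_density_def
    by (rule nn_integral_eq_integral[symmetric])
      (auto intro!: AE_I2 mu.integrable_const_bound[of _ "1 / sqrt (2 * pi * h\<^sup>2) * (1 / sqrt (2 * pi * h\<^sup>2))"]
        simp: abs_mult simp del: times_divide_eq_left times_divide_eq_right intro!: mult_mono le)
qed

lemma smoothed_density_measurable [measurable]:
  assumes "prob_space \<mu>" "sets \<mu> = sets borel"
  shows "smoothed_density h \<mu> \<in> borel_measurable (lborel \<Otimes>\<^sub>M lborel)"
proof -
  note [measurable_cong] = assms(2)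
  interpret prob_space \<mu> by fact
  show ?thesis unfolding smoothed_density_def by measurable
qed

lemma nn_integral_smoothed_density:
  assumes h: "h > 0" and mu: "prob_space \<mu>" and sets: "sets \<mu> = sets borel"
    and [measurable]: "f \<in> borel_measurable (lborel \<Otimes>\<^sub>M lborel)"
  shows "(\<integral>\<^sup>+p. f p * ennreal (smoothed_density h \<mu> p) \<partial>(lborel \<Otimes>\<^sub>M lborel)) =
    (\<integral>\<^sup>+z. \<integral>\<^sup>+p. f p * ennreal (normal_density 0 h (fst p - Re z) * normal_density 0 h (snd p - Im z)) \<partial>(lborel \<Otimes>\<^sub>M lborel) \<partial>\<mu>)"
proof -
  note [measurable_cong] = sets
  interpret mu: prob_space \<mu> by fact
  interpret L: sigma_finite_measure "lborel \<Otimes>\<^sub>M lborel :: (real \<times> real) measure"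
    by (simp add: lborel_prod lborel.sigma_finite_measure_axioms)
  interpret P: pair_sigma_finite "lborel \<Otimes>\<^sub>M lborel :: (real \<times> real) measure" \<mu> ..
  show ?thesis
    unfolding smoothed_density_nn[OF h mu sets]
    by (subst P.Fubini') (auto simp: nn_integral_cmult[symmetric])
qed

lemma normal_density_diff: "normal_density 0 h (x - c) = normal_density c h x"
  by (simp add: normal_density_def)

lemma nn_integral_normal_density_abs_le:
  assumes "h > 0"
  shows "(\<integral>\<^sup>+x. ennreal (\<bar>x - c\<bar> * normal_density 0 h (x - c)) \<partial>lborel) \<le> ennreal h"
proof -
  have hbi: "has_bochner_integral lborel (\<lambda>x. normal_density c h x * \<bar>x - c\<bar>) (h * sqrt (2 / pi))"
    using normal_moment_abs_odd[of h c 0] assms by simp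
  have "(\<integral>\<^sup>+x. ennreal (\<bar>x - c\<bar> * normal_density 0 h (x - c)) \<partial>lborel) = ennreal (h * sqrt (2 / pi))"
    unfolding normal_density_diff
    by (subst nn_integral_eq_integral[OF integrable.intros])
       (use hbi in \<open>auto simp: mult.commute has_bochner_integral_integral_eq\<close>)
  also have "sqrt (2 / pi) \<le> 1" using pi_ge_two by simp
  then have "ennreal (h * sqrt (2 / pi)) \<le> ennreal h"
    using assms by (intro ennreal_leI) (simp add: mult_left_le)
  finally show ?thesis .
qed

lemma nn_integral_normal_density_dist_le:
  assumes "h > 0"
  shows "(\<integral>\<^sup>+p. ennreal ((\<bar>fst p - a\<bar> + \<bar>snd p - b\<bar>) *
           (normal_density 0 h (fst p - a) * normal_density 0 h (snd p - b))) \<partial>(lborel \<Otimes>\<^sub>M lborel)) \<le> ennreal (2 * h)"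
proof -
  have 1: "(\<integral>\<^sup>+x. ennreal (normal_density 0 h (x - c)) \<partial>lborel) = 1" for c
    unfolding normal_density_diff using assms
    by (subst nn_integral_eq_integral) auto
  have "(\<integral>\<^sup>+p. ennreal ((\<bar>fst p - a\<bar> + \<bar>snd p - b\<bar>) *
           (normal_density 0 h (fst p - a) * normal_density 0 h (snd p - b))) \<partial>(lborel \<Otimes>\<^sub>M lborel))
     = (\<integral>\<^sup>+x. \<integral>\<^sup>+y. ennreal (\<bar>x - a\<bar> * normal_density 0 h (x - a)) * ennreal (normal_density 0 h (y - b))
          + ennreal (normal_density 0 h (x - a)) * ennreal (\<bar>y - b\<bar> * normal_density 0 h (y - b)) \<partial>lborel \<partial>lborel)"
    by (subst lborel.nn_integral_fst[symmetric])
       (auto simp: ennreal_mult[symmetric] ennreal_plus[symmetric] algebra_simps simp del: ennreal_plus)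
  also have "\<dots> = (\<integral>\<^sup>+x. ennreal (\<bar>x - a\<bar> * normal_density 0 h (x - a)) \<partial>lborel)
              + (\<integral>\<^sup>+y. ennreal (\<bar>y - b\<bar> * normal_density 0 h (y - b)) \<partial>lborel)"
    by (simp add: nn_integral_add nn_integral_cmult nn_integral_multc 1)
  also have "\<dots> \<le> ennreal h + ennreal h"
    by (intro add_mono nn_integral_normal_density_abs_le assms)
  also have "\<dots> = ennreal (2 * h)" using assms by (simp flip: ennreal_plus)
  finally show ?thesis .
qed

lemma Complex_fst_snd_measurable [measurable]:
  "(\<lambda>p. Complex (fst p) (snd p)) \<in> borel_measurable (lborel \<Otimes>\<^sub>M lborel)"
  unfolding Complex_eq by measurable

text \<open>Smoothing displaces a point by a Gaussian vector whose two coordinates each have mean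
  absolute value at most \<open>h\<close>. A \<open>K\<close>-Lipschitz function therefore changes
  its mean by at most \<open>2 * K * h\<close>, whatever the law.\<close>

lemma Lipschitz_smoothed_density:
  fixes f :: "complex \<Rightarrow> real"
  assumes h: "h > 0" and mu: "prob_space \<mu>" and sets: "sets \<mu> = sets borel"
    and f[measurable]: "f \<in> borel_measurable borel" and B: "\<And>z. \<bar>f z\<bar> \<le> B"
    and K: "\<And>z w. \<bar>f z - f w\<bar> \<le> K * cmod (z - w)" and K0: "K \<ge> 0"
  shows "\<bar>(LINT p|(lborel \<Otimes>\<^sub>M lborel). f (Complex (fst p) (snd p)) * smoothed_density h \<mu> p) - (LINT z|\<mu>. f z)\<bar>
           \<le> 2 * K * h"
proof -
  note [measurable_cong] = sets
  interpret mu: prob_space \<mu> by fact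
  let ?L = "lborel \<Otimes>\<^sub>M lborel :: (real \<times> real) measure"
  define k where "k z p = normal_density 0 h (fst p - Re z) * normal_density 0 h (snd p - Im z)" for z p
  let ?f = "\<lambda>p. f (Complex (fst p) (snd p))"
  have B0: "B \<ge> 0" using B[of 0] by simp
  have k0: "k z p \<ge> 0" for z p by (simp add: k_def)
  have [measurable]: "case_prod k \<in> borel_measurable (\<mu> \<Otimes>\<^sub>M ?L)" "k z \<in> borel_measurable ?L" for z
    unfolding k_def by measurable
  have k1: "(\<integral>\<^sup>+p. ennreal (k z p) \<partial>?L) = 1" for z
    unfolding k_def by (rule nn_integral_normal_density_prod[OF h])
  have kI: "integrable ?L (k z)" for z
    by (rule integrableI_bounded) (auto simp: k0 k1)
  have kint: "(LINT p|?L. k z p) = 1" for z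
    using nn_integral_eq_integral[OF kI, of z] k0 k1[of z] by simp
  have Lsf: "sigma_finite_measure ?L"
    by (simp add: lborel_prod lborel.sigma_finite_measure_axioms)
  then interpret P: pair_sigma_finite \<mu> ?L
    by (intro pair_sigma_finite.intro mu.sigma_finite_measure_axioms)
  have fkI: "integrable ?L (\<lambda>p. ?f p * k z p)" for z
    by (rule Bochner_Integration.integrable_bound[where f="\<lambda>p. B * k z p"])
       (auto intro!: kI mult_mono simp: abs_mult k0 B B0)
  have int2: "integrable (\<mu> \<Otimes>\<^sub>M ?L) (\<lambda>(z, p). ?f p * k z p)"
  proof (rule Bochner_Integration.integrable_bound[where f="\<lambda>(z,p). B * k z p"])
    have "(\<integral>\<^sup>+x. ennreal (norm (case_prod k x)) \<partial>(\<mu> \<Otimes>\<^sub>M ?L)) = (\<integral>\<^sup>+z. \<integral>\<^sup>+p. ennreal (k z p) \<partial>?L \<partial>\<mu>)"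
      by (subst sigma_finite_measure.nn_integral_fst[OF Lsf, symmetric]) (auto simp: k0)
    also have "\<dots> = 1" by (simp add: k1 mu.emeasure_space_1)
    finally have "integrable (\<mu> \<Otimes>\<^sub>M ?L) (case_prod k)"
      by (intro integrableI_bounded) auto
    then show "integrable (\<mu> \<Otimes>\<^sub>M ?L) (\<lambda>(z, p). B * k z p)"
      by (simp add: case_prod_unfold)
  qed (auto intro!: AE_I2 mult_mono simp: abs_mult k0 B B0)
  have "(LINT p|?L. ?f p * smoothed_density h \<mu> p) = (LINT p|?L. LINT z|\<mu>. ?f p * k z p)"
    by (simp add: smoothed_density_def k_def)
  also have "\<dots> = (LINT z|\<mu>. LINT p|?L. ?f p * k z p)"
    by (rule P.Fubini_integral[OF int2])
  finally have eq: "(LINT p|?L. ?f p * smoothed_density h \<mu> p) = (LINT z|\<mu>. LINT p|?L. ?f p * k z p)" .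
  have inner: "\<bar>(LINT p|?L. ?f p * k z p) - f z\<bar> \<le> 2 * K * h" for z
  proof -
    have "(LINT p|?L. ?f p * k z p) - f z = (LINT p|?L. ?f p * k z p - f z * k z p)"
      by (subst Bochner_Integration.integral_diff[OF fkI]) (auto simp: kI kint)
    then have "ennreal \<bar>(LINT p|?L. ?f p * k z p) - f z\<bar> \<le> (\<integral>\<^sup>+p. norm (?f p * k z p - f z * k z p) \<partial>?L)"
      using integral_norm_bound_ennreal[of ?L "\<lambda>p. ?f p * k z p - f z * k z p"] fkI kI by auto
    also have "\<dots> \<le> (\<integral>\<^sup>+p. ennreal K * ennreal ((\<bar>fst p - Re z\<bar> + \<bar>snd p - Im z\<bar>) * k z p) \<partial>?L)"
    proof (rule nn_integral_mono)
      fix p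
      have "norm (?f p * k z p - f z * k z p) = \<bar>?f p - f z\<bar> * k z p"
        by (simp add: abs_mult k0 flip: left_diff_distrib)
      also have "\<dots> \<le> K * (\<bar>fst p - Re z\<bar> + \<bar>snd p - Im z\<bar>) * k z p"
        using K0 cmod_le[of "Complex (fst p) (snd p) - z"]
        by (intro mult_right_mono[OF order_trans[OF K]] mult_left_mono) (auto simp: k0)
      finally show "ennreal (norm (?f p * k z p - f z * k z p)) \<le>
        ennreal K * ennreal ((\<bar>fst p - Re z\<bar> + \<bar>snd p - Im z\<bar>) * k z p)"
        using K0 by (simp add: ennreal_mult[symmetric] k0 mult.assoc ennreal_leI)
    qed
    also have "\<dots> = ennreal K * (\<integral>\<^sup>+p. ennreal ((\<bar>fst p - Re z\<bar> + \<bar>snd p - Im z\<bar>) * k z p) \<partial>?L)"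
      by (rule nn_integral_cmult) measurable
    also have "\<dots> \<le> ennreal K * ennreal (2 * h)"
      unfolding k_def by (intro mult_left_mono nn_integral_normal_density_dist_le h) auto
    also have "\<dots> = ennreal (2 * K * h)" using K0 h by (simp add: ennreal_mult[symmetric] mult_ac)
    finally show ?thesis using K0 h by (subst (asm) ennreal_le_iff) auto
  qed
  have I1: "integrable \<mu> (\<lambda>z. LINT p|?L. ?f p * k z p)"
    using P.integrable_fst[OF int2] by simp
  have I2: "integrable \<mu> f"
    by (rule mu.integrable_const_bound[of _ B]) (auto simp: B)
  have "\<bar>(LINT z|\<mu>. LINT p|?L. ?f p * k z p) - (LINT z|\<mu>. f z)\<bar> = \<bar>LINT z|\<mu>. (LINT p|?L. ?f p * k z p) - f z\<bar>"
    using I1 I2 by simp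
  also have "\<dots> \<le> (LINT z|\<mu>. \<bar>(LINT p|?L. ?f p * k z p) - f z\<bar>)"
    by (rule integral_abs_bound)
  also have "\<dots> \<le> (LINT z|\<mu>. 2 * K * h)"
    using I1 I2 inner by (intro integral_mono) auto
  finally show ?thesis using eq by (simp add: mu.prob_space)
qed

text \<open>The limit is given as a probability law, so the smoothed densities converge pointwise to
  a density of the same total mass and Scheffe's lemma upgrades this to convergence in L1; this
  takes the place of a tightness argument. The smoothing error is uniform in
  \<open>n\<close>.\<close>

lemma Lipschitz_integral_tendsto:
  fixes f :: "complex \<Rightarrow> real"
  assumes mu: "\<And>n. prob_space (\<mu> n)" and sets: "\<And>n. sets (\<mu> n) = sets borel"
    and mu': "prob_space \<mu>'" and sets': "sets \<mu>' = sets borel"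
    and lim: "\<And>u. (\<lambda>n. complex_char (\<mu> n) u) \<longlonglongrightarrow> complex_char \<mu>' u"
    and f[measurable]: "f \<in> borel_measurable borel" and B: "\<And>z. \<bar>f z\<bar> \<le> B"
    and K: "\<And>z w. \<bar>f z - f w\<bar> \<le> K * cmod (z - w)" and K0: "K \<ge> 0"
  shows "(\<lambda>n. LINT z|\<mu> n. f z) \<longlonglongrightarrow> (LINT z|\<mu>'. f z)"
proof (rule LIMSEQ_I)
  let ?L = "lborel \<Otimes>\<^sub>M lborel :: (real \<times> real) measure"
  let ?f = "\<lambda>p. f (Complex (fst p) (snd p))"
  fix e :: real assume e: "e > 0"
  \<comment> \<open>With this \<open>h\<close> each of the two smoothing errors is at most
    \<open>e / 4\<close>; \<open>K + 1\<close> instead of \<open>K\<close> covers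
    \<open>K = 0\<close>.\<close>
  define h where "h = e / (4 * (K + 1) * 2)"
  have h: "h > 0" using e K0 by (simp add: h_def)
  have "2 * K * h \<le> 2 * (K + 1) * h" using h by simp
  also have "\<dots> = e / 4" using K0 by (simp add: h_def field_simps)
  finally have Kh: "2 * K * h \<le> e / 4" .
  note meas [measurable] = smoothed_density_measurable[OF mu sets] smoothed_density_measurable[OF mu' sets']
  have nn: "smoothed_density h \<nu> p \<ge> 0" for \<nu> p
    by (simp add: smoothed_density_def)
  have int1: "(\<integral>\<^sup>+p. ennreal (smoothed_density h \<nu> p) \<partial>?L) = 1"
    if "prob_space \<nu>" "sets \<nu> = sets borel" for \<nu>
  proof -
    interpret prob_space \<nu> by fact
    show ?thesis
      using nn_integral_smoothed_density[OF h that, of "\<lambda>_. 1"]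
      by (simp add: nn_integral_normal_density_prod[OF h] emeasure_space_1)
  qed
  have I: "integrable ?L (smoothed_density h \<nu>)"
    if "prob_space \<nu>" "sets \<nu> = sets borel" for \<nu>
    using smoothed_density_measurable[OF that] int1[OF that] nn by (intro integrableI_bounded) auto
  have I': "integrable ?L (\<lambda>p. ?f p * smoothed_density h \<nu> p)"
    if "prob_space \<nu>" "sets \<nu> = sets borel" for \<nu>
    using smoothed_density_measurable[OF that, measurable] B order_trans[OF abs_ge_zero B]
    by (intro Bochner_Integration.integrable_bound[OF integrable_mult_right[OF I[OF that], of B]])
       (auto simp: abs_mult intro!: mult_mono nn)
  have "(\<lambda>n. \<integral>\<^sup>+p. norm (smoothed_density h (\<mu> n) p - smoothed_density h \<mu>' p) \<partial>?L) \<longlonglongrightarrow> 0"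
    by (rule Scheffe_lemma2)
       (auto simp: I mu' sets' nn int1 mu sets intro!: smoothed_density_tendsto h lim meas)
  then have "(\<lambda>n. ennreal B * (\<integral>\<^sup>+p. norm (smoothed_density h (\<mu> n) p - smoothed_density h \<mu>' p) \<partial>?L)) \<longlonglongrightarrow> ennreal B * 0"
    by (intro ennreal_tendsto_cmult) auto
  then have "eventually (\<lambda>n. ennreal B * (\<integral>\<^sup>+p. norm (smoothed_density h (\<mu> n) p - smoothed_density h \<mu>' p) \<partial>?L) < ennreal (e / 4)) sequentially"
    by (rule order_tendstoD) (use e in auto)
  then have "eventually (\<lambda>n. norm ((LINT z|\<mu> n. f z) - (LINT z|\<mu>'. f z)) < e) sequentially"
  proof eventually_elim
    case (elim n)
    let ?d = "\<lambda>p. smoothed_density h (\<mu> n) p - smoothed_density h \<mu>' p"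
    have B0: "B \<ge> 0" using order_trans[OF abs_ge_zero B] .
    have "\<bar>(LINT p|?L. ?f p * smoothed_density h (\<mu> n) p) - (LINT p|?L. ?f p * smoothed_density h \<mu>' p)\<bar>
       = \<bar>LINT p|?L. ?f p * ?d p\<bar>"
      by (simp add: I' mu sets mu' sets' right_diff_distrib)
    also have "ennreal \<dots> \<le> (\<integral>\<^sup>+p. norm (?f p * ?d p) \<partial>?L)"
      using integral_norm_bound_ennreal[of ?L "\<lambda>p. ?f p * ?d p"] I'[OF mu sets, of n] I'[OF mu' sets']
      by (simp add: right_diff_distrib)
    also have "\<dots> \<le> (\<integral>\<^sup>+p. ennreal B * norm (?d p) \<partial>?L)"
      using B B0 by (intro nn_integral_mono) (auto simp: abs_mult ennreal_mult[symmetric] intro!: ennreal_leI mult_right_mono)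
    also have "\<dots> = ennreal B * (\<integral>\<^sup>+p. norm (?d p) \<partial>?L)"
      by (intro nn_integral_cmult) auto
    also note elim
    finally have "\<bar>(LINT p|?L. ?f p * smoothed_density h (\<mu> n) p) - (LINT p|?L. ?f p * smoothed_density h \<mu>' p)\<bar> < e / 4"
      using e by (subst (asm) ennreal_less_iff) auto
    with Lipschitz_smoothed_density[OF h mu sets f B K K0, of n] Lipschitz_smoothed_density[OF h mu' sets' f B K K0] Kh
    show ?case using e by (auto simp: abs_real_def split: if_splits)
  qed
  then show "\<exists>no. \<forall>n\<ge>no. norm ((LINT z|\<mu> n. f z) - (LINT z|\<mu>'. f z)) < e"
    by (simp add: eventually_sequentially)
qed

text \<open>The Pasch-Hausdorff envelope: for bounded \<open>f\<close> and nonnegative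
  \<open>k\<close>, the largest \<open>k\<close>-Lipschitz function below \<open>f\<close>. It
  reduces bounded continuous test functions to Lipschitz ones.\<close>

definition inf_convolution :: "('a::metric_space \<Rightarrow> real) \<Rightarrow> real \<Rightarrow> 'a \<Rightarrow> real" where
  "inf_convolution f k x = (INF y. f y + k * dist x y)"

context
  fixes f :: "'a::metric_space \<Rightarrow> real" and B k :: real
  assumes B: "\<And>x. \<bar>f x\<bar> \<le> B" and k: "k \<ge> 0"
begin

lemma inf_convolution_bdd: "bdd_below (range (\<lambda>y. f y + k * dist x y))"
proof (rule bdd_belowI2[of _ "-B"])
  fix y show "- B \<le> f y + k * dist x y" using B[of y] mult_nonneg_nonneg[OF k zero_le_dist[of x y]] by linarith
qed

lemma inf_convolution_le: "inf_convolution f k x \<le> f x"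
  unfolding inf_convolution_def using inf_convolution_bdd by (rule cINF_lower2[where x=x]) auto

lemma inf_convolution_lower: "inf_convolution f k x \<ge> - B"
  unfolding inf_convolution_def
proof (rule cINF_greatest)
  fix y show "- B \<le> f y + k * dist x y" using B[of y] mult_nonneg_nonneg[OF k zero_le_dist[of x y]] by linarith
qed auto

lemma inf_convolution_abs_le: "\<bar>inf_convolution f k x\<bar> \<le> B"
  using inf_convolution_le[of x] inf_convolution_lower[of x] B[of x] by auto

lemma inf_convolution_Lipschitz: "\<bar>inf_convolution f k x - inf_convolution f k y\<bar> \<le> k * dist x y"
proof -
  have *: "inf_convolution f k x \<le> inf_convolution f k y + k * dist x y" for x y
  proof -
    have "inf_convolution f k x - k * dist x y \<le> inf_convolution f k y"
      unfolding inf_convolution_def[of f k y]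
    proof (rule cINF_greatest)
      fix w
      have "inf_convolution f k x \<le> f w + k * dist x w"
        unfolding inf_convolution_def using inf_convolution_bdd by (rule cINF_lower2[where x=w]) auto
      also have "k * dist x w \<le> k * (dist x y + dist y w)"
        using k dist_triangle by (intro mult_left_mono) auto
      finally show "inf_convolution f k x - k * dist x y \<le> f w + k * dist y w"
        by (simp add: algebra_simps)
    qed auto
    then show ?thesis by simp
  qed
  show ?thesis using *[of x y] *[of y x] by (auto simp: dist_commute abs_real_def)
qed

end

lemma inf_convolution_tendsto:
  fixes f :: "'a::metric_space \<Rightarrow> real"
  assumes B: "\<And>x. \<bar>f x\<bar> \<le> B" and c: "isCont f x"
  shows "(\<lambda>k. inf_convolution f (real k) x) \<longlonglongrightarrow> f x"
proof (rule LIMSEQ_I)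
  fix e :: real assume e: "e > 0"
  obtain d where d: "d > 0" "\<And>y. dist y x < d \<Longrightarrow> dist (f y) (f x) < e / 2"
    using c e unfolding continuous_at_eps_delta by (metis half_gt_zero)
  \<comment> \<open>Beyond distance \<open>d\<close> the penalty exceeds the oscillation
    \<open>2 * B\<close> of \<open>f\<close>, so the infimum is decided within the ball on which
    \<open>f\<close> is nearly constant.\<close>
  obtain K :: nat where K: "real K * d > 2 * B"
    using d(1) reals_Archimedean3 by blast
  show "\<exists>no. \<forall>k\<ge>no. norm (inf_convolution f (real k) x - f x) < e"
  proof (intro exI allI impI)
    fix k assume k: "k \<ge> K"
    have "f x - e / 2 \<le> inf_convolution f (real k) x"
      unfolding inf_convolution_def
    proof (rule cINF_greatest)
      fix y
      show "f x - e / 2 \<le> f y + real k * dist x y"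
      proof (cases "dist x y < d")
        case True
        then have "f x - e / 2 \<le> f y" using d(2)[of y] by (simp add: dist_commute dist_real_def abs_real_def split: if_splits)
        then show ?thesis by (simp add: add_increasing2)
      next
        case False
        have "real K * d \<le> real k * dist x y" using False k d(1) by (intro mult_mono) auto
        then show ?thesis using K B[of x] B[of y] e by auto
      qed
    qed auto
    with inf_convolution_le[of f B "real k" x] B e show "norm (inf_convolution f (real k) x - f x) < e"
      by auto
  qed
qed

text \<open>Lipschitz minorants bound the integrals of \<open>f\<close> eventually from below by
  nearly the limiting integral. The same bound for \<open>- f\<close> closes the gap.\<close>

lemma integral_tendsto_of_complex_char:
  fixes f :: "complex \<Rightarrow> real"
  assumes mu: "\<And>n. prob_space (\<mu> n)" and sets: "\<And>n. sets (\<mu> n) = sets borel"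
    and mu': "prob_space \<mu>'" and sets': "sets \<mu>' = sets borel"
    and lim: "\<And>u. (\<lambda>n. complex_char (\<mu> n) u) \<longlonglongrightarrow> complex_char \<mu>' u"
    and f: "continuous_on UNIV f" and B: "\<And>z. \<bar>f z\<bar> \<le> B"
  shows "(\<lambda>n. LINT z|\<mu> n. f z) \<longlonglongrightarrow> (LINT z|\<mu>'. f z)"
proof -
  have lower: "eventually (\<lambda>n. (LINT z|\<mu> n. f z) > (LINT z|\<mu>'. f z) - e) sequentially"
    if f: "continuous_on UNIV f" and B: "\<And>z. \<bar>f z\<bar> \<le> B" and e: "e > 0" for f :: "complex \<Rightarrow> real" and e
  proof -
    interpret mu': prob_space \<mu>' by fact
    let ?g = "\<lambda>k. inf_convolution f (real k)"
    have Lip: "\<bar>?g k z - ?g k w\<bar> \<le> real k * cmod (z - w)" for k z w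
      using inf_convolution_Lipschitz[of f B "real k" z w] B by (simp add: dist_norm)
    have gc: "continuous_on UNIV (?g k)" for k
    proof -
      have "(real k)-lipschitz_on UNIV (?g k)"
        using Lip by (intro lipschitz_onI) (auto simp: dist_real_def dist_norm)
      then show ?thesis by (rule lipschitz_on_continuous_on)
    qed
    have [measurable]: "?g k \<in> borel_measurable borel" "f \<in> borel_measurable borel" for k
      using gc f by (auto intro: borel_measurable_continuous_onI)
    have gB: "\<bar>?g k z\<bar> \<le> B" for k z using inf_convolution_abs_le[of f B "real k" z] B by simp
    have "(\<lambda>k. LINT z|\<mu>'. ?g k z) \<longlonglongrightarrow> (LINT z|\<mu>'. f z)"
      using f by (intro integral_dominated_convergence[where w="\<lambda>_. B"])
        (auto simp: sets' gB measurable_cong_sets[OF sets' refl] continuous_on_eq_continuous_at intro!: inf_convolution_tendsto B)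
    then have "eventually (\<lambda>k. (LINT z|\<mu>'. ?g k z) > (LINT z|\<mu>'. f z) - e) sequentially"
      by (rule order_tendstoD) (use e in auto)
    then obtain k where k: "(LINT z|\<mu>'. ?g k z) > (LINT z|\<mu>'. f z) - e"
      by (auto simp: eventually_sequentially)
    have "(\<lambda>n. LINT z|\<mu> n. ?g k z) \<longlonglongrightarrow> (LINT z|\<mu>'. ?g k z)"
      by (rule Lipschitz_integral_tendsto[OF mu sets mu' sets' lim _ gB Lip]) auto
    then have "eventually (\<lambda>n. (LINT z|\<mu> n. ?g k z) > (LINT z|\<mu>'. f z) - e) sequentially"
      by (rule order_tendstoD) (use k in auto)
    then show ?thesis
    proof eventually_elim
      case (elim n)
      interpret mu: prob_space "\<mu> n" by (rule mu)
      have "(LINT z|\<mu> n. ?g k z) \<le> (LINT z|\<mu> n. f z)"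
        by (intro integral_mono mu.integrable_const_bound[of _ B])
           (auto simp: measurable_cong_sets[OF sets refl] gB B intro!: inf_convolution_le[of f B])
      with elim show ?case by simp
    qed
  qed
  show ?thesis
  proof (rule LIMSEQ_I)
    fix e :: real assume e: "e > 0"
    have "eventually (\<lambda>n. (LINT z|\<mu> n. - f z) > (LINT z|\<mu>'. - f z) - e) sequentially"
      by (rule lower) (use f B e in \<open>auto intro!: continuous_intros\<close>)
    with lower[OF f B e] have "eventually (\<lambda>n. norm ((LINT z|\<mu> n. f z) - (LINT z|\<mu>'. f z)) < e) sequentially"
      by eventually_elim (auto simp: abs_real_def)
    then show "\<exists>no. \<forall>n\<ge>no. norm ((LINT z|\<mu> n. f z) - (LINT z|\<mu>'. f z)) < e"
      by (simp add: eventually_sequentially)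
  qed
qed

lemma converges_in_distribution_of_complex_char:
  fixes X :: "nat \<Rightarrow> 'a \<Rightarrow> complex" and Y :: "'b \<Rightarrow> complex"
  assumes M: "\<And>n. prob_space (M n)" and M': "prob_space M'"
    and X[measurable]: "\<And>n. X n \<in> borel_measurable (M n)" and Y[measurable]: "Y \<in> borel_measurable M'"
    and lim: "\<And>u. (\<lambda>n. CLINT \<omega>|M n. iexp (Re (u * X n \<omega>))) \<longlonglongrightarrow> (CLINT \<omega>|M'. iexp (Re (u * Y \<omega>)))"
  shows "converges_in_distribution M X M' Y"
  unfolding converges_in_distribution_def
proof (intro allI impI)
  fix f :: "complex \<Rightarrow> real" assume f: "continuous_on UNIV f \<and> bounded (range f)"
  then obtain B where B: "\<And>z. \<bar>f z\<bar> \<le> B" by (auto simp: bounded_iff)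
  have [measurable]: "f \<in> borel_measurable borel"
    using f by (auto intro: borel_measurable_continuous_onI)
  have "(\<lambda>n. LINT z|distr (M n) borel (X n). f z) \<longlonglongrightarrow> (LINT z|distr M' borel Y. f z)"
    by (rule integral_tendsto_of_complex_char)
       (use f B lim in \<open>auto simp: complex_char_def integral_distr intro!: prob_space.prob_space_distr M M' simp del: of_real_mult\<close>)
  then show "(\<lambda>n. LINT \<omega>|M n. f (X n \<omega>)) \<longlonglongrightarrow> (LINT \<omega>|M'. f (Y \<omega>))"
    by (simp add: integral_distr)
qed

section \<open>Characteristic functions of tree sums\<close>

text \<open>Fubini for the product law of an independent pair: freeze the first variable and average
  over the second. Every later conditioning step, in the tree, in the cascade and in the Gaussian
  mixture, goes through this form.\<close>

lemma (in prob_space) indep_var_integral: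
  fixes f :: "'b \<times> 'b \<Rightarrow> 'd::{banach, second_countable_topology}"
  assumes ind: "indep_var S X T Y" and f[measurable]: "f \<in> borel_measurable (S \<Otimes>\<^sub>M T)"
    and B: "\<And>p. norm (f p) \<le> B"
  shows "(\<integral>\<omega>. f (X \<omega>, Y \<omega>) \<partial>M) = (\<integral>x. (\<integral>\<omega>. f (x, Y \<omega>) \<partial>M) \<partial>distr M S X)"
proof -
  have X[measurable]: "random_variable S X" and Y[measurable]: "random_variable T Y"
    using ind by (auto dest: indep_var_rv1 indep_var_rv2)
  interpret X: prob_space "distr M S X" by (rule prob_space_distr) fact
  interpret Y: prob_space "distr M T Y" by (rule prob_space_distr) fact
  interpret XY: pair_prob_space "distr M S X" "distr M T Y" ..
  have "(\<integral>\<omega>. f (X \<omega>, Y \<omega>) \<partial>M) = (\<integral>p. f p \<partial>distr M (S \<Otimes>\<^sub>M T) (\<lambda>\<omega>. (X \<omega>, Y \<omega>)))"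
    by (subst integral_distr) auto
  also have "distr M (S \<Otimes>\<^sub>M T) (\<lambda>\<omega>. (X \<omega>, Y \<omega>)) = distr M S X \<Otimes>\<^sub>M distr M T Y"
    using ind by (simp add: indep_var_distribution_eq)
  also have "(\<integral>p. f p \<partial>(distr M S X \<Otimes>\<^sub>M distr M T Y)) = (\<integral>x. (\<integral>y. f (x, y) \<partial>distr M T Y) \<partial>distr M S X)"
    by (rule XY.integral_fst'[symmetric])
       (auto intro!: XY.integrable_const_bound[of _ B] B)
  also have "\<dots> = (\<integral>x. (\<integral>\<omega>. f (x, Y \<omega>) \<partial>M) \<partial>distr M S X)"
    by (intro Bochner_Integration.integral_cong refl integral_distr) auto
  finally show ?thesis .
qed

lemma (in prob_space) indep_vars_reindex:
  assumes ind: "indep_vars M' X I" and f: "inj_on f L" "f ` L \<subseteq> I"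
  shows "indep_vars (\<lambda>j. M' (f j)) (\<lambda>j. X (f j)) L"
proof -
  have "indep_vars (\<lambda>j. PiM {f j} M') (\<lambda>j \<omega>. restrict (\<lambda>i. X i \<omega>) {f j}) L"
    by (rule indep_vars_restrict[OF ind]) (use f in \<open>auto simp: disjoint_family_on_def inj_on_def\<close>)
  from indep_vars_compose2[OF this, of "\<lambda>j g. g (f j)" "\<lambda>j. M' (f j)"]
  show ?thesis by simp
qed

text \<open>The list runs from the root downwards and gives for each level the number of children
  and the coefficient of the Gaussian. A leaf contributes the constant 1, whence the base case. No
  probability space occurs in the recursion, so whatever normalization is extracted from it is
  deterministic and common to all realizations of the disorder.\<close>

fun iter_char :: "(nat \<times> complex) list \<Rightarrow> complex \<Rightarrow> complex" where
  "iter_char [] u = iexp (Re u)"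
| "iter_char ((N, b) # L) u = (CLINT x|std_normal_distribution. iter_char L (u * exp (b * of_real x))) ^ N"

lemma prob_space_std_normal: "prob_space std_normal_distribution"
  by (rule real_dist_normal_dist[THEN real_distribution.axioms(1)])

lemma iter_char_measurable [measurable]: "iter_char L \<in> borel_measurable borel"
proof (induction L)
  case Nil
  have "iter_char [] = (\<lambda>u. iexp (Re u))" by (simp add: fun_eq_iff)
  then show ?case by simp
next
  case (Cons a L)
  interpret prob_space std_normal_distribution by (rule prob_space_std_normal)
  note [measurable] = Cons
  obtain N b where a: "a = (N, b)" by force
  have "iter_char (a # L) = (\<lambda>u. (CLINT x|std_normal_distribution. iter_char L (u * exp (b * of_real x))) ^ N)"
    by (simp add: fun_eq_iff a)
  then show ?case by simp
qed

lemma norm_integral_std_normal_le: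
  fixes f :: "real \<Rightarrow> complex"
  assumes "\<And>x. cmod (f x) \<le> 1"
  shows "cmod (CLINT x|std_normal_distribution. f x) \<le> 1"
proof -
  interpret prob_space std_normal_distribution by (rule prob_space_std_normal)
  show ?thesis
  proof (cases "integrable std_normal_distribution f")
    case True
    have "cmod (CLINT x|std_normal_distribution. f x) \<le> (LINT x|std_normal_distribution. cmod (f x))"
      by (rule integral_norm_bound)
    also have "\<dots> \<le> (LINT x|std_normal_distribution. 1)"
      using True assms by (intro integral_mono) auto
    finally show ?thesis using prob_space by simp
  next
    case False
    then show ?thesis by (simp add: not_integrable_integral_eq)
  qed
qed

lemma norm_iter_char_le_1: "cmod (iter_char L u) \<le> 1"
proof (induction L arbitrary: u)
  case (Cons a L)
  obtain N b where a: "a = (N, b)" by force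
  show ?case
    unfolding a by (auto simp: norm_power intro!: power_le_one norm_integral_std_normal_le Cons)
qed simp

text \<open>Absorbing the inverse temperature, \<open>sqrt n\<close> and the standard deviations
  into one complex coefficient per level makes the part of the tree below a first-level vertex an
  object of the same kind, with parameters shifted by one.\<close>

definition tree_sum ::
  "nat \<Rightarrow> (nat \<Rightarrow> complex) \<Rightarrow> (nat \<Rightarrow> nat \<Rightarrow> nat) \<Rightarrow> nat \<Rightarrow> (nat list \<Rightarrow> 'a \<Rightarrow> real) \<Rightarrow> 'a \<Rightarrow> complex" where
  "tree_sum d b N n \<xi> \<omega> = (\<Sum>e\<in>grem_indices N n d. exp (\<Sum>j=1..d. b j * of_real (\<xi> (take j e) \<omega>)))"

lemma grem_indices_0 [simp]: "grem_indices N n 0 = {[]}"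
  by (auto simp: grem_indices_def)

lemma grem_indices_Suc:
  "grem_indices N n (Suc j) = (\<lambda>(i, e). i # e) ` ({1..N n 1} \<times> grem_indices (\<lambda>n j. N n (Suc j)) n j)"
proof -
  have "f \<in> grem_indices N n (Suc j) \<longleftrightarrow>
    (\<exists>i e. f = i # e \<and> i \<in> {1..N n 1} \<and> e \<in> grem_indices (\<lambda>n j. N n (Suc j)) n j)" for f
    by (cases f) (auto simp: grem_indices_def All_less_Suc2)
  then show ?thesis by (auto simp: image_iff)
qed

lemma grem_indices_take: "e \<in> grem_indices N n d \<Longrightarrow> j \<le> d \<Longrightarrow> take j e \<in> grem_indices N n j"
  by (auto simp: grem_indices_def)

lemma tree_sum_Suc:
  "tree_sum (Suc d) b N n \<xi> \<omega> = (\<Sum>i=1..N n 1. exp (b 1 * of_real (\<xi> [i] \<omega>)) *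
     tree_sum d (\<lambda>j. b (Suc j)) (\<lambda>n j. N n (Suc j)) n (\<lambda>e. \<xi> (i # e)) \<omega>)"
proof -
  have *: "(\<Sum>j=1..Suc d. b j * of_real (\<xi> (take j (i # e)) \<omega>)) =
      b 1 * of_real (\<xi> [i] \<omega>) + (\<Sum>j=1..d. b (Suc j) * of_real (\<xi> (i # take j e) \<omega>))" for i e
    by (subst sum.atLeast_Suc_atMost, simp, subst sum.atLeast_Suc_atMost_Suc_shift) simp
  show ?thesis
    unfolding tree_sum_def grem_indices_Suc
    by (subst sum.reindex) (auto simp: inj_on_def sum.cartesian_product' *[unfolded One_nat_def] exp_add sum_distrib_left
        simp del: sum.cl_ivl_Suc)
qed

text \<open>Induction on the depth. The variables whose index starts with \<open>i\<close> form a
  block, and disjoint blocks are independent, which produces the power; inside a block the variable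
  at the vertex itself is independent of those at strict descendants, which produces the Gaussian
  integral.\<close>

lemma tree_sum_char:
  assumes "prob_space M"
    and "prob_space.indep_vars M (\<lambda>_. borel) \<xi> (\<Union>j\<in>{1..d}. grem_indices N n j)"
    and "\<And>e. e \<in> (\<Union>j\<in>{1..d}. grem_indices N n j) \<Longrightarrow> distributed M lborel (\<xi> e) std_normal_density"
  shows "tree_sum d b N n \<xi> \<in> borel_measurable M"
    and "(CLINT \<omega>|M. iexp (Re (u * tree_sum d b N n \<xi> \<omega>))) = iter_char (map (\<lambda>j. (N n j, b j)) [1..<Suc d]) u"
proof -
  interpret prob_space M by fact
  have rv: "\<xi> e \<in> borel_measurable M" if "e \<in> (\<Union>j\<in>{1..d}. grem_indices N n j)" for e
    using assms(2) that unfolding indep_vars_def by blast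
  have "(\<lambda>\<omega>. complex_of_real (\<xi> (take j e) \<omega>)) \<in> borel_measurable M"
    if "e \<in> grem_indices N n d" "j \<in> {1..d}" for e j
    by (rule measurable_compose[OF rv borel_measurable_of_real])
      (rule UN_I[OF that(2)], use grem_indices_take[OF that(1), of j] that(2) in simp)
  then show "tree_sum d b N n \<xi> \<in> borel_measurable M"
    unfolding tree_sum_def
    by (intro borel_measurable_sum measurable_compose[OF _ borel_measurable_exp] borel_measurable_times
      borel_measurable_const) auto
  show "(CLINT \<omega>|M. iexp (Re (u * tree_sum d b N n \<xi> \<omega>))) = iter_char (map (\<lambda>j. (N n j, b j)) [1..<Suc d]) u"
    using assms(2,3)
  proof (induction d arbitrary: b N \<xi> u)
    case 0
    then show ?case by (simp add: tree_sum_def prob_space)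
  next
    case (Suc d)
    let ?I = "\<Union>j\<in>{1..Suc d}. grem_indices N n j"
    define N' where "N' = (\<lambda>n j. N n (Suc j))"
    define b' where "b' = (\<lambda>j. b (Suc j))"
    let ?I' = "\<Union>j\<in>{1..d}. grem_indices N' n j"
    define L where "L = map (\<lambda>j. (N' n j, b' j)) [1..<Suc d]"
    define Ti where "Ti i = tree_sum d b' N' n (\<lambda>e. \<xi> (i # e))" for i
    have memI: "i # e \<in> ?I" if i: "i \<in> {1..N n 1}" and e: "e \<in> ?I' \<or> e = []" for i e
    proof (cases "e = []")
      case True
      then have "i # e \<in> grem_indices N n 1" using i by (auto simp: grem_indices_Suc)
      then show ?thesis by force
    next
      case False
      then obtain j where j: "j \<in> {1..d}" "e \<in> grem_indices N' n j" using e by auto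
      then have "i # e \<in> grem_indices N n (Suc j)" using i j by (auto simp: grem_indices_Suc N'_def)
      then show ?thesis using j by force
    qed
    have rv: "\<xi> e \<in> borel_measurable M" if "e \<in> ?I" for e
      using Suc.prems(1) that unfolding indep_vars_def by blast
    \<comment> \<open>\<open>K' i\<close> holds the strict descendants of the vertex
      \<open>[i]\<close>; \<open>K i\<close> adds the vertex itself.\<close>
    define K' where "K' i = (\<lambda>e. i # e) ` ?I'" for i
    define K where "K i = insert [i] (K' i)" for i
    have KI: "K i \<subseteq> ?I" if "i \<in> {1..N n 1}" for i
      using memI[OF that] unfolding K_def K'_def by blast
    have Ki: "[i] \<in> K i" for i by (simp add: K_def)
    have nil: "[] \<notin> ?I'" by (auto simp: grem_indices_def)
    \<comment> \<open>Independence is available for restricted families, so the subtree sum is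
      written as a function of such a family. It may read only entries in \<open>K' i\<close>, since
      \<open>restrict\<close> makes all others \<open>undefined\<close>.\<close>
    define F' where "F' i f = (\<Sum>e\<in>grem_indices N' n d. exp (\<Sum>j=1..d. b' j * complex_of_real (f (i # take j e))))"
      for i and f :: "nat list \<Rightarrow> real"
    have takeI: "take j e \<in> ?I'" if "e \<in> grem_indices N' n d" "j \<in> {1..d}" for e j
      by (rule UN_I[OF that(2)]) (use grem_indices_take[OF that(1)] that(2) in simp)
    have F'K': "F' i (restrict (\<lambda>e. \<xi> e \<omega>) (K' i)) = Ti i \<omega>" for i \<omega>
      unfolding F'_def Ti_def tree_sum_def
      by (intro sum.cong refl arg_cong[where f=exp]) (use takeI in \<open>auto simp: K'_def\<close>)
    have F'K: "F' i (restrict (\<lambda>e. \<xi> e \<omega>) (K i)) = Ti i \<omega>" for i \<omega>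
      unfolding F'_def Ti_def tree_sum_def
      by (intro sum.cong refl arg_cong[where f=exp]) (use takeI in \<open>auto simp: K_def K'_def\<close>)
    have F'm: "F' i \<in> borel_measurable (PiM A (\<lambda>_. borel))" if "K' i \<subseteq> A" for i A
      unfolding F'_def
      by (intro borel_measurable_sum measurable_compose[OF _ borel_measurable_exp] borel_measurable_times
          borel_measurable_const measurable_compose[OF _ borel_measurable_of_real] measurable_component_singleton)
         (use takeI that in \<open>auto simp: K'_def\<close>)
    define Y where "Y i \<omega> = exp (b 1 * of_real (\<xi> [i] \<omega>)) * Ti i \<omega>" for i \<omega>
    have indepY: "indep_vars (\<lambda>_. borel) Y {1..N n 1}"
    proof -
      have "indep_vars (\<lambda>i. PiM (K i) (\<lambda>_. borel)) (\<lambda>i \<omega>. restrict (\<lambda>e. \<xi> e \<omega>) (K i)) {1..N n 1}"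
        by (rule indep_vars_restrict[OF Suc.prems(1)])
          (use KI in \<open>auto simp: disjoint_family_on_def K_def K'_def\<close>)
      then have "indep_vars (\<lambda>_. borel)
          (\<lambda>i \<omega>. (\<lambda>f. exp (b 1 * complex_of_real (f [i])) * F' i f) (restrict (\<lambda>e. \<xi> e \<omega>) (K i))) {1..N n 1}"
        by (rule indep_vars_compose2)
           (auto intro!: borel_measurable_times F'm measurable_compose[OF _ borel_measurable_exp]
              measurable_compose[OF _ borel_measurable_of_real] measurable_component_singleton simp: K_def)
      then show ?thesis
        by (rule indep_vars_cong[THEN iffD1, rotated -1]) (auto simp: Y_def F'K Ki fun_eq_iff)
    qed
    have EY: "(CLINT \<omega>|M. iexp (Re (u * Y i \<omega>))) =
        (CLINT x|std_normal_distribution. iter_char L (u * exp (b 1 * of_real x)))"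
      if i: "i \<in> {1..N n 1}" for i
    proof -
      have ind: "indep_var (PiM {[i]} (\<lambda>_. borel)) (\<lambda>\<omega>. restrict (\<lambda>e. \<xi> e \<omega>) {[i]})
                  (PiM (K' i) (\<lambda>_. borel)) (\<lambda>\<omega>. restrict (\<lambda>e. \<xi> e \<omega>) (K' i))"
        by (rule indep_var_restrict[OF Suc.prems(1)])
           (use KI[OF i] nil in \<open>auto simp: K_def K'_def\<close>)
      have "indep_var borel ((\<lambda>f. complex_of_real (f [i])) \<circ> (\<lambda>\<omega>. restrict (\<lambda>e. \<xi> e \<omega>) {[i]}))
               borel (F' i \<circ> (\<lambda>\<omega>. restrict (\<lambda>e. \<xi> e \<omega>) (K' i)))"
        by (rule indep_var_compose[OF ind]) (auto intro!: F'm)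
      then have ind2: "indep_var borel (\<lambda>\<omega>. complex_of_real (\<xi> [i] \<omega>)) borel (Ti i)"
        by (simp add: comp_def F'K')
      have d: "distr M borel (\<xi> [i]) = std_normal_distribution"
        using Suc.prems(2)[of "[i]"] memI[OF i] by (simp add: distributed_def cong: distr_cong)
      have IH: "(CLINT \<omega>|M. iexp (Re (v * Ti i \<omega>))) = iter_char L v" for v
        unfolding Ti_def L_def
      proof (rule Suc.IH)
        show "indep_vars (\<lambda>_. borel) (\<lambda>e. \<xi> (i # e)) ?I'"
          using KI[OF i] by (intro indep_vars_reindex[OF Suc.prems(1)]) (auto simp: K_def K'_def inj_on_def)
        show "distributed M lborel (\<xi> (i # e)) std_normal_density" if "e \<in> ?I'" for e
          using memI[OF i] that by (intro Suc.prems(2)) blast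
      qed
      have "(CLINT \<omega>|M. iexp (Re (u * Y i \<omega>))) =
         (CLINT \<omega>|M. (\<lambda>(x, t). iexp (Re (u * (exp (b 1 * x) * t)))) (complex_of_real (\<xi> [i] \<omega>), Ti i \<omega>))"
        by (simp add: Y_def)
      also have "\<dots> = (CLINT x|distr M borel (\<lambda>\<omega>. complex_of_real (\<xi> [i] \<omega>)).
          (CLINT \<omega>|M. iexp (Re (u * (exp (b 1 * x) * Ti i \<omega>)))))"
        by (subst indep_var_integral[OF ind2, where B=1]) (auto simp: case_prod_unfold simp del: of_real_mult)
      also have "\<dots> = (CLINT x|distr M borel (\<lambda>\<omega>. complex_of_real (\<xi> [i] \<omega>)). iter_char L (u * exp (b 1 * x)))"
        by (simp add: IH mult.assoc[symmetric] del: times_complex.sel)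
      also have "\<dots> = (CLINT x|distr M borel (\<xi> [i]). iter_char L (u * exp (b 1 * of_real x)))"
        using rv[of "[i]"] memI[OF i] by (simp add: integral_distr)
      also have "\<dots> = (CLINT x|std_normal_distribution. iter_char L (u * exp (b 1 * of_real x)))"
        unfolding d ..
      finally show ?thesis .
    qed
    have "(CLINT \<omega>|M. iexp (Re (u * tree_sum (Suc d) b N n \<xi> \<omega>))) =
        (CLINT \<omega>|M. \<Prod>i=1..N n 1. iexp (Re (u * Y i \<omega>)))"
      unfolding tree_sum_Suc Y_def Ti_def b'_def N'_def
      by (simp add: exp_sum[symmetric] sum_distrib_left Re_sum)
    also have "\<dots> = (\<Prod>i=1..N n 1. CLINT \<omega>|M. iexp (Re (u * Y i \<omega>)))"
    proof (rule indep_vars_lebesgue_integral)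
      show "indep_vars (\<lambda>_. borel) (\<lambda>i \<omega>. iexp (Re (u * Y i \<omega>))) {1..N n 1}"
        using indep_vars_compose2[OF indepY, of "\<lambda>_ z. iexp (Re (u * z))" "\<lambda>_. borel"] by simp
      show "integrable M (\<lambda>\<omega>. iexp (Re (u * Y i \<omega>)))" if "i \<in> {1..N n 1}" for i
      proof (rule integrable_const_bound[of _ 1])
        have [measurable]: "Y i \<in> borel_measurable M"
          using indepY that by (auto simp: indep_vars_def)
        show "(\<lambda>\<omega>. iexp (Re (u * Y i \<omega>))) \<in> borel_measurable M" by measurable
      qed (simp del: of_real_mult)
    qed simp
    also have "\<dots> = (CLINT x|std_normal_distribution. iter_char L (u * exp (b 1 * of_real x))) ^ N n 1"
      by (subst prod.cong[OF refl EY]) simp_all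
    also have "\<dots> = iter_char (map (\<lambda>j. (N n j, b j)) [1..<Suc (Suc d)]) u"
      unfolding L_def N'_def b'_def by (subst (2) upt_conv_Cons) (auto simp: map_Suc_upt[symmetric] comp_def simp del: upt_Suc map_Suc_upt)
    finally show ?case .
  qed
qed

section \<open>Laplace transforms of Poisson cascades\<close>

text \<open>The exponential of the negative on the extended half line. Working with values in
  \<open>ennreal\<close> postpones the question whether cascade sums are finite until their Laplace
  transforms are known.\<close>

definition eneg :: "ennreal \<Rightarrow> real" where
  "eneg a = (if a = \<top> then 0 else exp (- enn2real a))"

lemma eneg_simps [simp]: "eneg 0 = 1" "eneg \<top> = 0" "x \<ge> 0 \<Longrightarrow> eneg (ennreal x) = exp (- x)"
  by (auto simp: eneg_def)

lemma eneg_bounds: "eneg a \<ge> 0" "eneg a \<le> 1"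
  by (auto simp: eneg_def)

lemma eneg_measurable [measurable]: "eneg \<in> borel_measurable borel"
  unfolding eneg_def by measurable

lemma eneg_add: "eneg (a + b) = eneg a * eneg b"
  by (cases a; cases b) (auto simp: mult_exp_exp simp flip: ennreal_plus)

lemma eneg_sum: "eneg (sum f A) = (\<Prod>i\<in>A. eneg (f i))"
  by (induction A rule: infinite_finite_induct) (auto simp: eneg_add)

lemma eneg_mult_nat: "eneg (c * of_nat k) = eneg c ^ k"
  by (induction k) (auto simp: eneg_add distrib_left)

lemma eneg_tendsto:
  assumes "(f \<longlongrightarrow> a) F"
  shows "((\<lambda>x. eneg (f x)) \<longlongrightarrow> eneg a) F"
proof (cases "a = \<top>")
  case True
  show ?thesis
    unfolding True eneg_simps
  proof (rule tendstoI)
    fix e :: real assume e: "e > 0"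
    \<comment> \<open>Above \<open>- ln e\<close> the exponential is below \<open>e\<close>; the
      maximum with 0 keeps the threshold meaningful when \<open>e\<close> is larger than 1.\<close>
    have "eventually (\<lambda>x. f x > ennreal (max 0 (- ln e))) F"
      using assms unfolding True by (rule order_tendstoD) simp
    then show "eventually (\<lambda>x. dist (eneg (f x)) 0 < e) F"
    proof eventually_elim
      case (elim x)
      show ?case
      proof (cases "f x = \<top>")
        case False
        then obtain r where r: "f x = ennreal r" "r \<ge> 0" by (cases "f x") auto
        from elim have "ennreal (max 0 (- ln e)) < ennreal r" unfolding r(1) .
        then have "max 0 (- ln e) < r" by (subst (asm) ennreal_less_iff) auto
        then have "- ln e < r" by simp
        then have "exp (- r) < exp (ln e)" by simp
        then show ?thesis using r e by simp
      qed (use e in simp)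
    qed
  qed
next
  case False
  then have "((\<lambda>x. exp (- enn2real (f x))) \<longlongrightarrow> exp (- enn2real a)) F"
    using assms by (intro tendsto_exp tendsto_minus tendsto_enn2real) (auto simp: less_top)
  moreover have "eventually (\<lambda>x. f x < \<top>) F"
    using assms False by (intro order_tendstoD) (auto simp: less_top)
  then have "eventually (\<lambda>x. exp (- enn2real (f x)) = eneg (f x)) F"
    by eventually_elim (auto simp: eneg_def)
  ultimately show ?thesis using False by (simp add: eneg_def filterlim_cong)
qed

lemma (in prob_space) poisson_generating_function:
  assumes K[measurable]: "K \<in> measurable M (count_space UNIV)"
    and P: "\<And>k. prob {\<omega>\<in>space M. K \<omega> = k} = exp (- c) * c ^ k / fact k"
    and x: "x \<ge> 0" and c: "c \<ge> 0"
  shows "expectation (\<lambda>\<omega>. x ^ K \<omega>) = exp (- c * (1 - x))"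
proof -
  have "(\<integral>\<^sup>+\<omega>. ennreal (x ^ K \<omega>) \<partial>M) = (\<integral>\<^sup>+\<omega>. (\<Sum>k. ennreal (x ^ k) * indicator {\<omega>\<in>space M. K \<omega> = k} \<omega>) \<partial>M)"
  proof (intro nn_integral_cong)
    fix \<omega> assume w: "\<omega> \<in> space M"
    have "(\<Sum>k. ennreal (x ^ k) * indicator {\<omega>\<in>space M. K \<omega> = k} \<omega>) = (\<Sum>k\<in>{K \<omega>}. ennreal (x ^ k) * indicator {\<omega>\<in>space M. K \<omega> = k} \<omega>)"
      using w by (intro suminf_finite) auto
    then show "ennreal (x ^ K \<omega>) = (\<Sum>k. ennreal (x ^ k) * indicator {\<omega>\<in>space M. K \<omega> = k} \<omega>)"
      using w by simp
  qed
  also have "\<dots> = (\<Sum>k. ennreal (x ^ k) * emeasure M {\<omega>\<in>space M. K \<omega> = k})"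
    by (subst nn_integral_suminf) (auto simp: nn_integral_cmult_indicator)
  also have "\<dots> = (\<Sum>k. ennreal (exp (- c) * ((c * x) ^ k /\<^sub>R fact k)))"
    using x c by (simp add: emeasure_eq_measure P ennreal_mult[symmetric] power_mult_distrib divide_inverse mult_ac)
  also have "\<dots> = ennreal (\<Sum>k. exp (- c) * ((c * x) ^ k /\<^sub>R fact k))"
    using x c by (intro suminf_ennreal2 summable_mult summable_exp_generic) auto
  also have "(\<Sum>k. exp (- c) * ((c * x) ^ k /\<^sub>R fact k)) = exp (- c) * exp (c * x)"
    by (subst suminf_mult[OF summable_exp_generic]) (simp add: exp_def)
  also have "\<dots> = exp (- c * (1 - x))" by (simp add: mult_exp_exp algebra_simps)
  finally have nn: "(\<integral>\<^sup>+\<omega>. ennreal (x ^ K \<omega>) \<partial>M) = ennreal (exp (- c * (1 - x)))" .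
  have "expectation (\<lambda>\<omega>. x ^ K \<omega>) = enn2real (\<integral>\<^sup>+\<omega>. ennreal (x ^ K \<omega>) \<partial>M)"
    using x by (intro integral_eq_nn_integral) auto
  then show ?thesis unfolding nn by simp
qed

text \<open>The definition of the process counts points of a random set, whereas the cascade sums
  over an enumeration; injectivity of the enumeration makes the two counts agree.\<close>

lemma suminf_indicator_card:
  fixes X :: "nat \<Rightarrow> 'a"
  assumes inj: "inj X" and fin: "finite (range X \<inter> A)"
  shows "(\<Sum>i. indicator A (X i) :: ennreal) = of_nat (card (range X \<inter> A))"
proof -
  have im: "X ` {i. X i \<in> A} = range X \<inter> A" by auto
  have f: "finite {i. X i \<in> A}"
    using fin inj by (intro finite_imageD[of X]) (auto simp: im inj_on_def)
  have "(\<Sum>i. indicator A (X i) :: ennreal) = (\<Sum>i\<in>{i. X i \<in> A}. indicator A (X i))"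
    by (rule suminf_finite[OF f]) auto
  also have "\<dots> = of_nat (card {i. X i \<in> A})" by simp
  also have "card {i. X i \<in> A} = card (range X \<inter> A)"
    using card_image[of X "{i. X i \<in> A}"] inj by (simp add: im inj_on_def)
  finally show ?thesis .
qed

section \<open>The Laplace functional of a Poisson process\<close>

locale poisson_points = prob_space +
  fixes X :: "nat \<Rightarrow> 'a \<Rightarrow> real"
  assumes ppp: "poisson_point_process M (restrict_space lborel {0<..}) (\<lambda>\<omega>. range (\<lambda>i. X i \<omega>))"
    and smono: "AE \<omega> in M. strict_mono (\<lambda>i. X i \<omega>)"
    and X_measurable [measurable]: "\<And>i. X i \<in> borel_measurable M"
begin

lemma X_pos: "AE \<omega> in M. \<forall>i. X i \<omega> > 0"
proof -
  have "AE \<omega> in M. range (\<lambda>i. X i \<omega>) \<subseteq> {0<..}"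
    using ppp by (simp add: poisson_point_process_def space_restrict_space)
  then show ?thesis by eventually_elim auto
qed

text \<open>A simple function of bounded support sees only finitely many disjoint sets of finite
  measure. The sum over the points is then a linear combination of independent Poisson counts, and
  their generating functions multiply.\<close>

lemma laplace_simple:
  fixes v :: "real \<Rightarrow> ennreal"
  assumes fin: "finite (range v)" and [measurable]: "v \<in> borel_measurable borel"
    and top: "\<And>x. v x < \<top>" and supp: "\<And>x. x \<notin> {0<..K} \<Longrightarrow> v x = 0"
  shows "expectation (\<lambda>\<omega>. eneg (\<Sum>i. v (X i \<omega>))) = exp (- (LINT x|lborel. 1 - eneg (v x)))"
proof -
  \<comment> \<open>\<open>e\<close> enumerates the nonzero values of \<open>v\<close>; the
    corresponding level sets \<open>A j\<close> are disjoint and lie in the bounded support.\<close>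
  obtain e m where e: "bij_betw e {0..<m::nat} (range v - {0})"
    using ex_bij_betw_nat_finite[of "range v - {0}"] fin by auto
  then have e': "bij_betw e {..<m} (range v - {0})" by (simp add: atLeast0LessThan)
  have esurj: "\<exists>k<m. e k = v y" if "v y \<noteq> 0" for y
  proof -
    have "v y \<in> e ` {..<m}" using bij_betw_imp_surj_on[OF e'] that by simp
    then show ?thesis by auto
  qed
  define A where "A j = v -` {e j}" for j
  have ej: "e j \<noteq> 0" "e j < \<top>" if "j < m" for j
  proof -
    have "e j \<in> range v - {0}" using bij_betwE[OF e'] that by auto
    then show "e j \<noteq> 0" "e j < \<top>" using top by auto
  qed
  have injE: "i = j" if "e i = e j" "i < m" "j < m" for i j
    using e' that by (auto simp: bij_betw_def inj_on_def)
  have Asub: "A j \<subseteq> {0<..K}" if "j < m" for j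
    using ej[OF that] supp by (force simp: A_def)
  have Am[measurable]: "A j \<in> sets borel" for j
    unfolding A_def by (rule measurable_sets_borel[of v borel]) auto
  have Adisj: "disjoint_family_on A {..<m}"
    unfolding disjoint_family_on_def A_def using injE by auto
  have Afin: "emeasure lborel (A j) < \<infinity>" if "j < m" for j
  proof -
    have "emeasure lborel (A j) \<le> emeasure lborel {0<..K}" by (intro emeasure_mono Asub that) auto
    also have "\<dots> < \<infinity>" by (cases "K \<ge> 0") auto
    finally show ?thesis .
  qed
  let ?R = "restrict_space lborel {0<..} :: real measure"
  have AR: "A j \<in> sets ?R" "emeasure ?R (A j) = emeasure lborel (A j)" "measure ?R (A j) = measure lborel (A j)" if "j < m" for j
  proof -
    have "A j \<subseteq> {0<..}" using Asub[OF that] by auto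
    then show "A j \<in> sets ?R" "emeasure ?R (A j) = emeasure lborel (A j)" "measure ?R (A j) = measure lborel (A j)"
      by (auto simp: sets_restrict_space_iff emeasure_restrict_space measure_restrict_space)
  qed
  define N where "N j \<omega> = card (range (\<lambda>i. X i \<omega>) \<inter> A j)" for j \<omega>
  define x where "x j = eneg (e j)" for j
  have vsum: "v y = (\<Sum>j<m. e j * indicator (A j) y)" for y
  proof (cases "v y = 0")
    case True
    then have "y \<notin> A j" if "j < m" for j using ej[OF that] by (auto simp: A_def)
    then show ?thesis using True by simp
  next
    case False
    then obtain k where k: "k < m" "e k = v y" using esurj by blast
    have "(\<Sum>j<m. e j * indicator (A j) y) = (\<Sum>j\<in>{k}. e j * indicator (A j) y)"
      by (rule sum.mono_neutral_right) (use k injE in \<open>auto simp: A_def indicator_def\<close>)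
    then show ?thesis using k by (simp add: A_def)
  qed
  have indep: "indep_vars (\<lambda>_. count_space UNIV) N {..<m}"
    using ppp AR Afin Adisj unfolding poisson_point_process_def N_def by (auto simp: less_top)
  have NM[measurable]: "N j \<in> measurable M (count_space UNIV)" if "j < m" for j
    using indep that by (auto simp: indep_vars_def)
  have "AE \<omega> in M. \<forall>j\<in>{..<m}. finite (range (\<lambda>i. X i \<omega>) \<inter> A j)"
    using ppp AR Afin unfolding poisson_point_process_def by (intro AE_finite_allI) (auto simp: less_top)
  with smono have "AE \<omega> in M. eneg (\<Sum>i. v (X i \<omega>)) = (\<Prod>j<m. x j ^ N j \<omega>)"
  proof eventually_elim
    case (elim \<omega>)
    have inj: "inj (\<lambda>i. X i \<omega>)" using elim(1) by (rule strict_mono_imp_inj_on)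
    have "(\<Sum>i. v (X i \<omega>)) = (\<Sum>i. \<Sum>j<m. e j * indicator (A j) (X i \<omega>))"
      unfolding vsum ..
    also have "\<dots> = (\<Sum>j<m. \<Sum>i. e j * indicator (A j) (X i \<omega>))"
      by (rule suminf_sum) (rule summableI)
    also have "\<dots> = (\<Sum>j<m. e j * of_nat (N j \<omega>))"
    proof (intro sum.cong refl)
      fix j assume "j \<in> {..<m}"
      then have "(\<Sum>i. indicator (A j) (X i \<omega>) :: ennreal) = of_nat (N j \<omega>)"
        unfolding N_def using elim(2) by (intro suminf_indicator_card inj) auto
      then show "(\<Sum>i. e j * indicator (A j) (X i \<omega>)) = e j * of_nat (N j \<omega>)"
        by (simp add: ennreal_suminf_cmult)
    qed
    finally show ?case by (simp add: eneg_sum eneg_mult_nat x_def)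
  qed
  then have "expectation (\<lambda>\<omega>. eneg (\<Sum>i. v (X i \<omega>))) = expectation (\<lambda>\<omega>. \<Prod>j<m. x j ^ N j \<omega>)"
    by (intro integral_cong_AE) (auto intro!: borel_measurable_prod)
  also have "\<dots> = (\<Prod>j<m. expectation (\<lambda>\<omega>. x j ^ N j \<omega>))"
  proof (rule indep_vars_lebesgue_integral)
    show "indep_vars (\<lambda>_. borel) (\<lambda>j \<omega>. x j ^ N j \<omega>) {..<m}"
      by (rule indep_vars_compose2[OF indep]) auto
    show "integrable M (\<lambda>\<omega>. x j ^ N j \<omega>)" if "j \<in> {..<m}" for j
      using that by (intro integrable_const_bound[of _ 1]) (auto simp: x_def eneg_bounds power_le_one)
  qed simp
  also have "\<dots> = (\<Prod>j<m. exp (- measure lborel (A j) * (1 - x j)))"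
  proof (intro prod.cong refl poisson_generating_function)
    fix j k assume j: "j \<in> {..<m}"
    then show "N j \<in> measurable M (count_space UNIV)" by simp
    show "prob {\<omega>\<in>space M. N j \<omega> = k} = exp (- measure lborel (A j)) * measure lborel (A j) ^ k / fact k"
      using ppp AR[of j] Afin[of j] j unfolding poisson_point_process_def N_def by (auto simp: less_top)
  qed (auto simp: x_def eneg_bounds)
  also have "\<dots> = exp (- (\<Sum>j<m. (1 - x j) * measure lborel (A j)))"
    by (simp add: exp_sum[symmetric] sum_negf mult.commute)
  also have "(\<Sum>j<m. (1 - x j) * measure lborel (A j)) = (LINT y|lborel. (\<Sum>j<m. (1 - x j) * indicator (A j) y))"
    by (subst Bochner_Integration.integral_sum) (use Afin in \<open>auto intro!: integrable_mult_right\<close>)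
  also have "\<dots> = (LINT y|lborel. 1 - eneg (v y))"
  proof (intro Bochner_Integration.integral_cong refl)
    fix y
    show "(\<Sum>j<m. (1 - x j) * indicator (A j) y) = 1 - eneg (v y)"
    proof (cases "v y = 0")
      case True
      then have "y \<notin> A j" if "j < m" for j using ej[OF that] by (auto simp: A_def)
      then show ?thesis using True by simp
    next
      case False
      then obtain k where k: "k < m" "e k = v y" using esurj by blast
      have "(\<Sum>j<m. (1 - x j) * indicator (A j) y) = (\<Sum>j\<in>{k}. (1 - x j) * indicator (A j) y)"
        by (rule sum.mono_neutral_right) (use k injE in \<open>auto simp: A_def indicator_def\<close>)
      then show ?thesis using k by (simp add: A_def x_def)
    qed
  qed
  finally show ?thesis .
qed

text \<open>The multiplicative Campbell formula. Writing \<open>h\<close> as \<open>eneg u\<close>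
  turns products into sums, and simple functions increasing to \<open>u\<close> reduce the claim to
  the previous lemma. It is phrased with finite products because independence of the subtrees of a
  cascade will be used for finitely many of them at a time.\<close>

lemma laplace_functional:
  fixes h :: "real \<Rightarrow> real"
  assumes [measurable]: "h \<in> borel_measurable borel" and h: "\<And>x. 0 \<le> h x" "\<And>x. h x \<le> 1"
    and I: "integrable lborel (\<lambda>x. indicator {0<..} x * (1 - h x))"
  shows "(\<lambda>n. expectation (\<lambda>\<omega>. \<Prod>i<n. h (X i \<omega>))) \<longlonglongrightarrow> exp (- (LINT x|lborel. indicator {0<..} x * (1 - h x)))"
proof -
  \<comment> \<open>\<open>u\<close> is \<open>- ln h\<close>, infinite at the zeros of
    \<open>h\<close>. The value 0 off the positive axis is harmless since the points are almost
    surely positive.\<close>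
  define u where "u x = (if x \<le> 0 then 0 else if h x = 0 then \<top> else ennreal (- ln (h x)))" for x
  have [measurable]: "u \<in> borel_measurable borel" unfolding u_def by measurable
  have uh: "eneg (u x) = h x" if "x > 0" for x
    using that h[of x] by (auto simp: u_def eneg_simps ln_le_zero_iff)
  have u0: "u x = 0" if "x \<le> 0" for x using that by (simp add: u_def)
  obtain f where f: "\<And>i. simple_function borel (f i)" "incseq f" "\<And>i x. f i x < \<top>" "\<And>x. (SUP i. f i x) = u x"
    using borel_measurable_implies_simple_function_sequence'[of u borel] by (auto simp: image_comp)
  \<comment> \<open>The cutoff at \<open>k\<close> supplies the bounded support and keeps the
    approximation increasing.\<close>
  define v where "v k x = f k x * indicator {0<..real k} x" for k x
  have vinc: "incseq (\<lambda>k. v k x)" for x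
    unfolding v_def using f(2) by (intro incseq_SucI mult_mono) (auto simp: incseq_Suc_iff le_fun_def indicator_def)
  have vlim: "(\<lambda>k. v k x) \<longlonglongrightarrow> u x" for x
  proof (cases "x > 0")
    case True
    have "(\<lambda>k. f k x) \<longlonglongrightarrow> u x"
      unfolding f(4)[symmetric] using f(2) by (intro LIMSEQ_SUP) (auto simp: incseq_def le_fun_def)
    moreover have "eventually (\<lambda>k. f k x = v k x) sequentially"
      using eventually_ge_at_top[of "nat \<lceil>x\<rceil>"]
    proof eventually_elim
      case (elim k)
      then have "x \<le> real k" by linarith
      then show ?case using True by (simp add: v_def)
    qed
    ultimately show ?thesis by (rule Lim_transform_eventually)
  qed (simp add: v_def u0)
  have vSUP: "(SUP k. v k x) = u x" for x
    using LIMSEQ_unique[OF LIMSEQ_SUP[OF vinc] vlim] .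
  have [measurable]: "v k \<in> borel_measurable borel" for k
    using borel_measurable_simple_function[OF f(1), of k] unfolding v_def by measurable
  have E: "expectation (\<lambda>\<omega>. eneg (\<Sum>i. v k (X i \<omega>))) = exp (- (LINT x|lborel. 1 - eneg (v k x)))" for k
  proof (rule laplace_simple)
    have "range (v k) \<subseteq> insert 0 (range (f k))" by (auto simp: v_def indicator_def)
    then show "finite (range (v k))"
      by (rule finite_subset) (use f(1)[of k] in \<open>simp add: simple_function_def\<close>)
    show "v k x < \<top>" for x using f(3)[of k x] by (simp add: v_def indicator_def)
    show "x \<notin> {0<..real k} \<Longrightarrow> v k x = 0" for x by (simp add: v_def)
  qed measurable
  have S: "(\<lambda>k. \<Sum>i. v k (X i \<omega>)) \<longlonglongrightarrow> (\<Sum>i. u (X i \<omega>))" for \<omega>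
  proof -
    have "(\<Sum>i. u (X i \<omega>)) = (SUP k. \<Sum>i. v k (X i \<omega>))"
      unfolding vSUP[symmetric] by (rule ennreal_suminf_SUP_eq) (rule vinc)
    moreover have "incseq (\<lambda>k. \<Sum>i. v k (X i \<omega>))"
      using vinc by (intro incseq_SucI suminf_le summableI) (auto simp: incseq_Suc_iff)
    ultimately show ?thesis using LIMSEQ_SUP by metis
  qed
  have 1: "(\<lambda>k. expectation (\<lambda>\<omega>. eneg (\<Sum>i. v k (X i \<omega>)))) \<longlonglongrightarrow> expectation (\<lambda>\<omega>. eneg (\<Sum>i. u (X i \<omega>)))"
    by (rule integral_dominated_convergence[where w="\<lambda>_. 1"])
       (auto intro!: eneg_tendsto S simp: eneg_bounds)
  have "(\<lambda>k. LINT x|lborel. 1 - eneg (v k x)) \<longlonglongrightarrow> (LINT x|lborel. indicator {0<..} x * (1 - h x))"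
  proof (rule integral_dominated_convergence[OF _ _ I])
    have lim: "(\<lambda>k. 1 - eneg (v k x)) \<longlonglongrightarrow> indicator {0<..} x * (1 - h x)" for x
    proof (cases "x > 0")
      case True
      have "(\<lambda>k. 1 - eneg (v k x)) \<longlonglongrightarrow> 1 - eneg (u x)" by (intro tendsto_intros eneg_tendsto vlim)
      then show ?thesis using True by (simp add: uh)
    qed (simp add: v_def)
    then show "AE x in lborel. (\<lambda>k. 1 - eneg (v k x)) \<longlonglongrightarrow> indicator {0<..} x * (1 - h x)" by simp
    have "1 - eneg (v k x) \<le> indicator {0<..} x * (1 - h x)" for k x
    proof (rule incseq_le[OF _ lim])
      have "eneg b \<le> eneg a" if "a \<le> b" for a b
        using that by (auto simp: eneg_def top_unique intro!: enn2real_mono simp: less_top)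
      then show "incseq (\<lambda>k. 1 - eneg (v k x))" using vinc[of x] by (auto simp: incseq_def)
    qed
    then show "AE x in lborel. norm (1 - eneg (v k x)) \<le> indicator {0<..} x * (1 - h x)" for k
      by (simp add: eneg_bounds)
  qed measurable
  then have 2: "(\<lambda>k. exp (- (LINT x|lborel. 1 - eneg (v k x)))) \<longlonglongrightarrow> exp (- (LINT x|lborel. indicator {0<..} x * (1 - h x)))"
    by (intro tendsto_intros)
  have 3: "expectation (\<lambda>\<omega>. eneg (\<Sum>i. u (X i \<omega>))) = exp (- (LINT x|lborel. indicator {0<..} x * (1 - h x)))"
    using LIMSEQ_unique[OF 1 2[folded E]] .
  have "(\<lambda>n. expectation (\<lambda>\<omega>. eneg (\<Sum>i<n. u (X i \<omega>)))) \<longlonglongrightarrow> expectation (\<lambda>\<omega>. eneg (\<Sum>i. u (X i \<omega>)))"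
    by (rule integral_dominated_convergence[where w="\<lambda>_. 1"])
       (auto intro!: eneg_tendsto summable_LIMSEQ summableI simp: eneg_bounds)
  moreover have "expectation (\<lambda>\<omega>. eneg (\<Sum>i<n. u (X i \<omega>))) = expectation (\<lambda>\<omega>. \<Prod>i<n. h (X i \<omega>))" for n
  proof (rule integral_cong_AE)
    show "AE \<omega> in M. eneg (\<Sum>i<n. u (X i \<omega>)) = (\<Prod>i<n. h (X i \<omega>))"
      using X_pos by eventually_elim (simp add: eneg_sum uh)
  qed measurable
  ultimately show ?thesis unfolding 3 by simp
qed

end

text \<open>The sum defining the cascade zeta function, grouped by the first index; in
  \<open>ennreal\<close> the grouping is always legitimate.\<close>

fun cascade_sum :: "real list \<Rightarrow> (nat list \<Rightarrow> real) \<Rightarrow> ennreal" where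
  "cascade_sum [] p = 1"
| "cascade_sum (z # zs) p = (\<Sum>i. ennreal (p [i] powr - z) * cascade_sum zs (\<lambda>e. p (i # e)))"

text \<open>The multiplicative Campbell formula applied to the top level: a point at
  \<open>x\<close> carries an independent copy of the remaining cascade, scaled by
  \<open>x powr - z\<close>.\<close>

fun cascade_laplace :: "real list \<Rightarrow> real \<Rightarrow> real" where
  "cascade_laplace [] t = exp (- t)"
| "cascade_laplace (z # zs) t =
     exp (- (LINT x|lborel. indicator {0<..} x * (1 - cascade_laplace zs (t * x powr - z))))"

text \<open>The Bochner integral of a non-integrable function is 0, in which case
  \<open>cascade_laplace\<close> would take the value 1 for no probabilistic reason. This predicate
  rules that out at every level.\<close>

fun cascade_integrable :: "real list \<Rightarrow> bool" where
  "cascade_integrable [] = True"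
| "cascade_integrable (z # zs) = (cascade_integrable zs \<and>
     (\<forall>t\<ge>0. integrable lborel (\<lambda>x. indicator {0<..} x * (1 - cascade_laplace zs (t * x powr - z)))))"

lemma cascade_laplace_bounds: "t \<ge> 0 \<Longrightarrow> 0 \<le> cascade_laplace zs t \<and> cascade_laplace zs t \<le> 1"
proof (induction zs arbitrary: t)
  case (Cons z zs)
  have "0 \<le> (LINT x|lborel. indicator {0<..} x * (1 - cascade_laplace zs (t * x powr - z)))"
  proof (rule Bochner_Integration.integral_nonneg)
    fix x :: real
    show "0 \<le> indicator {0<..} x * (1 - cascade_laplace zs (t * x powr - z))"
      using Cons.IH[of "t * x powr - z"] Cons.prems by (intro mult_nonneg_nonneg) auto
  qed
  then show ?case by simp
qed simp

lemma cascade_laplace_measurable [measurable]: "cascade_laplace zs \<in> borel_measurable borel"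
proof (induction zs)
  case Nil
  have "cascade_laplace [] = (\<lambda>t. exp (- t))" by (simp add: fun_eq_iff)
  then show ?case by simp
next
  case (Cons z zs)
  note [measurable] = Cons
  have "cascade_laplace (z # zs) =
      (\<lambda>t. exp (- (LINT x|lborel. indicator {0<..} x * (1 - cascade_laplace zs (t * x powr - z)))))"
    by (simp add: fun_eq_iff)
  then show ?case by simp
qed

lemma cascade_sum_cong:
  assumes "\<And>e. e \<noteq> [] \<Longrightarrow> length e \<le> length zs \<Longrightarrow> p e = p' e"
  shows "cascade_sum zs p = cascade_sum zs p'"
  using assms
proof (induction zs arbitrary: p p')
  case (Cons z zs)
  have "cascade_sum zs (\<lambda>e. p (i # e)) = cascade_sum zs (\<lambda>e. p' (i # e))" for i
    by (rule Cons.IH) (use Cons.prems in auto)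
  moreover have "p [i] = p' [i]" for i using Cons.prems by simp
  ultimately show ?case by simp
qed simp

lemma cascade_sum_measurable:
  assumes "\<And>e. e \<noteq> [] \<Longrightarrow> length e \<le> length zs \<Longrightarrow> (\<lambda>\<omega>. p \<omega> e) \<in> borel_measurable M"
  shows "(\<lambda>\<omega>. cascade_sum zs (p \<omega>)) \<in> borel_measurable M"
  using assms
proof (induction zs arbitrary: p)
  case (Cons z zs)
  have [measurable]: "(\<lambda>\<omega>. cascade_sum zs (\<lambda>e. p \<omega> (i # e))) \<in> borel_measurable M" for i
    by (rule Cons.IH) (use Cons.prems in auto)
  have [measurable]: "(\<lambda>\<omega>. p \<omega> [i]) \<in> borel_measurable M" for i using Cons.prems by simp
  show ?case by simp
qed simp

context
  fixes M :: "'a measure" and P :: "nat list \<Rightarrow> 'a \<Rightarrow> real"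
begin

lemma poisson_cascade_subtree:
  assumes "poisson_cascade (Suc m) M P"
  shows "poisson_cascade m M (\<lambda>e. P (i # e))"
proof -
  interpret prob_space M using assms by (simp add: poisson_cascade_def)
  have ind: "indep_vars (\<lambda>_. \<Pi>\<^sub>M i\<in>UNIV. borel) (\<lambda>e \<omega> i. P (e @ [i]) \<omega>) {e. length e < Suc m}"
    using assms by (simp add: poisson_cascade_def)
  have "indep_vars (\<lambda>_. \<Pi>\<^sub>M i\<in>UNIV. borel) (\<lambda>e \<omega> j. P ((i # e) @ [j]) \<omega>) {e. length e < m}"
    by (rule indep_vars_reindex[OF ind, of "\<lambda>e. i # e"]) auto
  moreover have "poisson_point_process M (restrict_space lborel {0<..}) (\<lambda>\<omega>. range (\<lambda>j. P ((i # e) @ [j]) \<omega>)) \<and>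
        (AE \<omega> in M. strict_mono (\<lambda>j. P ((i # e) @ [j]) \<omega>))" if "length e < m" for e
    using assms that unfolding poisson_cascade_def by (auto dest!: spec[of _ "i # e"] simp del: append_Cons)
  ultimately show ?thesis
    using prob_space_axioms by (simp add: poisson_cascade_def)
qed

lemma poisson_cascade_measurable:
  assumes "poisson_cascade m M P" "e \<noteq> []" "length e \<le> m"
  shows "P e \<in> borel_measurable M"
proof -
  interpret prob_space M using assms by (simp add: poisson_cascade_def)
  have "length (butlast e) < m" using assms(2,3) by (cases e) auto
  moreover have "indep_vars (\<lambda>_. \<Pi>\<^sub>M i\<in>UNIV. borel) (\<lambda>e \<omega> i. P (e @ [i]) \<omega>) {e. length e < m}"
    using assms by (simp add: poisson_cascade_def)
  ultimately have "(\<lambda>\<omega> i. P (butlast e @ [i]) \<omega>) \<in> measurable M (\<Pi>\<^sub>M i\<in>UNIV. borel)"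
    unfolding indep_vars_def by blast
  then have "(\<lambda>\<omega>. P (butlast e @ [last e]) \<omega>) \<in> borel_measurable M"
    by (rule measurable_compose) (rule measurable_component_singleton, simp)
  then show ?thesis using assms by simp
qed

lemma poisson_cascade_points:
  assumes "poisson_cascade m M P" "length e < m"
  shows "poisson_points M (\<lambda>i. P (e @ [i]))"
proof -
  interpret prob_space M using assms by (simp add: poisson_cascade_def)
  show ?thesis
    by unfold_locales
      (use assms poisson_cascade_measurable[OF assms(1)] in \<open>auto simp: poisson_cascade_def\<close>)
qed

end

lemma measurable_PiM_UNIV:
  assumes "\<And>i. (\<lambda>\<omega>. f \<omega> i) \<in> measurable M N"
  shows "f \<in> measurable M (\<Pi>\<^sub>M i\<in>UNIV. N)"
  by (rule measurable_PiM_single') (use assms in \<open>auto dest: measurable_space\<close>)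

text \<open>Induction on the number of levels. The first-level points are independent of the subtree
  sums below them, and these are independent among themselves with a common Laplace transform.
  Freezing the points leaves a product of transforms evaluated at the points, whose mean is given by
  the Laplace functional.\<close>

lemma cascade_laplace_eq:
  assumes "poisson_cascade (length zs) M P" "cascade_integrable zs" "t \<ge> 0"
  shows "(LINT \<omega>|M. eneg (ennreal t * cascade_sum zs (\<lambda>e. P e \<omega>))) = cascade_laplace zs t"
  using assms
proof (induction zs arbitrary: P t)
  case Nil
  then interpret prob_space M by (simp add: poisson_cascade_def)
  show ?case using Nil by (simp add: prob_space)
next
  case (Cons z zs)
  let ?m = "length zs"
  have casc: "poisson_cascade (Suc ?m) M P" using Cons.prems by simp
  interpret prob_space M using casc by (simp add: poisson_cascade_def)
  interpret pts: poisson_points M "\<lambda>i. P ([] @ [i])" by (rule poisson_cascade_points[OF casc]) simp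
  define Q where "Q i \<omega> = cascade_sum zs (\<lambda>e. P (i # e) \<omega>)" for i \<omega>
  have Qm[measurable]: "Q i \<in> borel_measurable M" for i
    unfolding Q_def by (intro cascade_sum_measurable poisson_cascade_measurable[OF casc]) auto
  have Pm[measurable]: "P [i] \<in> borel_measurable M" for i
    by (rule poisson_cascade_measurable[OF casc]) auto
  have ind: "indep_vars (\<lambda>_. \<Pi>\<^sub>M i\<in>UNIV. borel) (\<lambda>e \<omega> i. P (e @ [i]) \<omega>) {e. length e < Suc ?m}"
    using casc by (simp add: poisson_cascade_def)
  have IH: "(LINT \<omega>|M. eneg (ennreal s * Q i \<omega>)) = cascade_laplace zs s" if "s \<ge> 0" for s i
    unfolding Q_def using Cons.prems that by (intro Cons.IH poisson_cascade_subtree) auto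
  let ?B = "\<Pi>\<^sub>M i\<in>(UNIV::nat set). (borel :: ennreal measure)"
  have comp: "(\<lambda>g. g e j) \<in> borel_measurable (PiM A (\<lambda>_. \<Pi>\<^sub>M i\<in>(UNIV::nat set). (borel :: real measure)))" if "e \<in> A" for A j and e :: "nat list"
    by (rule measurable_compose[OF measurable_component_singleton[OF that] measurable_component_singleton]) simp
  have indXQ: "indep_var ?B (\<lambda>\<omega> i. ennreal (P [i] \<omega> powr - z)) ?B (\<lambda>\<omega> i. Q i \<omega>)"
  proof -
    \<comment> \<open>The process attached to the empty list is the first level, the remaining
      processes make up all subtrees. The point \<open>P e\<close> is recovered as coordinate
      \<open>last e\<close> of the process attached to \<open>butlast e\<close>.\<close>
    let ?R = "{e :: nat list. length e < Suc ?m} - {[]}"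
    have "indep_var (PiM {[]} (\<lambda>_. \<Pi>\<^sub>M i\<in>UNIV. borel)) (\<lambda>\<omega>. restrict (\<lambda>e i. P (e @ [i]) \<omega>) {[]})
            (PiM ?R (\<lambda>_. \<Pi>\<^sub>M i\<in>UNIV. borel)) (\<lambda>\<omega>. restrict (\<lambda>e i. P (e @ [i]) \<omega>) ?R)"
      by (rule indep_var_restrict[OF ind]) auto
    then have "indep_var ?B ((\<lambda>g i. ennreal (g [] i powr - z)) \<circ> (\<lambda>\<omega>. restrict (\<lambda>e i. P (e @ [i]) \<omega>) {[]}))
         ?B ((\<lambda>g i. cascade_sum zs (\<lambda>e. g (butlast (i # e)) (last (i # e)))) \<circ> (\<lambda>\<omega>. restrict (\<lambda>e i. P (e @ [i]) \<omega>) ?R))"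
    proof (rule indep_var_compose)
      have p: "(\<lambda>x. ennreal (x powr - z)) \<in> borel_measurable borel" by measurable
      show "(\<lambda>g i. ennreal (g [] i powr - z)) \<in> measurable (PiM {[] :: nat list} (\<lambda>_. \<Pi>\<^sub>M i\<in>(UNIV :: nat set). borel)) ?B"
      proof (rule measurable_PiM_UNIV)
        fix i :: nat
        show "(\<lambda>g. ennreal (g [] i powr - z)) \<in> borel_measurable (PiM {[] :: nat list} (\<lambda>_. \<Pi>\<^sub>M i\<in>(UNIV :: nat set). borel))"
          by (rule measurable_compose[OF comp[of "[]" "{[]}" i] p]) simp
      qed
      show "(\<lambda>g i. cascade_sum zs (\<lambda>e. g (butlast (i # e)) (last (i # e)))) \<in> measurable (PiM ?R (\<lambda>_. \<Pi>\<^sub>M i\<in>UNIV. borel)) ?B"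
        by (intro measurable_PiM_UNIV cascade_sum_measurable comp) auto
    qed
    moreover have "(\<lambda>g i. cascade_sum zs (\<lambda>e. g (butlast (i # e)) (last (i # e)))) \<circ> (\<lambda>\<omega>. restrict (\<lambda>e i. P (e @ [i]) \<omega>) ?R) = (\<lambda>\<omega> i. Q i \<omega>)"
      unfolding fun_eq_iff comp_def Q_def
      by (intro allI cascade_sum_cong) auto
    ultimately show ?thesis by (simp add: comp_def)
  qed
  have indQ: "indep_vars (\<lambda>_. borel) Q {..<n}" for n
  proof -
    define K where "K i = (\<lambda>e. i # e) ` {e. length e < ?m}" for i :: nat
    have "indep_vars (\<lambda>j. PiM (K j) (\<lambda>_. \<Pi>\<^sub>M i\<in>UNIV. borel)) (\<lambda>j \<omega>. restrict (\<lambda>e i. P (e @ [i]) \<omega>) (K j)) {..<n}"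
      by (rule indep_vars_restrict[OF ind]) (auto simp: K_def disjoint_family_on_def)
    then have "indep_vars (\<lambda>_. borel) (\<lambda>j \<omega>. (\<lambda>g. cascade_sum zs (\<lambda>e. g (j # butlast e) (last e))) (restrict (\<lambda>e i. P (e @ [i]) \<omega>) (K j))) {..<n}"
    proof (rule indep_vars_compose2)
      show "(\<lambda>g. cascade_sum zs (\<lambda>e. g (j # butlast e) (last e))) \<in> measurable (PiM (K j) (\<lambda>_. \<Pi>\<^sub>M i\<in>UNIV. borel)) borel" for j
        by (intro cascade_sum_measurable comp) (auto simp: K_def neq_Nil_conv image_iff intro!: exI[of _ "butlast _"])
    qed
    moreover have "cascade_sum zs (\<lambda>e. restrict (\<lambda>e i. P (e @ [i]) \<omega>) (K j) (j # butlast e) (last e)) = Q j \<omega>" for j \<omega>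
    proof -
      have "j # butlast e \<in> K j" if "e \<noteq> []" "length e \<le> ?m" for e
        using that unfolding K_def by (intro imageI) (cases e, auto)
      then show ?thesis unfolding Q_def by (intro cascade_sum_cong) auto
    qed
    ultimately show ?thesis by simp
  qed
  have fin: "(LINT \<omega>|M. (\<Prod>i<n. eneg (ennreal t * ennreal (P [i] \<omega> powr - z) * Q i \<omega>))) =
      (LINT \<omega>|M. (\<Prod>i<n. cascade_laplace zs (t * P [i] \<omega> powr - z)))" for n
  proof -
    define f where "f = (\<lambda>(x :: nat \<Rightarrow> ennreal, y :: nat \<Rightarrow> ennreal). \<Prod>i<n. eneg (ennreal t * x i * y i))"
    have fm[measurable]: "f \<in> borel_measurable (?B \<Otimes>\<^sub>M ?B)"
      unfolding f_def case_prod_unfold by measurable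
    have f1: "norm (f p) \<le> 1" for p
      unfolding f_def by (cases p) (auto simp: eneg_bounds abs_prod intro!: prod_le_1)
    have Xm[measurable]: "(\<lambda>\<omega> i. ennreal (P [i] \<omega> powr - z)) \<in> measurable M ?B"
      by (rule measurable_PiM_UNIV) measurable
    have Ym[measurable]: "(\<lambda>\<omega> i. Q i \<omega>) \<in> measurable M ?B"
      by (rule measurable_PiM_UNIV) measurable
    have "(LINT \<omega>|M. (\<Prod>i<n. eneg (ennreal t * ennreal (P [i] \<omega> powr - z) * Q i \<omega>))) =
        (LINT \<omega>|M. f (\<lambda>i. ennreal (P [i] \<omega> powr - z), \<lambda>i. Q i \<omega>))"
      by (simp add: f_def)
    also have "\<dots> = (LINT x|distr M ?B (\<lambda>\<omega> i. ennreal (P [i] \<omega> powr - z)). LINT \<omega>|M. f (x, \<lambda>i. Q i \<omega>))"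
      by (rule indep_var_integral[OF indXQ fm f1])
    also have "\<dots> = (LINT \<omega>'|M. LINT \<omega>|M. f (\<lambda>i. ennreal (P [i] \<omega>' powr - z), \<lambda>i. Q i \<omega>))"
      by (subst integral_distr) measurable
    also have "\<dots> = (LINT \<omega>'|M. (\<Prod>i<n. cascade_laplace zs (t * P [i] \<omega>' powr - z)))"
    proof (intro Bochner_Integration.integral_cong refl)
      fix \<omega>'
      define c where "c i = t * P [i] \<omega>' powr - z" for i
      have c: "c i \<ge> 0" for i using Cons.prems by (simp add: c_def)
      have "(LINT \<omega>|M. f (\<lambda>i. ennreal (P [i] \<omega>' powr - z), \<lambda>i. Q i \<omega>)) = (LINT \<omega>|M. (\<Prod>i<n. eneg (ennreal (c i) * Q i \<omega>)))"
        using Cons.prems by (simp add: f_def c_def ennreal_mult)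
      also have "\<dots> = (\<Prod>i<n. LINT \<omega>|M. eneg (ennreal (c i) * Q i \<omega>))"
      proof (rule indep_vars_lebesgue_integral)
        show "indep_vars (\<lambda>_. borel) (\<lambda>i \<omega>. eneg (ennreal (c i) * Q i \<omega>)) {..<n}"
          by (rule indep_vars_compose2[OF indQ]) measurable
        show "integrable M (\<lambda>\<omega>. eneg (ennreal (c i) * Q i \<omega>))" for i
          by (rule integrable_const_bound[of _ 1]) (auto simp: eneg_bounds)
      qed simp
      also have "\<dots> = (\<Prod>i<n. cascade_laplace zs (c i))" using IH[OF c] by simp
      finally show "(LINT \<omega>|M. f (\<lambda>i. ennreal (P [i] \<omega>' powr - z), \<lambda>i. Q i \<omega>)) = (\<Prod>i<n. cascade_laplace zs (t * P [i] \<omega>' powr - z))"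
        by (simp add: c_def)
    qed
    finally show ?thesis .
  qed
  have "(\<lambda>n. LINT \<omega>|M. (\<Prod>i<n. cascade_laplace zs (t * P ([] @ [i]) \<omega> powr - z))) \<longlonglongrightarrow>
      exp (- (LINT x|lborel. indicator {0<..} x * (1 - cascade_laplace zs (t * x powr - z))))"
    by (rule pts.laplace_functional) (use Cons.prems cascade_laplace_bounds in auto)
  then have lim1: "(\<lambda>n. LINT \<omega>|M. (\<Prod>i<n. eneg (ennreal t * ennreal (P [i] \<omega> powr - z) * Q i \<omega>))) \<longlonglongrightarrow> cascade_laplace (z # zs) t"
    by (simp add: fin)
  have "(\<lambda>n. LINT \<omega>|M. eneg (\<Sum>i<n. ennreal t * ennreal (P [i] \<omega> powr - z) * Q i \<omega>)) \<longlonglongrightarrow>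
      (LINT \<omega>|M. eneg (\<Sum>i. ennreal t * ennreal (P [i] \<omega> powr - z) * Q i \<omega>))"
    by (rule integral_dominated_convergence[where w="\<lambda>_. 1"])
       (auto intro!: eneg_tendsto summable_LIMSEQ summableI simp: eneg_bounds)
  then have "(LINT \<omega>|M. eneg (\<Sum>i. ennreal t * ennreal (P [i] \<omega> powr - z) * Q i \<omega>)) = cascade_laplace (z # zs) t"
    unfolding eneg_sum by (rule LIMSEQ_unique[OF _ lim1])
  moreover have "(\<Sum>i. ennreal t * ennreal (P [i] \<omega> powr - z) * Q i \<omega>) = ennreal t * cascade_sum (z # zs) (\<lambda>e. P e \<omega>)" for \<omega>
    by (simp only: mult.assoc ennreal_suminf_cmult cascade_sum.simps Q_def)
  ultimately show ?case by simp
qed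

text \<open>As \<open>t\<close> decreases to 0, \<open>eneg (t * S)\<close> tends to the indicator
  of the event that \<open>S\<close> is finite, so the limit of the Laplace transform at 0 is the
  probability of that event.\<close>

lemma cascade_sum_finite:
  assumes P: "poisson_cascade (length zs) M P" and zs: "cascade_integrable zs"
    and lim: "(\<lambda>k. cascade_laplace zs (1 / real (Suc k))) \<longlonglongrightarrow> 1"
  shows "AE \<omega> in M. cascade_sum zs (\<lambda>e. P e \<omega>) < \<top>"
proof -
  interpret prob_space M using P by (simp add: poisson_cascade_def)
  define S where "S \<omega> = cascade_sum zs (\<lambda>e. P e \<omega>)" for \<omega>
  have [measurable]: "S \<in> borel_measurable M"
    unfolding S_def by (intro cascade_sum_measurable poisson_cascade_measurable[OF P])
  have "(\<lambda>k. LINT \<omega>|M. eneg (ennreal (1 / real (Suc k)) * S \<omega>)) \<longlonglongrightarrow> (LINT \<omega>|M. indicator {\<omega>\<in>space M. S \<omega> < \<top>} \<omega>)"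
  proof (rule integral_dominated_convergence[where w="\<lambda>_. 1"])
    show "AE \<omega> in M. (\<lambda>k. eneg (ennreal (1 / real (Suc k)) * S \<omega>)) \<longlonglongrightarrow> indicator {\<omega>\<in>space M. S \<omega> < \<top>} \<omega>"
    proof (rule AE_I2)
      fix \<omega> assume w: "\<omega> \<in> space M"
      show "(\<lambda>k. eneg (ennreal (1 / real (Suc k)) * S \<omega>)) \<longlonglongrightarrow> indicator {\<omega>\<in>space M. S \<omega> < \<top>} \<omega>"
      proof (cases "S \<omega>")
        case (real r)
        have "(\<lambda>k. exp (- (1 / real (Suc k) * r))) \<longlonglongrightarrow> exp (- (0 * r))"
          by (intro tendsto_intros LIMSEQ_Suc[OF lim_1_over_n])
        moreover have "eneg (ennreal (1 / real (Suc k)) * S \<omega>) = exp (- (1 / real (Suc k) * r))" for k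
        proof -
          have "ennreal (1 / real (Suc k)) * S \<omega> = ennreal (1 / real (Suc k) * r)"
            using real by (simp only: ennreal_mult[symmetric] zero_le_divide_1_iff of_nat_0_le_iff)
          then show ?thesis using real by (simp only: eneg_simps mult_nonneg_nonneg zero_le_divide_1_iff of_nat_0_le_iff)
        qed
        ultimately show ?thesis using real w by simp
      next
        case top
        then show ?thesis using w by (simp add: ennreal_mult_top)
      qed
    qed
  qed (auto simp: eneg_bounds)
  moreover have "(LINT \<omega>|M. eneg (ennreal (1 / real (Suc k)) * S \<omega>)) = cascade_laplace zs (1 / real (Suc k))" for k
    unfolding S_def by (rule cascade_laplace_eq[OF P zs]) simp
  ultimately have "(LINT \<omega>|M. indicator {\<omega>\<in>space M. S \<omega> < \<top>} \<omega>) = (1::real)"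
    using lim by (simp only:) (rule LIMSEQ_unique)
  then have "prob {\<omega>\<in>space M. S \<omega> < \<top>} = 1" by simp
  then have "AE \<omega> in M. \<omega> \<in> {\<omega>\<in>space M. S \<omega> < \<top>}"
    by (intro AE_prob_1)
  then show ?thesis by eventually_elim (simp add: S_def)
qed

section \<open>The cascade zeta function as an unordered sum\<close>

lemma nn_integral_count_space_Cons:
  fixes F :: "nat list \<Rightarrow> ennreal"
  assumes "F [] = 0"
  shows "(\<integral>\<^sup>+e. F e \<partial>count_space UNIV) = (\<Sum>i. \<integral>\<^sup>+e. F (i # e) \<partial>count_space UNIV)"
proof -
  have bij: "bij_betw (\<lambda>p :: nat \<times> nat list. fst p # snd p) UNIV {e. e \<noteq> []}"
    by (auto simp: bij_betw_def inj_on_def image_iff neq_Nil_conv)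
  have "(\<integral>\<^sup>+e. F e \<partial>count_space UNIV) = (\<integral>\<^sup>+e. F e \<partial>count_space {e. e \<noteq> []})"
    by (rule nn_integral_count_space_eq) (use assms in auto)
  also have "\<dots> = (\<integral>\<^sup>+p. F (fst p # snd p) \<partial>count_space UNIV)"
    by (rule nn_integral_bij_count_space[OF bij, symmetric])
  also have "\<dots> = (\<integral>\<^sup>+i. \<integral>\<^sup>+e. F (i # e) \<partial>count_space UNIV \<partial>count_space UNIV)"
    by (subst nn_integral_fst_count_space[symmetric]) simp
  finally show ?thesis by (simp add: nn_integral_count_space_nat)
qed

lemma cascade_sum_eq_nn_integral:
  "cascade_sum zs p = (\<integral>\<^sup>+e. (if length e = length zs
      then ennreal (\<Prod>j<length zs. p (take (Suc j) e) powr - (zs ! j)) else 0) \<partial>count_space UNIV)"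
proof (induction zs arbitrary: p)
  case Nil
  have "(\<integral>\<^sup>+e. (if length e = length ([] :: real list)
      then ennreal (\<Prod>j<length ([] :: real list). p (take (Suc j) e) powr - ([] ! j)) else 0) \<partial>count_space UNIV) =
      (\<integral>\<^sup>+e. indicator {[]} e \<partial>count_space (UNIV :: nat list set))"
    by (intro nn_integral_cong) auto
  also have "\<dots> = 1" by simp
  finally show ?case by (simp only: cascade_sum.simps)
next
  case (Cons z zs)
  have "(\<integral>\<^sup>+e. (if length e = length (z # zs) then ennreal (\<Prod>j<length (z # zs). p (take (Suc j) e) powr - ((z # zs) ! j)) else 0) \<partial>count_space UNIV)
    = (\<Sum>i. \<integral>\<^sup>+e. (if length (i # e) = length (z # zs) then ennreal (\<Prod>j<length (z # zs). p (take (Suc j) (i # e)) powr - ((z # zs) ! j)) else 0) \<partial>count_space UNIV)"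
    by (rule nn_integral_count_space_Cons) simp
  also have "\<dots> = (\<Sum>i. \<integral>\<^sup>+e. ennreal (p [i] powr - z) * (if length e = length zs then ennreal (\<Prod>j<length zs. p (i # take (Suc j) e) powr - (zs ! j)) else 0) \<partial>count_space UNIV)"
    by (intro suminf_cong nn_integral_cong)
       (auto simp: prod.lessThan_Suc_shift ennreal_mult prod_nonneg simp del: prod.lessThan_Suc)
  finally show ?case by (simp add: nn_integral_cmult Cons.IH)
qed

lemma infsum_of_real_nn_integral:
  fixes g :: "'a \<Rightarrow> real"
  assumes g: "\<And>x. x \<in> A \<Longrightarrow> g x \<ge> 0" and fin: "(\<integral>\<^sup>+x. ennreal (g x) \<partial>count_space A) < \<top>"
  shows "(\<Sum>\<^sub>\<infinity>x\<in>A. complex_of_real (g x)) = of_real (enn2real (\<integral>\<^sup>+x. ennreal (g x) \<partial>count_space A))"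
proof -
  have I: "integrable (count_space A) g"
    using fin g by (intro integrableI_nonneg) (auto simp: AE_count_space)
  then have abs: "Infinite_Set_Sum.abs_summable_on g A" by (simp add: Infinite_Set_Sum.abs_summable_on_def)
  have "infsum g A = infsetsum g A" by (rule infsetsum_infsum[OF abs, symmetric])
  also have "\<dots> = enn2real (\<integral>\<^sup>+x. ennreal (g x) \<partial>count_space A)"
    unfolding infsetsum_def using g by (intro integral_eq_nn_integral) (auto simp: AE_count_space)
  finally have eq: "infsum g A = enn2real (\<integral>\<^sup>+x. ennreal (g x) \<partial>count_space A)" .
  have "(\<lambda>x. norm (g x)) summable_on A" by (rule abs_summable_equivalent[THEN iffD2, OF abs])
  then have "g summable_on A" by (rule abs_summable_summable)
  then have "((\<lambda>x. complex_of_real (g x)) has_sum of_real (infsum g A)) A"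
    by (intro has_sum_of_real has_sum_infsum)
  then show ?thesis unfolding eq by (rule infsumI)
qed

lemma cascade_zeta_eq:
  assumes p: "\<And>e. e \<noteq> [] \<Longrightarrow> length e \<le> m \<Longrightarrow> P e \<omega> > 0" and fin: "cascade_sum (map z [1..<Suc m]) (\<lambda>e. P e \<omega>) < \<top>"
  shows "poisson_cascade_zeta m P (\<lambda>j. of_real (z j)) \<omega> = of_real (enn2real (cascade_sum (map z [1..<Suc m]) (\<lambda>e. P e \<omega>)))"
proof -
  let ?A = "{e :: nat list. length e = m}"
  define g where "g e = (\<Prod>j<m. P (take (Suc j) e) \<omega> powr - z (Suc j))" for e
  have eq: "cascade_sum (map z [1..<Suc m]) (\<lambda>e. P e \<omega>) = (\<integral>\<^sup>+e. ennreal (g e) \<partial>count_space ?A)"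
  proof -
    have n: "map z [1..<Suc m] ! j = z (Suc j)" if "j < m" for j
      using that by (simp add: nth_append del: upt_Suc)
    have "cascade_sum (map z [1..<Suc m]) (\<lambda>e. P e \<omega>) = (\<integral>\<^sup>+e. (if length e = m then ennreal (g e) else 0) \<partial>count_space UNIV)"
      unfolding cascade_sum_eq_nn_integral g_def
      by (intro nn_integral_cong) (auto simp: n simp del: upt_Suc intro!: prod.cong arg_cong[where f=ennreal])
    also have "\<dots> = (\<integral>\<^sup>+e. ennreal (g e) * indicator ?A e \<partial>count_space UNIV)"
      by (intro nn_integral_cong) auto
    finally show ?thesis by (simp add: nn_integral_count_space_indicator)
  qed
  have "poisson_cascade_zeta m P (\<lambda>j. of_real (z j)) \<omega> = (\<Sum>\<^sub>\<infinity>e\<in>?A. complex_of_real (g e))"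
    unfolding poisson_cascade_zeta_def
  proof (rule infsum_cong)
    fix e assume e: "e \<in> ?A"
    have "(\<Prod>j=1..m. complex_of_real (P (take j e) \<omega>) powr - complex_of_real (z j)) = (\<Prod>j<m. complex_of_real (P (take (Suc j) e) \<omega>) powr - complex_of_real (z (Suc j)))"
      by (rule prod.reindex_bij_witness[of _ Suc "\<lambda>j. j - 1"]) auto
    also have "\<dots> = (\<Prod>j<m. complex_of_real (P (take (Suc j) e) \<omega> powr - z (Suc j)))"
    proof (intro prod.cong refl)
      fix j assume j: "j \<in> {..<m}"
      have "P (take (Suc j) e) \<omega> > 0" using e j by (intro p) auto
      then show "complex_of_real (P (take (Suc j) e) \<omega>) powr - complex_of_real (z (Suc j)) = complex_of_real (P (take (Suc j) e) \<omega> powr - z (Suc j))"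
        using powr_of_real[of "P (take (Suc j) e) \<omega>" "- z (Suc j)"] by simp
    qed
    finally show "(\<Prod>j=1..m. complex_of_real (P (take j e) \<omega>) powr - complex_of_real (z j)) = complex_of_real (g e)"
      by (simp add: g_def)
  qed
  also have "\<dots> = of_real (enn2real (\<integral>\<^sup>+e. ennreal (g e) \<partial>count_space ?A))"
    by (rule infsum_of_real_nn_integral) (use fin in \<open>simp_all only: eq[symmetric]\<close>, simp add: g_def prod_nonneg)
  finally show ?thesis by (simp only: eq)
qed

text \<open>Outside a null set all points are positive and the cascade sum is finite; there complex
  powers are real powers and the unordered complex sum is the cascade sum. Measurability of the zeta
  function is a hypothesis because this identification holds only almost surely.\<close>

lemma poisson_cascade_zeta_laplace:
  assumes P: "poisson_cascade m M P" and zs: "cascade_integrable (map z [1..<Suc m])"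
    and lim: "(\<lambda>k. cascade_laplace (map z [1..<Suc m]) (1 / real (Suc k))) \<longlonglongrightarrow> 1"
    and \<zeta>[measurable]: "poisson_cascade_zeta m P (\<lambda>j. of_real (z j)) \<in> borel_measurable M"
  shows "AE \<omega> in M. \<exists>r\<ge>0. poisson_cascade_zeta m P (\<lambda>j. of_real (z j)) \<omega> = of_real r"
    and "t \<ge> 0 \<Longrightarrow> (LINT \<omega>|M. exp (- t * Re (poisson_cascade_zeta m P (\<lambda>j. of_real (z j)) \<omega>))) = cascade_laplace (map z [1..<Suc m]) t"
proof -
  let ?zs = "map z [1..<Suc m]"
  interpret prob_space M using P by (simp add: poisson_cascade_def)
  have len: "length ?zs = m" by simp
  have P': "poisson_cascade (length ?zs) M P" using P by (simp only: len)
  have Sm[measurable]: "(\<lambda>\<omega>. cascade_sum ?zs (\<lambda>e. P e \<omega>)) \<in> borel_measurable M"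
    by (intro cascade_sum_measurable poisson_cascade_measurable[OF P'])
  have "AE \<omega> in M. \<forall>e\<in>{e. length e < m}. \<forall>i. P (e @ [i]) \<omega> > 0"
  proof (rule AE_ball_countable')
    show "AE \<omega> in M. \<forall>i. P (e @ [i]) \<omega> > 0" if "e \<in> {e. length e < m}" for e
    proof -
      interpret pts: poisson_points M "\<lambda>i. P (e @ [i])" using poisson_cascade_points[OF P] that by simp
      show ?thesis by (rule pts.X_pos)
    qed
  qed simp
  then have pos: "AE \<omega> in M. \<forall>e. e \<noteq> [] \<longrightarrow> length e \<le> m \<longrightarrow> P e \<omega> > 0"
  proof eventually_elim
    case (elim \<omega>)
    show ?case
    proof (intro allI impI)
      fix e :: "nat list" assume "e \<noteq> []" "length e \<le> m"
      then have "butlast e \<in> {e. length e < m}" "butlast e @ [last e] = e" by (cases e; auto)+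
      then show "P e \<omega> > 0" using elim by metis
    qed
  qed
  have ev: "AE \<omega> in M. cascade_sum ?zs (\<lambda>e. P e \<omega>) < \<top> \<and> poisson_cascade_zeta m P (\<lambda>j. of_real (z j)) \<omega> = of_real (enn2real (cascade_sum ?zs (\<lambda>e. P e \<omega>)))"
    using cascade_sum_finite[OF P' zs lim] pos by eventually_elim (simp add: cascade_zeta_eq del: upt_Suc)
  then show "AE \<omega> in M. \<exists>r\<ge>0. poisson_cascade_zeta m P (\<lambda>j. of_real (z j)) \<omega> = of_real r"
    by eventually_elim auto
  assume t: "t \<ge> 0"
  have "AE \<omega> in M. exp (- t * Re (poisson_cascade_zeta m P (\<lambda>j. of_real (z j)) \<omega>)) = eneg (ennreal t * cascade_sum ?zs (\<lambda>e. P e \<omega>))"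
    using ev
  proof eventually_elim
    case (elim \<omega>)
    then obtain r where r: "cascade_sum ?zs (\<lambda>e. P e \<omega>) = ennreal r" "r \<ge> 0"
      by (cases "cascade_sum ?zs (\<lambda>e. P e \<omega>)") auto
    then show ?case using elim t by (simp add: ennreal_mult[symmetric] del: upt_Suc)
  qed
  then have "(LINT \<omega>|M. exp (- t * Re (poisson_cascade_zeta m P (\<lambda>j. of_real (z j)) \<omega>))) = (LINT \<omega>|M. eneg (ennreal t * cascade_sum ?zs (\<lambda>e. P e \<omega>)))"
    by (intro integral_cong_AE) measurable
  then show "(LINT \<omega>|M. exp (- t * Re (poisson_cascade_zeta m P (\<lambda>j. of_real (z j)) \<omega>))) = cascade_laplace ?zs t"
    by (simp only: cascade_laplace_eq[OF P' zs t])
qed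

section \<open>Second order expansions\<close>

declare times_complex.sel [simp del]

lemma Re_mult_real [simp]:
  "Re (z * of_real x) = Re z * x" "Re (of_real x * z) = x * Re z"
  "Re (of_nat n * z) = real n * Re z"
  by (simp_all add: times_complex.sel)

section \<open>Exponential integrals of Gaussian variables\<close>

lemma integrable_scaleR_iff:
  fixes f :: "'a \<Rightarrow> 'b::{banach, second_countable_topology}"
  assumes "c \<noteq> 0"
  shows "integrable M (\<lambda>x. c *\<^sub>R f x) \<longleftrightarrow> integrable M f"
proof
  assume "integrable M (\<lambda>x. c *\<^sub>R f x)"
  then have "integrable M (\<lambda>x. inverse c *\<^sub>R (c *\<^sub>R f x))" by (rule integrable_scaleR_right)
  then show "integrable M f" using assms by simp
qed simp

text \<open>Completing the square: weighting a standard normal variable with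
  \<open>exp (s * x)\<close> amounts to shifting its mean to \<open>s\<close>.\<close>

lemma integral_std_normal_tilt:
  fixes F :: "real \<Rightarrow> 'a::{banach, second_countable_topology}"
  assumes [measurable]: "F \<in> borel_measurable borel"
  shows "(LINT x|std_normal_distribution. exp (s * x) *\<^sub>R F x) =
      exp (s\<^sup>2 / 2) *\<^sub>R (LINT x|std_normal_distribution. F (x + s))"
    and "integrable std_normal_distribution (\<lambda>x. exp (s * x) *\<^sub>R F x) \<longleftrightarrow>
      integrable std_normal_distribution (\<lambda>x. F (x + s))"
proof -
  have d: "std_normal_density (s + x) * exp (s * (s + x)) = exp (s\<^sup>2 / 2) * std_normal_density x" for x
    by (simp add: std_normal_density_def mult_exp_exp power2_eq_square field_simps)
  have eq: "(\<lambda>x. std_normal_density (s + x) *\<^sub>R exp (s * (s + x)) *\<^sub>R F (s + x)) =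
      (\<lambda>x. exp (s\<^sup>2 / 2) *\<^sub>R (std_normal_density x *\<^sub>R F (x + s)))"
    unfolding scaleR_scaleR d by (simp add: add.commute)
  have "(LINT x|std_normal_distribution. exp (s * x) *\<^sub>R F x) =
      (LINT x|lborel. std_normal_density x *\<^sub>R exp (s * x) *\<^sub>R F x)"
    by (subst integral_density) auto
  also have "\<dots> = (LINT x|lborel. std_normal_density (s + x) *\<^sub>R exp (s * (s + x)) *\<^sub>R F (s + x))"
    by (subst lborel_integral_real_affine[where c=1 and t=s]) auto
  also have "\<dots> = exp (s\<^sup>2 / 2) *\<^sub>R (LINT x|lborel. std_normal_density x *\<^sub>R F (x + s))"
    unfolding eq by (rule integral_scaleR_right)
  also have "(LINT x|lborel. std_normal_density x *\<^sub>R F (x + s)) = (LINT x|std_normal_distribution. F (x + s))"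
    by (subst integral_density) auto
  finally show "(LINT x|std_normal_distribution. exp (s * x) *\<^sub>R F x) =
      exp (s\<^sup>2 / 2) *\<^sub>R (LINT x|std_normal_distribution. F (x + s))" .
  have "integrable std_normal_distribution (\<lambda>x. exp (s * x) *\<^sub>R F x) \<longleftrightarrow>
      integrable lborel (\<lambda>x. std_normal_density x *\<^sub>R exp (s * x) *\<^sub>R F x)"
    by (subst integrable_density) auto
  also have "\<dots> \<longleftrightarrow> integrable lborel (\<lambda>x. std_normal_density (s + x) *\<^sub>R exp (s * (s + x)) *\<^sub>R F (s + x))"
    using lborel_integrable_real_affine_iff[of 1 "\<lambda>x. std_normal_density x *\<^sub>R exp (s * x) *\<^sub>R F x" s] by simp
  also have "\<dots> \<longleftrightarrow> integrable lborel (\<lambda>x. std_normal_density x *\<^sub>R F (x + s))"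
    unfolding eq by (rule integrable_scaleR_iff) simp
  also have "\<dots> \<longleftrightarrow> integrable std_normal_distribution (\<lambda>x. F (x + s))"
    by (subst integrable_density) auto
  finally show "integrable std_normal_distribution (\<lambda>x. exp (s * x) *\<^sub>R F x) \<longleftrightarrow>
      integrable std_normal_distribution (\<lambda>x. F (x + s))" .
qed

text \<open>The real part of \<open>b\<close> is removed by tilting, and the imaginary part leaves a
  characteristic function of the standard normal law.\<close>

lemma std_normal_exp:
  shows "(CLINT x|std_normal_distribution. exp (b * of_real x)) = exp (b\<^sup>2 / 2)"
    and "integrable std_normal_distribution (\<lambda>x. exp (b * complex_of_real x))"
proof -
  interpret prob_space std_normal_distribution by (rule prob_space_std_normal)
  have e: "exp (b * complex_of_real x) = exp (Re b * x) *\<^sub>R iexp (Im b * x)" for x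
  proof -
    have "b * complex_of_real x = of_real (Re b * x) + \<i> * of_real (Im b * x)"
      by (simp add: complex_eq_iff times_complex.sel)
    then show ?thesis by (simp add: exp_add scaleR_conv_of_real exp_of_real del: of_real_mult)
  qed
  have "(CLINT x|std_normal_distribution. exp (b * of_real x)) =
      exp ((Re b)\<^sup>2 / 2) *\<^sub>R (CLINT x|std_normal_distribution. iexp (Im b * (x + Re b)))"
    unfolding e by (rule integral_std_normal_tilt) measurable
  also have "(CLINT x|std_normal_distribution. iexp (Im b * (x + Re b))) =
      (CLINT x|std_normal_distribution. iexp (Im b * Re b) * iexp (Im b * x))"
    by (simp add: exp_add[symmetric] algebra_simps)
  also have "\<dots> = iexp (Im b * Re b) * char std_normal_distribution (Im b)"
    unfolding char_def by simp
  also have "\<dots> = iexp (Im b * Re b) * of_real (exp (- ((Im b)\<^sup>2) / 2))"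
    by (simp add: char_std_normal_distribution exp_of_real)
  also have "exp ((Re b)\<^sup>2 / 2) *\<^sub>R \<dots> = exp (b\<^sup>2 / 2)"
  proof -
    have *: "b\<^sup>2 / 2 = of_real ((Re b)\<^sup>2 / 2) + (\<i> * of_real (Im b * Re b) + of_real (- ((Im b)\<^sup>2) / 2))"
      by (simp add: complex_eq_iff power2_eq_square field_simps times_complex.sel)
    show ?thesis unfolding * exp_add exp_of_real scaleR_conv_of_real by (simp only: mult_ac)
  qed
  finally show "(CLINT x|std_normal_distribution. exp (b * of_real x)) = exp (b\<^sup>2 / 2)" .
  show "integrable std_normal_distribution (\<lambda>x. exp (b * complex_of_real x))"
    unfolding e
    by (subst integral_std_normal_tilt) (auto intro!: integrable_const_bound[of _ 1] simp del: of_real_mult of_real_add)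
qed

lemma std_normal_exp_real:
  shows "(LINT x|std_normal_distribution. exp (s * x)) = exp (s\<^sup>2 / 2)"
    and "integrable std_normal_distribution (\<lambda>x. exp (s * x))"
proof -
  interpret prob_space std_normal_distribution by (rule prob_space_std_normal)
  show "(LINT x|std_normal_distribution. exp (s * x)) = exp (s\<^sup>2 / 2)"
    using integral_std_normal_tilt(1)[of "\<lambda>_. 1::real" s] prob_space by simp
  show "integrable std_normal_distribution (\<lambda>x. exp (s * x))"
    using integral_std_normal_tilt(2)[of "\<lambda>_. 1::real" s] by simp
qed

text \<open>Powers of \<open>1 + t\<close> stay in the unit disc, so each Taylor remainder obeys a
  one-step recursion in \<open>N\<close> driven by the preceding one. The bounds hold for every size
  of \<open>N * t\<close>.\<close>

lemma power_expansion:
  fixes t :: complex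
  assumes "cmod (1 + t) \<le> 1"
  shows power_expansion_1: "cmod ((1 + t) ^ N - 1 - of_nat N * t) \<le> (real N * cmod t)\<^sup>2"
    and power_expansion_2:
      "cmod ((1 + t) ^ N - 1 - of_nat N * t - of_nat (N choose 2) * t\<^sup>2) \<le> (real N * cmod t) ^ 3"
proof -
  have R1: "cmod ((1 + t) ^ N - 1) \<le> real N * cmod t" for N
  proof (induction N)
    case (Suc N)
    have eq: "(1 + t) ^ Suc N - 1 = ((1 + t) ^ N - 1) + t * (1 + t) ^ N"
      by (simp add: algebra_simps)
    have "cmod ((1 + t) ^ Suc N - 1) \<le> real N * cmod t + cmod t * cmod (1 + t) ^ N"
      unfolding eq by (rule order_trans[OF norm_triangle_ineq]) (simp add: norm_mult norm_power Suc)
    also have "\<dots> \<le> real N * cmod t + cmod t * 1"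
      using assms by (intro add_left_mono mult_left_mono power_le_one) auto
    finally show ?case by (simp add: algebra_simps)
  qed simp
  have R2: "cmod ((1 + t) ^ N - 1 - of_nat N * t) \<le> (real N * cmod t)\<^sup>2" for N
  proof (induction N)
    case (Suc N)
    have eq: "(1 + t) ^ Suc N - 1 - of_nat (Suc N) * t = ((1 + t) ^ N - 1 - of_nat N * t) + t * ((1 + t) ^ N - 1)"
      by (simp add: algebra_simps)
    have "cmod ((1 + t) ^ Suc N - 1 - of_nat (Suc N) * t) \<le>
        (real N * cmod t)\<^sup>2 + cmod t * (real N * cmod t)"
      unfolding eq using Suc mult_left_mono[OF R1[of N], of "cmod t"]
      by (intro order_trans[OF norm_triangle_ineq]) (simp add: norm_mult)
    also have "\<dots> \<le> (real (Suc N) * cmod t)\<^sup>2"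
      by (simp add: power2_eq_square algebra_simps)
    finally show ?case .
  qed simp
  show "cmod ((1 + t) ^ N - 1 - of_nat N * t) \<le> (real N * cmod t)\<^sup>2" by (rule R2)
  show "cmod ((1 + t) ^ N - 1 - of_nat N * t - of_nat (N choose 2) * t\<^sup>2) \<le> (real N * cmod t) ^ 3"
  proof (induction N)
    case (Suc N)
    have eq: "(1 + t) ^ Suc N - 1 - of_nat (Suc N) * t - of_nat (Suc N choose 2) * t\<^sup>2 =
        ((1 + t) ^ N - 1 - of_nat N * t - of_nat (N choose 2) * t\<^sup>2) + t * ((1 + t) ^ N - 1 - of_nat N * t)"
      by (simp add: algebra_simps numeral_2_eq_2)
    have "cmod ((1 + t) ^ Suc N - 1 - of_nat (Suc N) * t - of_nat (Suc N choose 2) * t\<^sup>2) \<le>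
        (real N * cmod t) ^ 3 + cmod t * (real N * cmod t)\<^sup>2"
      unfolding eq using Suc mult_left_mono[OF R2[of N], of "cmod t"]
      by (intro order_trans[OF norm_triangle_ineq]) (simp add: norm_mult)
    also have "\<dots> = (real N ^ 3 + real N ^ 2) * cmod t ^ 3"
      by (simp add: power2_eq_square power3_eq_cube algebra_simps)
    also have "\<dots> \<le> (real (Suc N)) ^ 3 * cmod t ^ 3"
      by (intro mult_right_mono) (auto simp: power2_eq_square power3_eq_cube algebra_simps)
    finally show ?case by (simp add: power_mult_distrib)
  qed simp
qed

text \<open>
  If \<open>g\<close> is the characteristic function of \<open>Z\<close>, then \<open>m\<close>, \<open>A\<close> and \<open>B\<close> play the roles of
  the mean, of \<open>E |Z|\<^sup>2\<close> and of \<open>E Z\<^sup>2\<close>. The scale-invariant error term replaces uniform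
  integrability of \<open>|Z|\<^sup>2\<close>.
\<close>

definition quad_poly :: "complex \<Rightarrow> real \<Rightarrow> complex \<Rightarrow> complex \<Rightarrow> complex" where
  "quad_poly m A B v = 1 + \<i> * of_real (Re (v * m)) - of_real (A * (cmod v)\<^sup>2 / 4 + Re (v\<^sup>2 * B) / 4)"

definition quad_expansion ::
  "real \<Rightarrow> real \<Rightarrow> (complex \<Rightarrow> complex) \<Rightarrow> complex \<Rightarrow> real \<Rightarrow> complex \<Rightarrow> bool" where
  "quad_expansion C e g m A B \<longleftrightarrow> A > 0 \<and> (cmod m)\<^sup>2 \<le> A \<and> cmod B \<le> A \<and>
     (\<forall>v. cmod (g v - quad_poly m A B v) \<le> C * (sqrt A * cmod v) powr (2 + e))"

lemma abs_Re_le: "(cmod m)\<^sup>2 \<le> A \<Longrightarrow> \<bar>Re (v * m)\<bar> \<le> sqrt A * cmod v"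
proof -
  assume "(cmod m)\<^sup>2 \<le> A"
  then have "cmod m \<le> sqrt A" by (rule real_le_rsqrt)
  then have "cmod (v * m) \<le> sqrt A * cmod v"
    by (simp add: norm_mult mult.commute mult_right_mono)
  then show ?thesis using abs_Re_le_cmod[of "v * m"] by linarith
qed

text \<open>Applied to \<open>v * Z\<close> under an expectation, this turns half the mean of the
  squared real part into \<open>A * (cmod v)\<^sup>2 / 4 + Re (v\<^sup>2 * B) / 4\<close>, which is
  the quadratic term of \<open>quad_poly\<close>.\<close>

lemma Re_square: "(Re z)\<^sup>2 = ((cmod z)\<^sup>2 + Re (z\<^sup>2)) / 2"
  by (simp only: cmod_power2 Re_power2) simp

lemma norm_quad_poly_le:
  assumes "A \<ge> 0" "(cmod m)\<^sup>2 \<le> A" "cmod B \<le> A"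
  shows "cmod (quad_poly m A B v) \<le> 1 + sqrt A * cmod v + (sqrt A * cmod v)\<^sup>2 / 2"
proof -
  have "\<bar>Re (v\<^sup>2 * B)\<bar> \<le> A * (cmod v)\<^sup>2"
    using abs_Re_le_cmod[of "v\<^sup>2 * B"] mult_right_mono[OF assms(3), of "(cmod v)\<^sup>2"]
    by (simp add: norm_mult norm_power mult.commute)
  then have "\<bar>A * (cmod v)\<^sup>2 / 4 + Re (v\<^sup>2 * B) / 4\<bar> \<le> A * (cmod v)\<^sup>2 / 2"
    using assms(1) unfolding abs_le_iff by auto
  moreover have "cmod (quad_poly m A B v) \<le> 1 + \<bar>Re (v * m)\<bar> + \<bar>A * (cmod v)\<^sup>2 / 4 + Re (v\<^sup>2 * B) / 4\<bar>"
    unfolding quad_poly_def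
    by (intro order_trans[OF norm_triangle_ineq4] add_mono order_trans[OF norm_triangle_ineq])
       (auto simp: norm_mult simp del: of_real_add)
  ultimately show ?thesis
    using abs_Re_le[OF assms(2), of v] assms(1) by (simp add: power_mult_distrib)
qed

lemma quad_poly_integral:
  shows "(CLINT x|std_normal_distribution. quad_poly m A B (v * exp (b * of_real x))) =
     1 + \<i> * of_real (Re (v * (m * exp (b\<^sup>2 / 2)))) - of_real (A * exp (2 * (Re b)\<^sup>2) * (cmod v)\<^sup>2 / 4 + Re (v\<^sup>2 * (B * exp (2 * b\<^sup>2))) / 4)"
    and "integrable std_normal_distribution (\<lambda>x. quad_poly m A B (v * exp (b * of_real x)))"
proof -
  interpret prob_space std_normal_distribution by (rule prob_space_std_normal)
  have e2: "exp (b * complex_of_real x)^2 = exp ((2 * b) * complex_of_real x)" for x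
    by (simp add: exp_double[symmetric] mult.assoc)
  have n2: "(cmod (exp (b * complex_of_real x)))^2 = exp (2 * Re b * x)" for x
    by (simp add: exp_double[symmetric] mult.assoc times_complex.sel)
  have i1: "integrable std_normal_distribution (\<lambda>x. Re (v * m * exp (b * complex_of_real x)))"
    by (intro integrable_Re integrable_mult_right std_normal_exp)
  have i2: "integrable std_normal_distribution (\<lambda>x. Re (v\<^sup>2 * B * exp ((2 * b) * complex_of_real x)))"
    by (intro integrable_Re integrable_mult_right std_normal_exp)
  have i3: "integrable std_normal_distribution (\<lambda>x. A * (cmod v)\<^sup>2 * exp (2 * Re b * x))"
    by (intro integrable_mult_right std_normal_exp_real)
  have q: "quad_poly m A B (v * exp (b * of_real x)) =
      1 + \<i> * of_real (Re (v * m * exp (b * of_real x)))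
      - of_real (A * (cmod v)\<^sup>2 * exp (2 * Re b * x) / 4 + Re (v\<^sup>2 * B * exp ((2 * b) * of_real x)) / 4)" for x
    unfolding quad_poly_def power_mult_distrib norm_mult n2 e2 by (simp only: mult_ac)
  have I1: "(LINT x|std_normal_distribution. Re (v * m * exp (b * complex_of_real x))) = Re (v * (m * exp (b\<^sup>2 / 2)))"
    by (subst integral_Re) (auto intro!: integrable_mult_right std_normal_exp simp: std_normal_exp mult.assoc simp del: times_complex.sel)
  have "(CLINT x|std_normal_distribution. v\<^sup>2 * B * exp ((2 * b) * complex_of_real x)) = v\<^sup>2 * (B * exp (2 * b\<^sup>2))"
    by (subst integral_mult_right_zero, subst std_normal_exp) (simp add: power_mult_distrib mult.assoc)
  then have I2: "(LINT x|std_normal_distribution. Re (v\<^sup>2 * B * exp ((2 * b) * complex_of_real x))) = Re (v\<^sup>2 * (B * exp (2 * b\<^sup>2)))"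
    by (subst integral_Re) (intro integrable_mult_right std_normal_exp, simp only:)
  have I3: "(LINT x|std_normal_distribution. A * (cmod v)\<^sup>2 * exp (2 * Re b * x)) = A * exp (2 * (Re b)\<^sup>2) * (cmod v)\<^sup>2"
    by (simp add: std_normal_exp_real power_mult_distrib)
  note [simp del] = times_complex.sel
  have "has_bochner_integral std_normal_distribution (\<lambda>x. quad_poly m A B (v * exp (b * of_real x)))
     (1 + \<i> * of_real (Re (v * (m * exp (b\<^sup>2 / 2)))) - of_real (A * exp (2 * (Re b)\<^sup>2) * (cmod v)\<^sup>2 / 4 + Re (v\<^sup>2 * (B * exp (2 * b\<^sup>2))) / 4))"
    unfolding q
    by (intro has_bochner_integral_diff has_bochner_integral_add has_bochner_integral_mult_right
        has_bochner_integral_of_real has_bochner_integral_divide_zero)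
       (use i1 i2 i3 I1 I2 I3 prob_space in \<open>auto simp: has_bochner_integral_iff\<close>)
  then show "integrable std_normal_distribution (\<lambda>x. quad_poly m A B (v * exp (b * of_real x)))"
    "(CLINT x|std_normal_distribution. quad_poly m A B (v * exp (b * of_real x))) =
     1 + \<i> * of_real (Re (v * (m * exp (b\<^sup>2 / 2)))) - of_real (A * exp (2 * (Re b)\<^sup>2) * (cmod v)\<^sup>2 / 4 + Re (v\<^sup>2 * (B * exp (2 * b\<^sup>2))) / 4)"
    by (simp_all add: has_bochner_integral_iff)
qed

text \<open>The new second moments are those of a sum of \<open>N\<close> independent terms: the
  diagonal contributes \<open>N * exp (2 * (Re b)\<^sup>2) * A\<close>, and the
  \<open>N * (N - 1)\<close> cross terms give the multiple \<open>1 - 1 / N\<close> of the squared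
  mean; likewise for \<open>B\<close>. The hypothesis comparing \<open>N\<close> with an exponential
  is a Lyapunov condition: the summed moments of order \<open>2 + e\<close> are at most the power
  \<open>1 + e / 2\<close> of the summed second moments, so the error keeps its scale-invariant
  form.\<close>

lemma quad_expansion_step:
  fixes N :: nat and b m B :: complex and A :: real
  assumes q: "quad_expansion C e g m A B" and e: "0 < e" "e \<le> 1" and C: "C \<ge> 0"
    and g[measurable]: "g \<in> borel_measurable borel" and g1: "\<And>v. cmod (g v) \<le> 1"
    and N1: "N \<ge> 1" and N: "exp ((2 + e) * (Re b)\<^sup>2) \<le> real N"
  shows "quad_expansion (4 + C + (1 + C) * (3 + C) + (2 + C) ^ 3) e
    (\<lambda>v. (CLINT x|std_normal_distribution. g (v * exp (b * of_real x))) ^ N)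
    (of_nat N * m * exp (b\<^sup>2 / 2))
    (real N * exp (2 * (Re b)\<^sup>2) * A + (1 - 1 / real N) * (cmod (of_nat N * m * exp (b\<^sup>2 / 2)))\<^sup>2)
    (of_nat N * exp (2 * b\<^sup>2) * B + (1 - 1 / of_nat N) * (of_nat N * m * exp (b\<^sup>2 / 2))\<^sup>2)"
proof -
  interpret prob_space std_normal_distribution by (rule prob_space_std_normal)
  let ?s = "Re b"
  define m' where "m' = of_nat N * m * exp (b\<^sup>2 / 2)"
  define A1 where "A1 = real N * exp (2 * ?s\<^sup>2) * A"
  define A' where "A' = A1 + (1 - 1 / real N) * (cmod m')\<^sup>2"
  define B1 where "B1 = of_nat N * exp (2 * b\<^sup>2) * B"
  define B' where "B' = B1 + (1 - 1 / of_nat N) * m'\<^sup>2"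
  have A: "A > 0" and m: "(cmod m)\<^sup>2 \<le> A" and B: "cmod B \<le> A"
    and ex: "\<And>v. cmod (g v - quad_poly m A B v) \<le> C * (sqrt A * cmod v) powr (2 + e)"
    using q by (auto simp: quad_expansion_def)
  have N0: "real N > 0" "1 / real N \<le> 1" using N1 by auto
  have A1: "A1 > 0" using A N0 by (simp add: A1_def)
  have A'A1: "A1 \<le> A'" using N0 by (simp add: A'_def)
  have A'0: "A' > 0" using A1 A'A1 by simp
  have B1: "cmod B1 \<le> A1"
  proof -
    have "Re (2 * b\<^sup>2) \<le> 2 * ?s\<^sup>2" by (simp add: power2_eq_square times_complex.sel)
    then have "cmod (exp (2 * b\<^sup>2)) \<le> exp (2 * ?s\<^sup>2)" by simp
    then have "cmod (exp (2 * b\<^sup>2)) * cmod B \<le> exp (2 * ?s\<^sup>2) * A"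
      using B by (intro mult_mono) auto
    then show ?thesis using N0 by (simp add: B1_def A1_def norm_mult mult.assoc del: norm_exp_eq_Re)
  qed
  have B': "cmod B' \<le> A'"
  proof -
    have "cmod (1 - 1 / complex_of_nat N) = cmod (complex_of_real (1 - 1 / real N))" by simp
    also have "\<dots> = 1 - 1 / real N" using N0 by (subst norm_of_real) simp
    finally show ?thesis
      unfolding B'_def A'_def using B1
      by (intro order_trans[OF norm_triangle_ineq]) (simp add: norm_mult norm_power)
  qed
  have m': "(cmod m')\<^sup>2 \<le> A'"
  proof -
    have "(cmod (exp (b\<^sup>2 / 2)))\<^sup>2 = exp (Re (b\<^sup>2))"
      by (simp add: power2_eq_square mult_exp_exp)
    also have "\<dots> \<le> exp (2 * ?s\<^sup>2)" by (simp add: power2_eq_square times_complex.sel)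
    finally have "(cmod m)\<^sup>2 * (cmod (exp (b\<^sup>2 / 2)))\<^sup>2 \<le> A * exp (2 * ?s\<^sup>2)"
      using m A by (intro mult_mono) auto
    then have "real N * ((cmod m)\<^sup>2 * (cmod (exp (b\<^sup>2 / 2)))\<^sup>2) \<le> real N * (A * exp (2 * ?s\<^sup>2))"
      using N0 by (intro mult_left_mono) auto
    also have "real N * ((cmod m)\<^sup>2 * (cmod (exp (b\<^sup>2 / 2)))\<^sup>2) = (cmod m')\<^sup>2 / N"
      using N0 by (simp add: m'_def norm_mult power_mult_distrib power2_eq_square field_simps)
    finally have "(cmod m')\<^sup>2 / N \<le> A1" by (simp add: A1_def mult_ac)
    then show ?thesis by (simp add: A'_def algebra_simps)
  qed
  \<comment> \<open>The summands pay, in this order, for the range \<open>x >= 1\<close>, for the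
    integrated error of \<open>g\<close>, for replacing the square of \<open>N * t\<close> by that
    of \<open>P1\<close>, and for the cubic remainder of the power.\<close>
  define C' where "C' = 4 + C + (1 + C) * (3 + C) + (2 + C) ^ 3"
  let ?g' = "\<lambda>v. (CLINT x|std_normal_distribution. g (v * exp (b * of_real x))) ^ N"
  have main: "cmod (?g' v - quad_poly m' A' B' v) \<le> C' * (sqrt A' * cmod v) powr (2 + e)" for v
  proof -
    define x where "x = sqrt A' * cmod v"
    have x0: "x \<ge> 0" using A'0 by (simp add: x_def)
    have g'1: "cmod (?g' v) \<le> 1"
      by (auto simp: norm_power intro!: power_le_one norm_integral_std_normal_le g1)
    show ?thesis
    proof (cases "x \<ge> 1")
      \<comment> \<open>For \<open>x >= 1\<close> the new function is bounded and the polynomial at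
        most quadratic in \<open>x\<close>, so the claim holds by size alone.\<close>
      case True
      have "cmod (?g' v - quad_poly m' A' B' v) \<le> 1 + (1 + x + x\<^sup>2 / 2)"
        using norm_quad_poly_le[OF less_imp_le[OF A'0] m' B', of v] g'1
        by (intro order_trans[OF norm_triangle_ineq4] add_mono) (auto simp: x_def)
      also have "\<dots> \<le> 4 * x\<^sup>2"
      proof -
        have "x * 1 \<le> x * x" using True by (intro mult_left_mono) auto
        then have "x \<le> x\<^sup>2" by (simp add: power2_eq_square)
        with True show ?thesis by linarith
      qed
      also have "x\<^sup>2 \<le> x powr (2 + e)"
        using True e powr_mono[of 2 "2 + e" x] by simp
      also have "4 * x powr (2 + e) \<le> C' * x powr (2 + e)"
        unfolding C'_def using C by (intro mult_right_mono) auto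
      finally show ?thesis by (simp add: x_def)
    next
      case False
      then have x1: "x \<le> 1" by simp
      have p3: "x ^ 3 \<le> x powr (2 + e)"
      proof (cases "x = 0")
        case False
        then have "x ^ 3 = x powr 3" using x0 by simp
        also have "\<dots> \<le> x powr (2 + e)"
          using x0 x1 e False by (intro powr_mono') auto
        finally show ?thesis .
      qed simp
      have p1: "x powr (2 + e) \<le> x\<^sup>2"
      proof (cases "x = 0")
        case False
        then have "x powr (2 + e) \<le> x powr 2"
          using x0 x1 e by (intro powr_mono') auto
        then show ?thesis using x0 False by simp
      qed simp
      define t where "t = (CLINT x|std_normal_distribution. g (v * exp (b * of_real x))) - 1"
      \<comment> \<open>\<open>P1\<close> is the mean term, \<open>P2\<close> the diagonal
        second-order term and \<open>E1\<close> the integrated error of the expansion of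
        \<open>g\<close>; only \<open>P1\<close> contributes to the square of \<open>N * t\<close>
        at the relevant order.\<close>
      define P1 where "P1 = \<i> * complex_of_real (Re (v * m'))"
      define P2 where "P2 = - complex_of_real (A1 * (cmod v)\<^sup>2 / 4 + Re (v\<^sup>2 * B1) / 4)"
      define E1 where "E1 = of_nat N * (CLINT x|std_normal_distribution.
          g (v * exp (b * of_real x)) - quad_poly m A B (v * exp (b * of_real x)))"
      have ig: "integrable std_normal_distribution (\<lambda>x. g (v * exp (b * complex_of_real x)))"
        by (rule integrable_const_bound[of _ 1]) (auto simp: g1)
      have Nt: "of_nat N * t = P1 + P2 + E1"
      proof -
        have "E1 = of_nat N * ((1 + t) - (CLINT x|std_normal_distribution. quad_poly m A B (v * exp (b * of_real x))))"
          unfolding E1_def t_def using ig quad_poly_integral(2) by simp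
        also have "\<dots> = of_nat N * t - (P1 + P2)"
        proof -
          have "Re (v * m') = Re (of_nat N * (v * (m * exp (b\<^sup>2 / 2))))" by (simp add: m'_def mult_ac)
          then have a: "Re (v * m') = N * Re (v * (m * exp (b\<^sup>2 / 2)))" by (simp add: times_complex.sel)
          have "Re (v\<^sup>2 * B1) = Re (of_nat N * (v\<^sup>2 * (B * exp (2 * b\<^sup>2))))" by (simp add: B1_def mult_ac)
          then have b: "Re (v\<^sup>2 * B1) = N * Re (v\<^sup>2 * (B * exp (2 * b\<^sup>2)))" by (simp add: times_complex.sel)
          show ?thesis
            unfolding quad_poly_integral(1) P1_def P2_def a b A1_def by (simp add: algebra_simps)
        qed
        finally show ?thesis by simp
      qed
      have E1: "cmod E1 \<le> C * x powr (2 + e)"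
      proof -
        have "cmod E1 \<le> N * (LINT x|std_normal_distribution.
            cmod (g (v * exp (b * of_real x)) - quad_poly m A B (v * exp (b * of_real x))))"
          unfolding E1_def norm_mult norm_of_nat
          by (intro mult_left_mono integral_norm_bound) auto
        also have "\<dots> \<le> N * (LINT x|std_normal_distribution. C * (sqrt A * cmod v) powr (2 + e) * exp ((2 + e) * ?s * x))"
        proof (intro mult_left_mono integral_mono)
          show "integrable std_normal_distribution (\<lambda>x. cmod (g (v * exp (b * of_real x)) - quad_poly m A B (v * exp (b * of_real x))))"
            using ig quad_poly_integral(2) by auto
          show "integrable std_normal_distribution (\<lambda>x. C * (sqrt A * cmod v) powr (2 + e) * exp ((2 + e) * ?s * x))"
            by (intro integrable_mult_right std_normal_exp_real)
          show "cmod (g (v * exp (b * of_real x)) - quad_poly m A B (v * exp (b * of_real x)))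
              \<le> C * (sqrt A * cmod v) powr (2 + e) * exp ((2 + e) * ?s * x)" for x
            using ex[of "v * exp (b * of_real x)"] A
            by (simp add: norm_mult powr_mult exp_powr_real mult_ac)
        qed auto
        also have "\<dots> = C * (sqrt A * cmod v) powr (2 + e) * (N * exp (((2 + e) * ?s)\<^sup>2 / 2))"
          by (simp add: std_normal_exp_real)
        also have "\<dots> \<le> C * (sqrt A * cmod v) powr (2 + e) * ((N * exp (2 * ?s\<^sup>2)) powr (1 + e / 2))"
        proof (rule mult_left_mono)
          \<comment> \<open>The coefficient \<open>(2 + e)\<^sup>2 / 2\<close> equals
            \<open>(2 + e) * (e / 2) + 2 * (1 + e / 2)\<close>, and the Lyapunov condition bounds
            the factor belonging to the first summand by \<open>N powr (e / 2)\<close>.\<close>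
          have "N * exp (((2 + e) * ?s)\<^sup>2 / 2) = N * (exp ((2 + e) * ?s\<^sup>2) powr (e / 2) * exp (2 * ?s\<^sup>2) powr (1 + e / 2))"
            unfolding exp_powr_real mult_exp_exp by (simp add: power2_eq_square field_simps)
          also have "\<dots> \<le> N * (N powr (e / 2) * exp (2 * ?s\<^sup>2) powr (1 + e / 2))"
            using N e by (intro mult_left_mono mult_right_mono powr_mono2) auto
          also have "\<dots> = (N * exp (2 * ?s\<^sup>2)) powr (1 + e / 2)"
            using N0 by (simp add: powr_mult powr_add)
          finally show "N * exp (((2 + e) * ?s)\<^sup>2 / 2) \<le> (N * exp (2 * ?s\<^sup>2)) powr (1 + e / 2)" .
        qed (use C in simp)
        also have "(N * exp (2 * ?s\<^sup>2)) powr (1 + e / 2) = sqrt (N * exp (2 * ?s\<^sup>2)) powr (2 + e)"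
          by (simp add: powr_half_sqrt[symmetric] powr_powr add_divide_distrib)
        also have "C * (sqrt A * cmod v) powr (2 + e) * sqrt (N * exp (2 * ?s\<^sup>2)) powr (2 + e) = C * (sqrt A1 * cmod v) powr (2 + e)"
          using A N0 by (simp add: A1_def real_sqrt_mult powr_mult mult_ac)
        also have "\<dots> \<le> C * x powr (2 + e)"
          unfolding x_def using A'A1 C A1 e by (intro mult_left_mono powr_mono2 mult_right_mono) auto
        finally show ?thesis .
      qed
      have P1: "cmod P1 \<le> x"
        using abs_Re_le[OF m', of v] by (simp add: P1_def norm_mult x_def del: times_complex.sel)
      have P2: "cmod P2 \<le> x\<^sup>2 / 2"
      proof -
        have "\<bar>Re (v\<^sup>2 * B1)\<bar> \<le> A1 * (cmod v)\<^sup>2"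
          using abs_Re_le_cmod[of "v\<^sup>2 * B1"] mult_right_mono[OF B1, of "(cmod v)\<^sup>2"]
          by (simp add: norm_mult norm_power mult.commute del: times_complex.sel)
        then have "\<bar>A1 * (cmod v)\<^sup>2 / 4 + Re (v\<^sup>2 * B1) / 4\<bar> \<le> A1 * (cmod v)\<^sup>2 / 2"
          using A1 unfolding abs_le_iff by auto
        also have "\<dots> \<le> x\<^sup>2 / 2"
          using A'A1 A'0 by (auto simp: x_def power_mult_distrib intro!: mult_right_mono)
        finally show ?thesis by (simp add: P2_def del: times_complex.sel of_real_add)
      qed
      have xx: "x\<^sup>2 \<le> x" using x0 x1 by (simp add: power2_eq_square mult_left_le)
      have P2E1: "cmod (P2 + E1) \<le> (1 + C) * x\<^sup>2"
      proof -
        have "cmod (P2 + E1) \<le> x\<^sup>2 / 2 + C * x powr (2 + e)"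
          by (rule order_trans[OF norm_triangle_ineq add_mono[OF P2 E1]])
        also have "\<dots> \<le> x\<^sup>2 + C * x\<^sup>2" using C p1 by (intro add_mono mult_left_mono) auto
        finally show ?thesis by (simp add: algebra_simps)
      qed
      have Ntb: "real N * cmod t \<le> (2 + C) * x"
      proof -
        have "real N * cmod t = cmod (of_nat N * t)" by (simp add: norm_mult)
        also have "\<dots> \<le> x + (1 + C) * x\<^sup>2"
          unfolding Nt add.assoc by (rule order_trans[OF norm_triangle_ineq add_mono[OF P1 P2E1]])
        also have "\<dots> \<le> x + (1 + C) * x" using xx C by (intro add_left_mono mult_left_mono) auto
        finally show ?thesis by (simp add: algebra_simps)
      qed
      have "cmod (1 + t) \<le> 1"
        unfolding t_def using norm_integral_std_normal_le[of "\<lambda>x. g (v * exp (b * of_real x))"] g1 by simp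
      define R where "R = (1 + t) ^ N - 1 - of_nat N * t - of_nat (N choose 2) * t\<^sup>2"
      have "cmod R \<le> (real N * cmod t) ^ 3"
        unfolding R_def by (rule power_expansion_2) fact
      also have "\<dots> \<le> ((2 + C) * x) ^ 3" using Ntb by (intro power_mono) auto
      finally have R: "cmod R \<le> (2 + C) ^ 3 * x ^ 3" by (simp add: power_mult_distrib)
      have ch: "of_nat (N choose 2) * t\<^sup>2 = (1 - 1 / of_nat N) / 2 * (of_nat N * t)\<^sup>2"
      proof -
        have "real (N choose 2) = real N * (real N - 1) / 2"
          using N1 by (simp add: choose_two real_of_nat_div)
        then have "complex_of_real (real (N choose 2)) = complex_of_real (real N * (real N - 1) / 2)"
          by (rule arg_cong)
        then have c: "(of_nat (N choose 2) :: complex) = of_nat N * (of_nat N - 1) / 2" by simp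
        show ?thesis unfolding c using N0 by (simp add: field_simps power2_eq_square)
      qed
      define D where "D = (of_nat N * t)\<^sup>2 - P1\<^sup>2"
      have D: "cmod D \<le> (1 + C) * (3 + C) * x ^ 3"
      proof -
        have "D = (P2 + E1) * (of_nat N * t + P1)"
          unfolding D_def Nt by (simp add: power2_eq_square algebra_simps)
        also have "cmod \<dots> \<le> (1 + C) * x\<^sup>2 * ((2 + C) * x + x)"
          unfolding norm_mult
        proof (rule mult_mono[OF P2E1])
          show "cmod (of_nat N * t + P1) \<le> (2 + C) * x + x"
            using P1 Ntb by (intro order_trans[OF norm_triangle_ineq] add_mono) (auto simp: norm_mult)
        qed (use C in auto)
        finally show ?thesis by (simp add: algebra_simps power3_eq_cube power2_eq_square)
      qed
      define X where "X = (cmod m')\<^sup>2 * (cmod v)\<^sup>2 / 2 + Re (v\<^sup>2 * m'\<^sup>2) / 2"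
      have P1X: "P1\<^sup>2 = - complex_of_real X"
        unfolding P1_def power_mult_distrib of_real_power[symmetric] Re_square[of "v * m'"]
        by (simp add: X_def norm_mult power_mult_distrib add_divide_distrib mult.commute)
      have N2: "(1 - 1 / of_nat N) / 2 = complex_of_real ((1 - 1 / real N) / 2)" by simp
      have "v\<^sup>2 * B' = v\<^sup>2 * B1 + of_real (1 - 1 / real N) * (v\<^sup>2 * m'\<^sup>2)"
        by (simp add: B'_def algebra_simps)
      then have "Re (v\<^sup>2 * B') = Re (v\<^sup>2 * B1) + (1 - 1 / real N) * Re (v\<^sup>2 * m'\<^sup>2)"
        by (simp only: plus_complex.sel Re_mult_real)
      then have AB: "A' * (cmod v)\<^sup>2 / 4 + Re (v\<^sup>2 * B') / 4 =
          (A1 * (cmod v)\<^sup>2 / 4 + Re (v\<^sup>2 * B1) / 4) + (1 - 1 / real N) / 2 * X"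
        by (simp add: A'_def X_def field_simps)
      have "1 + P1 - (p + q * x) = 1 + P1 + - p + q * (- x)" for p q x :: complex
        by (simp add: algebra_simps)
      then have qp: "quad_poly m' A' B' v = 1 + P1 + P2 + (1 - 1 / of_nat N) / 2 * P1\<^sup>2"
        unfolding quad_poly_def P1_def[symmetric] P2_def P1X N2 AB
        by (simp only: of_real_add of_real_mult)
      have "1 + t = (CLINT x|std_normal_distribution. g (v * exp (b * of_real x)))"
        by (simp add: t_def)
      then have "?g' v = R + 1 + (P1 + P2 + E1) + (1 - 1 / of_nat N) / 2 * (of_nat N * t)\<^sup>2"
        unfolding R_def ch[symmetric] Nt[symmetric] by simp
      moreover have "r + 1 + (p + q + e) + c * y - (1 + p + q + c * z) = e + c * (y - z) + r"
        for r p q e c y z :: complex by (simp add: algebra_simps)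
      ultimately have "?g' v - quad_poly m' A' B' v = E1 + (1 - 1 / of_nat N) / 2 * D + R"
        unfolding qp D_def by (simp only:)
      also have "cmod \<dots> \<le> C * x powr (2 + e) + (1 + C) * (3 + C) * x ^ 3 + (2 + C) ^ 3 * x ^ 3"
      proof -
        have "cmod ((1 - 1 / complex_of_nat N) / 2) = \<bar>(1 - 1 / real N) / 2\<bar>"
          unfolding N2 by (rule norm_of_real)
        also have "\<dots> \<le> 1" using N0 by (auto intro: order_trans[of _ 0])
        finally have "cmod ((1 - 1 / complex_of_nat N) / 2 * D) \<le> 1 * ((1 + C) * (3 + C) * x ^ 3)"
          unfolding norm_mult using D C x0 by (intro mult_mono) auto
        then show ?thesis using E1 R by (intro order_trans[OF norm_triangle_ineq] add_mono) auto
      qed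
      also have "\<dots> \<le> C * x powr (2 + e) + (1 + C) * (3 + C) * x powr (2 + e) + (2 + C) ^ 3 * x powr (2 + e)"
        using p3 C by (intro add_mono mult_left_mono) auto
      also have "\<dots> \<le> C' * x powr (2 + e)"
        by (simp add: C'_def algebra_simps)
      finally show ?thesis by (simp add: x_def)
    qed
  qed
  show ?thesis
    unfolding quad_expansion_def m'_def[symmetric] A1_def[symmetric] B1_def[symmetric] A'_def[symmetric] B'_def[symmetric] C'_def[symmetric]
    using A'0 m' B' main by blast
qed

section \<open>The critical level\<close>

text \<open>Since \<open>N * t\<close> converges and \<open>N\<close> diverges, \<open>t\<close>
  tends to 0; the principal logarithm of \<open>1 + t\<close> then differs from \<open>t\<close>
  quadratically, and \<open>N\<close> times this difference vanishes.\<close>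

lemma power_tendsto_exp:
  fixes t :: "nat \<Rightarrow> complex" and N :: "nat \<Rightarrow> nat"
  assumes N: "filterlim (\<lambda>n. real (N n)) at_top sequentially" and t: "(\<lambda>n. of_nat (N n) * t n) \<longlonglongrightarrow> L"
  shows "(\<lambda>n. (1 + t n) ^ N n) \<longlonglongrightarrow> exp L"
proof -
  have N1: "eventually (\<lambda>n. N n \<ge> 1) sequentially"
    using N[unfolded filterlim_at_top, rule_format, of 1] by simp
  have "(\<lambda>n. inverse (real (N n))) \<longlonglongrightarrow> 0"
    by (rule tendsto_inverse_0_at_top[OF N])
  then have "(\<lambda>n. of_real (inverse (real (N n))) * (of_nat (N n) * t n)) \<longlonglongrightarrow> of_real 0 * L"
    by (intro tendsto_mult t tendsto_of_real)
  then have "(\<lambda>n. of_real (inverse (real (N n))) * (of_nat (N n) * t n)) \<longlonglongrightarrow> 0"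
    by (simp only: of_real_0 mult_zero_left)
  then have "t \<longlonglongrightarrow> 0"
    by (rule Lim_transform_eventually) (use N1 in \<open>auto elim: eventually_mono\<close>)
  then have tn0: "(\<lambda>n. cmod (t n)) \<longlonglongrightarrow> 0" by (simp add: tendsto_norm_zero)
  have "eventually (\<lambda>n. cmod (t n) < 1 / 2) sequentially"
    using tn0 by (rule order_tendstoD) simp
  then have "eventually (\<lambda>n. cmod (of_nat (N n) * Ln (1 + t n) - of_nat (N n) * t n) \<le>
      2 * (cmod (of_nat (N n) * t n) * cmod (t n))) sequentially"
  proof eventually_elim
    case (elim n)
    have "cmod (Ln (1 + t n) - t n) \<le> (cmod (t n))\<^sup>2 / (1 - cmod (t n))"
      by (rule Ln_approx_linear) (use elim in simp)
    also have "\<dots> \<le> (cmod (t n))\<^sup>2 / (1 / 2)"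
      using elim by (intro divide_left_mono) auto
    finally have "real (N n) * cmod (Ln (1 + t n) - t n) \<le> real (N n) * (2 * (cmod (t n))\<^sup>2)"
      by (intro mult_left_mono) auto
    then show ?case
      unfolding right_diff_distrib[symmetric] by (simp add: norm_mult power2_eq_square mult_ac)
  qed
  moreover have "(\<lambda>n. 2 * (cmod (of_nat (N n) * t n) * cmod (t n))) \<longlonglongrightarrow> 2 * (cmod L * 0)"
    by (intro tendsto_mult tendsto_const tendsto_norm t tn0)
  then have "(\<lambda>n. 2 * (cmod (of_nat (N n) * t n) * cmod (t n))) \<longlonglongrightarrow> 0"
    by (simp only: mult_zero_right)
  ultimately have "(\<lambda>n. of_nat (N n) * Ln (1 + t n) - of_nat (N n) * t n) \<longlonglongrightarrow> 0"
    by (rule Lim_null_comparison)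
  from tendsto_add[OF this t] have "(\<lambda>n. of_nat (N n) * Ln (1 + t n)) \<longlonglongrightarrow> L" by simp
  then have "(\<lambda>n. exp (of_nat (N n) * Ln (1 + t n))) \<longlonglongrightarrow> exp L" by (rule tendsto_exp)
  moreover have "eventually (\<lambda>n. exp (of_nat (N n) * Ln (1 + t n)) = (1 + t n) ^ N n) sequentially"
    using \<open>eventually (\<lambda>n. cmod (t n) < 1 / 2) sequentially\<close>
  proof eventually_elim
    case (elim n)
    have "1 + t n \<noteq> 0"
    proof
      assume "1 + t n = 0"
      then have "t n = - 1" by (simp add: add_eq_0_iff)
      with elim show False by simp
    qed
    then show ?case by (simp add: exp_of_nat_mult)
  qed
  ultimately show ?thesis by (rule Lim_transform_eventually)
qed

text \<open>The exponent \<open>p\<close> plays the part of the order of a moment that is finite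
  uniformly in \<open>n\<close>. For \<open>p > 1\<close> a first-order term must be split off,
  hence the mean \<open>m\<close>. Outside the unit disc the bound by 1 on characteristic functions
  is used instead.\<close>

definition char_bound :: "(nat \<Rightarrow> complex \<Rightarrow> complex) \<Rightarrow> (nat \<Rightarrow> complex) \<Rightarrow> real \<Rightarrow> bool" where
  "char_bound g m p \<longleftrightarrow> (\<exists>C\<ge>0. \<forall>\<^sub>F n in sequentially. \<forall>v. cmod v \<le> 1 \<longrightarrow>
     cmod (g n v - 1 - \<i> * of_real (Re (v * m n))) \<le> C * cmod v powr p)"

text \<open>The remainder of the power is at most the square of \<open>N * cmod t\<close>. On the
  unit disc that quantity is at most \<open>(C + 1) * cmod u powr (q / 2)\<close>, because
  \<open>q\<close> is at most 2 and the mean below 1, so its square has again order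
  \<open>q\<close>.\<close>

lemma char_bound_power:
  fixes t :: "nat \<Rightarrow> complex \<Rightarrow> complex" and N :: "nat \<Rightarrow> nat"
  assumes t1: "\<And>n u. cmod (1 + t n u) \<le> 1" and C: "C \<ge> 0" and q: "0 < q" "q \<le> 2" and m: "m \<longlonglongrightarrow> 0"
    and b: "eventually (\<lambda>n. \<forall>u. cmod u \<le> 1 \<longrightarrow> cmod (of_nat (N n) * t n u - \<i> * of_real (Re (u * m n))) \<le> C * cmod u powr q) sequentially"
  shows "char_bound (\<lambda>n u. (1 + t n u) ^ N n) m q"
proof -
  have "eventually (\<lambda>n. cmod (m n) < 1) sequentially"
    using tendsto_norm_zero[OF m] by (rule order_tendstoD) simp
  with b have "eventually (\<lambda>n. \<forall>u. cmod u \<le> 1 \<longrightarrow>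
     cmod ((1 + t n u) ^ N n - 1 - \<i> * of_real (Re (u * m n))) \<le> (C + (C + 1)\<^sup>2) * cmod u powr q) sequentially"
  proof eventually_elim
    case (elim n)
    show ?case
    proof (intro allI impI)
      fix u assume u: "cmod u \<le> 1"
      let ?x = "cmod u powr q"
      define y where "y = of_nat (N n) * t n u"
      have 1: "cmod (y - \<i> * of_real (Re (u * m n))) \<le> C * ?x"
        using elim u by (simp add: y_def)
      have "cmod ((1 + t n u) ^ N n - 1 - y) \<le> (cmod y)\<^sup>2"
        using power_expansion_1[OF t1, of n u "N n"] by (simp add: y_def norm_mult)
      have "cmod y \<le> C * ?x + cmod u"
      proof -
        have "cmod y \<le> cmod (y - \<i> * of_real (Re (u * m n))) + cmod (\<i> * of_real (Re (u * m n)))"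
          using norm_triangle_ineq[of "y - \<i> * of_real (Re (u * m n))" "\<i> * of_real (Re (u * m n))"] by simp
        also have "cmod (\<i> * of_real (Re (u * m n))) \<le> cmod u * cmod (m n)"
          using abs_Re_le_cmod[of "u * m n"] by (simp add: norm_mult)
        also have "\<dots> \<le> cmod u" using elim by (intro mult_left_le) auto
        finally show ?thesis using 1 by linarith
      qed
      also have "C * ?x + cmod u \<le> (C + 1) * cmod u powr (q / 2)"
      proof -
        have "?x \<le> cmod u powr (q / 2)" "cmod u powr 1 \<le> cmod u powr (q / 2)"
          by (rule powr_mono'; use q u in simp)+
        then show ?thesis using C mult_left_mono[of ?x "cmod u powr (q / 2)" C] by (auto simp: algebra_simps)
      qed
      finally have "(cmod y)\<^sup>2 \<le> ((C + 1) * cmod u powr (q / 2))\<^sup>2" by (intro power_mono) auto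
      also have "\<dots> = (C + 1)\<^sup>2 * ?x"
      proof -
        have "cmod u powr (q / 2) * cmod u powr (q / 2) = cmod u powr (q / 2 + q / 2)"
          by (rule powr_add[symmetric])
        then show ?thesis by (simp add: power2_eq_square)
      qed
      finally have "cmod ((1 + t n u) ^ N n - 1 - y) \<le> (C + 1)\<^sup>2 * ?x"
        using \<open>cmod ((1 + t n u) ^ N n - 1 - y) \<le> (cmod y)\<^sup>2\<close> by linarith
      then have "cmod ((1 + t n u) ^ N n - 1 - \<i> * of_real (Re (u * m n))) \<le> (C + 1)\<^sup>2 * ?x + C * ?x"
        using 1 by (rule norm_diff_triangle_le)
      then show "cmod ((1 + t n u) ^ N n - 1 - \<i> * of_real (Re (u * m n))) \<le> (C + (C + 1)\<^sup>2) * ?x"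
        by (simp add: algebra_simps)
    qed
  qed
  then show ?thesis unfolding char_bound_def using C by (intro exI[of _ "C + (C + 1)\<^sup>2"]) auto
qed

text \<open>A shift by half a period \<open>pi / \<omega>\<close> reverses the sign of the
  oscillating factor, so twice the integral is bounded by the L1 distance between the half-normal
  density and its translate. Scheffe's lemma sends this distance to 0, the jump at the origin being
  a null set.\<close>

lemma Riemann_Lebesgue_half_normal:
  assumes \<omega>: "filterlim \<omega> at_top sequentially"
  shows "(\<lambda>n. CLINT x|std_normal_distribution. indicator {..<0} x * iexp (\<omega> n * x)) \<longlonglongrightarrow> 0"
proof -
  define f where "f x = indicator {..<0} x * std_normal_density x" for x :: real
  have [measurable]: "f \<in> borel_measurable borel" unfolding f_def by measurable
  have fI: "integrable lborel f"
    unfolding f_def using integrable_normal_density[of 1 0]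
    by (intro Bochner_Integration.integrable_bound[OF integrable_normal_density[of 1 0]]) (auto simp: indicator_def)
  define h where "h n = pi / \<omega> n" for n
  have h: "h \<longlonglongrightarrow> 0"
    unfolding h_def by (intro tendsto_divide_0[OF tendsto_const] filterlim_at_top_imp_at_infinity \<omega>)
  have S: "(\<lambda>n. \<integral>\<^sup>+x. norm (f (h n + x) - f x) \<partial>lborel) \<longlonglongrightarrow> 0"
  proof (rule Scheffe_lemma2)
    have "AE x in lborel. x \<noteq> (0::real)" by (rule AE_lborel_singleton)
    then show "AE x in lborel. (\<lambda>n. f (h n + x)) \<longlonglongrightarrow> f x"
    proof eventually_elim
      case (elim x)
      have "isCont f x"
      proof (cases "x < 0")
        case True
        have "isCont std_normal_density x" unfolding std_normal_density_def by (intro continuous_intros) auto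
        moreover have "eventually (\<lambda>y. y \<in> {..<0}) (nhds x)"
          using True by (intro eventually_nhds_in_open) auto
        then have "eventually (\<lambda>y. std_normal_density y = f y) (nhds x)"
          by eventually_elim (simp add: f_def)
        ultimately show ?thesis using isCont_cong by blast
      next
        case False
        then have "x > 0" using elim by simp
        then have "eventually (\<lambda>y. y \<in> {0<..}) (nhds x)" by (intro eventually_nhds_in_open) auto
        then have "eventually (\<lambda>y. 0 = f y) (nhds x)"
          by eventually_elim (simp add: f_def)
        then show ?thesis using isCont_cong[of "\<lambda>_. 0" f x] by simp
      qed
      moreover have "(\<lambda>n. h n + x) \<longlonglongrightarrow> 0 + x" by (intro tendsto_intros h)
      ultimately show ?case by (auto intro: isCont_tendsto_compose)
    qed
    show "(\<integral>\<^sup>+x. norm (f (h n + x)) \<partial>lborel) \<le> (\<integral>\<^sup>+x. norm (f x) \<partial>lborel)" for n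
      using nn_integral_real_affine[of "\<lambda>x. ennreal (norm (f x))" 1 "h n"] by simp
  qed (auto simp: fI)
  have eq: "eventually (\<lambda>n. cmod (CLINT x|std_normal_distribution. indicator {..<0} x * iexp (\<omega> n * x))
      \<le> enn2real (\<integral>\<^sup>+x. norm (f (h n + x) - f x) \<partial>lborel)) sequentially"
    using filterlim_at_top_dense[THEN iffD1, OF \<omega>, rule_format, of 0]
  proof eventually_elim
    case (elim n)
    have fhI: "integrable lborel (\<lambda>x. f (h n + x))"
      using lborel_integrable_real_affine[OF fI, of 1 "h n"] by simp
    have fc: "integrable lborel (\<lambda>x. of_real (g x) * iexp (\<omega> n * x))" if "integrable lborel g" for g
      by (rule Bochner_Integration.integrable_bound[OF that]) (use that in \<open>auto simp: norm_mult simp del: of_real_mult\<close>)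
    have "(CLINT x|std_normal_distribution. indicator {..<0} x * iexp (\<omega> n * x)) =
        (CLINT x|lborel. of_real (f x) * iexp (\<omega> n * x))"
      by (subst integral_density) (auto simp: f_def scaleR_conv_of_real indicator_def intro!: Bochner_Integration.integral_cong)
    also have "\<dots> = (CLINT x|lborel. of_real (f (h n + x)) * iexp (\<omega> n * (h n + x)))"
      by (subst lborel_integral_real_affine[where c=1 and t="h n"]) auto
    also have "\<dots> = (CLINT x|lborel. - (of_real (f (h n + x)) * iexp (\<omega> n * x)))"
    proof (intro Bochner_Integration.integral_cong refl)
      fix x
      have "iexp (\<omega> n * (h n + x)) = iexp (pi + \<omega> n * x)"
        using elim by (simp add: h_def ring_distribs)
      also have "\<dots> = - iexp (\<omega> n * x)" by (simp add: ring_distribs exp_add)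
      finally show "of_real (f (h n + x)) * iexp (\<omega> n * (h n + x)) = - (of_real (f (h n + x)) * iexp (\<omega> n * x))"
        by simp
    qed
    also have "\<dots> = - (CLINT x|lborel. of_real (f (h n + x)) * iexp (\<omega> n * x))" by simp
    finally have a: "(CLINT x|std_normal_distribution. indicator {..<0} x * iexp (\<omega> n * x)) =
      - (CLINT x|lborel. of_real (f (h n + x)) * iexp (\<omega> n * x))" .
    have b: "(CLINT x|std_normal_distribution. indicator {..<0} x * iexp (\<omega> n * x)) =
        (CLINT x|lborel. of_real (f x) * iexp (\<omega> n * x))"
      by (subst integral_density) (auto simp: f_def scaleR_conv_of_real indicator_def intro!: Bochner_Integration.integral_cong)
    have "2 * (CLINT x|std_normal_distribution. indicator {..<0} x * iexp (\<omega> n * x)) =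
      - ((CLINT x|lborel. of_real (f (h n + x)) * iexp (\<omega> n * x)) - (CLINT x|lborel. of_real (f x) * iexp (\<omega> n * x)))"
      using a b by simp
    also have "\<dots> = - (CLINT x|lborel. of_real (f (h n + x) - f x) * iexp (\<omega> n * x))"
      by (subst Bochner_Integration.integral_diff[symmetric]) (use fc[OF fI] fc[OF fhI] in \<open>simp_all only: left_diff_distrib of_real_diff\<close>)
    finally have "cmod (2 * (CLINT x|std_normal_distribution. indicator {..<0} x * iexp (\<omega> n * x))) =
       cmod (CLINT x|lborel. of_real (f (h n + x) - f x) * iexp (\<omega> n * x))"
      by (simp only: norm_minus_cancel)
    then have "2 * cmod (CLINT x|std_normal_distribution. indicator {..<0} x * iexp (\<omega> n * x)) =
       cmod (CLINT x|lborel. of_real (f (h n + x) - f x) * iexp (\<omega> n * x))"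
      by (simp only: norm_mult norm_numeral)
    also have "\<dots> \<le> (LINT x|lborel. cmod (of_real (f (h n + x) - f x) * iexp (\<omega> n * x)))"
      by (rule integral_norm_bound)
    also have "\<dots> = (LINT x|lborel. \<bar>f (h n + x) - f x\<bar>)"
      by (simp add: norm_mult del: of_real_diff of_real_mult)
    also have "\<dots> = enn2real (\<integral>\<^sup>+x. norm (f (h n + x) - f x) \<partial>lborel)"
      using fI fhI by (subst integral_eq_nn_integral) auto
    finally have "2 * cmod (CLINT x|std_normal_distribution. indicator {..<0} x * iexp (\<omega> n * x)) \<le>
      enn2real (\<integral>\<^sup>+x. norm (f (h n + x) - f x) \<partial>lborel)" .
    moreover have "0 \<le> cmod (CLINT x|std_normal_distribution. indicator {..<0} x * iexp (\<omega> n * x))" by simp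
    ultimately show ?case by linarith
  qed
  have "(\<lambda>n. enn2real (\<integral>\<^sup>+x. norm (f (h n + x) - f x) \<partial>lborel)) \<longlonglongrightarrow> 0"
    by (rule tendsto_enn2real) (use S in simp_all)
  then show ?thesis
    by (intro Lim_null_comparison[OF eq]) simp
qed

text \<open>Integrability of the limit function is recorded as well: at the extremal levels it
  becomes the integrability demanded by the Laplace recursion.\<close>

lemma tendsto_integral_dominated_eventually:
  fixes f :: "nat \<Rightarrow> 'a \<Rightarrow> 'b::{banach, second_countable_topology}"
  assumes w: "integrable M w" and b: "eventually (\<lambda>n. \<forall>x. norm (f n x) \<le> w x) sequentially"
    and f[measurable]: "\<And>n. f n \<in> borel_measurable M" and lim: "AE x in M. (\<lambda>n. f n x) \<longlonglongrightarrow> l x"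
    and l[measurable]: "l \<in> borel_measurable M"
  shows "(\<lambda>n. \<integral>x. f n x \<partial>M) \<longlonglongrightarrow> (\<integral>x. l x \<partial>M)" and "integrable M l"
proof -
  obtain n0 where n0: "\<And>n x. n \<ge> n0 \<Longrightarrow> norm (f n x) \<le> w x"
    using b by (auto simp: eventually_sequentially)
  have lim': "AE x in M. (\<lambda>n. f (n + n0) x) \<longlonglongrightarrow> l x"
    using lim by eventually_elim (rule LIMSEQ_ignore_initial_segment)
  have b': "AE x in M. norm (f (n + n0) x) \<le> w x" for n
    using n0[of "n + n0"] by auto
  have "(\<lambda>n. \<integral>x. f (n + n0) x \<partial>M) \<longlonglongrightarrow> (\<integral>x. l x \<partial>M)"
    by (rule integral_dominated_convergence[OF _ _ w lim' b']) auto
  then show "(\<lambda>n. \<integral>x. f n x \<partial>M) \<longlonglongrightarrow> (\<integral>x. l x \<partial>M)" by (rule LIMSEQ_offset)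
  show "integrable M l"
    by (rule integrable_dominated_convergence[OF _ _ w lim' b']) auto
qed

text \<open>Here \<open>2 * Re b = sqrt \<kappa>\<close> while \<open>N\<close> is about
  \<open>exp (\<kappa> / 2)\<close>, and \<open>c\<close> scales the diagonal part of the second
  moment to 1. After the tilt the weight \<open>W\<close> tends to 0 for \<open>x > 0\<close>, where
  points are too rare to matter, and to infinity for \<open>x < 0\<close>, where each summand is
  negligible and its quadratic term decides. Half the Gaussian mass thus contributes, and
  \<open>(cmod u)\<^sup>2 / 4\<close> becomes \<open>(cmod u)\<^sup>2 / 8\<close>.\<close>

lemma critical_level:
  fixes N :: "nat \<Rightarrow> nat" and \<kappa> A c :: "nat \<Rightarrow> real" and b m B :: "nat \<Rightarrow> complex"
    and \<Phi> :: "nat \<Rightarrow> complex \<Rightarrow> complex"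
  assumes \<kappa>: "filterlim \<kappa> at_top sequentially"
    and N: "(\<lambda>n. N n * exp (- \<kappa> n / 2)) \<longlonglongrightarrow> 1"
    and Reb: "\<And>n. Re (b n) = sqrt (\<kappa> n) / 2"
    and Imb: "filterlim (\<lambda>n. Im (b n)) at_top sequentially"
    and \<kappa>0: "\<And>n. \<kappa> n \<ge> 0"
    and q: "eventually (\<lambda>n. quad_expansion C e (\<Phi> n) (m n) (A n) (B n)) sequentially"
    and e: "0 < e" "e \<le> 1" and C: "C \<ge> 0"
    and \<Phi>[measurable]: "\<And>n. \<Phi> n \<in> borel_measurable borel" and \<Phi>1: "\<And>n v. cmod (\<Phi> n v) \<le> 1"
    and c: "\<And>n. c n = 1 / sqrt (N n * exp (\<kappa> n / 2) * A n)"
    and m': "m' = (\<lambda>n. of_nat (N n) * of_real (c n) * m n * exp ((b n)\<^sup>2 / 2))"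
    and m'0: "m' \<longlonglongrightarrow> 0"
    and g: "g = (\<lambda>n u. (CLINT x|std_normal_distribution. \<Phi> n (u * of_real (c n) * exp (b n * of_real x))) ^ N n)"
  shows "(\<lambda>n. g n u) \<longlonglongrightarrow> of_real (exp (- (cmod u)\<^sup>2 / 8))"
    and "char_bound g m' 2"
proof -
  interpret prob_space std_normal_distribution by (rule prob_space_std_normal)
  have Ntop: "filterlim (\<lambda>n. real (N n)) at_top sequentially"
  proof -
    have "filterlim (\<lambda>n. (N n * exp (- \<kappa> n / 2)) * exp (\<kappa> n / 2)) at_top sequentially"
      by (rule filterlim_tendsto_pos_mult_at_top[OF N])
         (auto intro!: filterlim_compose[OF exp_at_top] filterlim_at_top_mult_tendsto_pos[where c="1/2", OF tendsto_const, simplified] \<kappa>)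
    then show ?thesis by (simp add: mult_exp_exp mult.assoc)
  qed
  \<comment> \<open>With \<open>r\<close> the rescaled modulus, \<open>2 + r\<close> is at most
    three times the square of \<open>r\<close> when \<open>r >= 1\<close>, and
    \<open>C + 1 / 2\<close> suffices for smaller \<open>r\<close>.\<close>
  define K where "K = 3 + C"
  define W where "W n x = N n * exp (- \<kappa> n / 2) * exp (- sqrt (\<kappa> n) * x)" for n x
  define v where "v u n x = u * of_real (c n) * exp (b n * of_real (x + sqrt (\<kappa> n)))" for u n x
  define \<Psi> where "\<Psi> n w = \<Phi> n w - 1 - \<i> * of_real (Re (w * m n))" for n w
  define t where "t n u = (CLINT x|std_normal_distribution. \<Phi> n (u * of_real (c n) * exp (b n * of_real x))) - 1" for n u
  have [measurable]: "\<Psi> n \<in> borel_measurable borel" for n unfolding \<Psi>_def by measurable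
  have [measurable]: "(\<lambda>x. v u n x) \<in> borel_measurable borel" for u n unfolding v_def by measurable
  have [measurable]: "(\<lambda>x. W n x) \<in> borel_measurable borel" for n unfolding W_def by measurable
  have t1: "cmod (1 + t n u) \<le> 1" for n u
    unfolding t_def using norm_integral_std_normal_le[of "\<lambda>x. \<Phi> n (u * of_real (c n) * exp (b n * of_real x))"] \<Phi>1 by simp
  have gt: "g = (\<lambda>n u. (1 + t n u) ^ N n)" by (simp add: g t_def)
  define good where "good n \<longleftrightarrow> N n \<ge> 1 \<and> quad_expansion C e (\<Phi> n) (m n) (A n) (B n)" for n
  have good: "eventually good sequentially"
    unfolding good_def using q Ntop[unfolded filterlim_at_top, rule_format, of 1] by eventually_elim auto
  have W0: "W n x \<ge> 0" for n x by (simp add: W_def)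
  text \<open>The weight \<open>W\<close> is the density of the \<open>N n\<close> points after tilting by
    \<open>exp (sqrt (\<kappa> n) * x)\<close>, which recentres the Gaussian at the edge.\<close>
  have NPsi: "of_nat (N n) * t n u - \<i> * of_real (Re (u * m' n)) =
      (CLINT x|std_normal_distribution. of_real (W n x) * \<Psi> n (v u n x))" for n u
  proof -
    let ?w = "\<lambda>x. u * of_real (c n) * exp (b n * complex_of_real x)"
    have i: "integrable std_normal_distribution (\<lambda>x. ?w x * m n)"
      by (intro integrable_mult_left integrable_mult_right std_normal_exp)
    have "(LINT x|std_normal_distribution. Re (?w x * m n)) = Re (CLINT x|std_normal_distribution. ?w x * m n)"
      using i by (rule integral_Re)
    also have "(CLINT x|std_normal_distribution. ?w x * m n) = u * of_real (c n) * exp ((b n)\<^sup>2 / 2) * m n"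
      by (simp add: std_normal_exp)
    finally have I1: "(LINT x|std_normal_distribution. Re (?w x * m n)) =
      Re (u * of_real (c n) * exp ((b n)\<^sup>2 / 2) * m n)" .
    have "Re (u * m' n) = Re (of_nat (N n) * (u * of_real (c n) * exp ((b n)\<^sup>2 / 2) * m n))"
      by (simp add: m' mult_ac)
    then have I2: "Re (u * m' n) = N n * Re (u * of_real (c n) * exp ((b n)\<^sup>2 / 2) * m n)"
      by (simp only: Re_mult_real)
    have "(CLINT x|std_normal_distribution. \<Psi> n (?w x)) = t n u - \<i> * of_real (Re (u * of_real (c n) * exp ((b n)\<^sup>2 / 2) * m n))"
    proof -
      have "integrable std_normal_distribution (\<lambda>x. \<Phi> n (?w x))"
        by (rule integrable_const_bound[of _ 1]) (auto simp: \<Phi>1)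
      moreover have "integrable std_normal_distribution (\<lambda>x. \<i> * complex_of_real (Re (?w x * m n)))"
        using i by (intro integrable_mult_right integrable_of_real integrable_Re)
      ultimately show ?thesis
        unfolding \<Psi>_def using prob_space by (simp add: I1 t_def)
    qed
    then have s0: "of_nat (N n) * t n u - \<i> * of_real (Re (u * m' n)) = of_nat (N n) * (CLINT x|std_normal_distribution. \<Psi> n (?w x))"
      unfolding I2 by (simp only: of_real_mult of_real_of_nat_eq right_diff_distrib mult.left_commute)
    define E where "E x = exp (- sqrt (\<kappa> n) * x)" for x
    have Em[measurable]: "E \<in> borel_measurable borel" unfolding E_def by measurable
    have ee: "exp (sqrt (\<kappa> n) * x) *\<^sub>R (E x *\<^sub>R \<Psi> n (?w x)) = \<Psi> n (?w x)" for x
      by (simp add: E_def mult_exp_exp)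
    have "(CLINT x|std_normal_distribution. exp (sqrt (\<kappa> n) * x) *\<^sub>R (E x *\<^sub>R \<Psi> n (?w x))) =
       exp ((sqrt (\<kappa> n))\<^sup>2 / 2) *\<^sub>R (CLINT x|std_normal_distribution. E (x + sqrt (\<kappa> n)) *\<^sub>R \<Psi> n (?w (x + sqrt (\<kappa> n))))"
      by (rule integral_std_normal_tilt(1)[of "\<lambda>x. E x *\<^sub>R \<Psi> n (?w x)" "sqrt (\<kappa> n)"]) measurable
    then have s1: "(CLINT x|std_normal_distribution. \<Psi> n (?w x)) =
       exp (\<kappa> n / 2) *\<^sub>R (CLINT x|std_normal_distribution. E (x + sqrt (\<kappa> n)) *\<^sub>R \<Psi> n (v u n x))"
      unfolding ee v_def[symmetric] real_sqrt_pow2[OF \<kappa>0] .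
    have W: "real (N n) * exp (\<kappa> n / 2) * E (x + sqrt (\<kappa> n)) = W n x" for x
    proof -
      have "real (N n) * exp (\<kappa> n / 2) * E (x + sqrt (\<kappa> n)) = real (N n) * (exp (\<kappa> n / 2 + - sqrt (\<kappa> n) * (x + sqrt (\<kappa> n))))"
        by (simp only: E_def exp_add mult.assoc)
      also have "\<kappa> n / 2 + - sqrt (\<kappa> n) * (x + sqrt (\<kappa> n)) = - \<kappa> n / 2 + - sqrt (\<kappa> n) * x"
        using real_sqrt_mult_self[of "\<kappa> n"] \<kappa>0[of n] by (simp add: algebra_simps)
      finally show ?thesis unfolding W_def exp_add by (simp only: mult.assoc)
    qed
    have "of_nat (N n) * (CLINT x|std_normal_distribution. \<Psi> n (?w x)) =
      of_real (real (N n) * exp (\<kappa> n / 2)) * (CLINT x|std_normal_distribution. E (x + sqrt (\<kappa> n)) *\<^sub>R \<Psi> n (v u n x))"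
      unfolding s1 by (simp add: scaleR_conv_of_real)
    also have "\<dots> = (CLINT x|std_normal_distribution. of_real (real (N n) * exp (\<kappa> n / 2)) * (E (x + sqrt (\<kappa> n)) *\<^sub>R \<Psi> n (v u n x)))"
      by (rule integral_mult_right_zero[symmetric])
    also have "\<dots> = (CLINT x|std_normal_distribution. of_real (W n x) * \<Psi> n (v u n x))"
      unfolding W[symmetric] by (simp add: scaleR_conv_of_real mult.assoc)
    finally show ?thesis unfolding s0 .
  qed
  have cA: "(c n)\<^sup>2 * A n * (N n * exp (\<kappa> n / 2)) = 1" "A n > 0" "N n > 0" if "good n" for n
    using that by (auto simp: c good_def quad_expansion_def power_divide field_simps)
  have ncv: "cmod (v u n x) = cmod u * \<bar>c n\<bar> * exp ((sqrt (\<kappa> n) * x + \<kappa> n) / 2)" for u n x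
    using \<kappa>0[of n] by (simp add: v_def norm_mult Reb algebra_simps add_divide_distrib)
  \<comment> \<open>The weight exactly cancels the growth of the squared modulus. This is the
    algebraic form of criticality, and it makes the dominating functions below constant in
    \<open>x\<close>.\<close>
  have Wrho: "W n x * (A n * (cmod (v u n x))\<^sup>2) = (cmod u)\<^sup>2" if "good n" for n x u
  proof -
    have "(cmod (v u n x))\<^sup>2 = (cmod u)\<^sup>2 * (c n)\<^sup>2 * exp (sqrt (\<kappa> n) * x + \<kappa> n)"
      unfolding ncv by (simp add: power_mult_distrib exp_double[symmetric])
    then have "W n x * (A n * (cmod (v u n x))\<^sup>2) = (cmod u)\<^sup>2 * ((c n)\<^sup>2 * A n * (N n * (exp (- \<kappa> n / 2) * exp (- sqrt (\<kappa> n) * x) * exp (sqrt (\<kappa> n) * x + \<kappa> n))))"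
      by (simp add: W_def mult_ac)
    also have "exp (- \<kappa> n / 2) * exp (- sqrt (\<kappa> n) * x) * exp (sqrt (\<kappa> n) * x + \<kappa> n) = exp (\<kappa> n / 2)"
      unfolding mult_exp_exp by simp
    finally show ?thesis using cA(1)[OF that] by simp
  qed
  have Psi_le: "cmod (\<Psi> n w) \<le> 2 + sqrt (A n) * cmod w" if "good n" for n w
  proof -
    have "cmod (\<Psi> n w) \<le> cmod (\<Phi> n w) + 1 + \<bar>Re (w * m n)\<bar>"
      unfolding \<Psi>_def by (intro order_trans[OF norm_triangle_ineq4] add_mono) (auto simp: norm_mult)
    also have "\<dots> \<le> 1 + 1 + sqrt (A n) * cmod w"
      using that \<Phi>1 by (intro add_mono abs_Re_le) (auto simp: good_def quad_expansion_def)
    finally show ?thesis by simp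
  qed
  define Q where "Q n w = complex_of_real (A n * (cmod w)\<^sup>2 / 4 + Re (w\<^sup>2 * B n) / 4)" for n w
  have Psi_Q: "cmod (\<Psi> n w + Q n w) \<le> C * (sqrt (A n) * cmod w) powr (2 + e)" if "good n" for n w
    using that by (auto simp: good_def quad_expansion_def quad_poly_def \<Psi>_def Q_def algebra_simps)
  have Q_le: "cmod (Q n w) \<le> (sqrt (A n) * cmod w)\<^sup>2 / 2" if "good n" for n w
  proof -
    have "\<bar>Re (w\<^sup>2 * B n)\<bar> \<le> cmod (w\<^sup>2 * B n)" by (rule abs_Re_le_cmod)
    also have "\<dots> \<le> A n * (cmod w)\<^sup>2"
      using that by (simp add: norm_mult norm_power mult.commute mult_right_mono good_def quad_expansion_def)
    finally have "\<bar>A n * (cmod w)\<^sup>2 / 4 + Re (w\<^sup>2 * B n) / 4\<bar> \<le> A n * (cmod w)\<^sup>2 / 2"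
      using cA(2)[OF that] unfolding abs_le_iff by auto
    then show ?thesis using cA(2)[OF that] by (simp add: Q_def power_mult_distrib del: of_real_add)
  qed
  have Psi_K: "cmod (\<Psi> n w) \<le> K * (sqrt (A n) * cmod w)\<^sup>2" if "good n" for n w
  proof -
    define r where "r = sqrt (A n) * cmod w"
    have r0: "r \<ge> 0" using cA(2)[OF that] by (simp add: r_def)
    show ?thesis
    proof (cases "r \<ge> 1")
      case True
      have "r * 1 \<le> r * r" using True by (intro mult_left_mono) auto
      then have "r \<le> r\<^sup>2" by (simp add: power2_eq_square)
      then have "2 + r \<le> 3 * r\<^sup>2" using True by linarith
      also have "\<dots> \<le> K * r\<^sup>2" using C by (intro mult_right_mono) (auto simp: K_def)
      finally show ?thesis using Psi_le[OF that, of w] by (simp add: r_def)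
    next
      case False
      have "r powr (2 + e) \<le> r\<^sup>2"
      proof (cases "r = 0")
        case nz: False
        then have "r powr (2 + e) \<le> r powr 2" using r0 False e by (intro powr_mono') auto
        then show ?thesis using r0 nz by simp
      qed simp
      then have "C * r powr (2 + e) \<le> C * r\<^sup>2" using C by (rule mult_left_mono)
      moreover have "cmod (\<Psi> n w) \<le> C * r powr (2 + e) + r\<^sup>2 / 2"
        using Psi_Q[OF that, of w] Q_le[OF that, of w] norm_triangle_ineq4[of "\<Psi> n w + Q n w" "Q n w"] by (simp add: r_def)
      ultimately have "cmod (\<Psi> n w) \<le> C * r\<^sup>2 + r\<^sup>2 / 2" by linarith
      also have "\<dots> \<le> K * r\<^sup>2" by (simp add: K_def algebra_simps)
      finally show ?thesis by (simp add: r_def)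
    qed
  qed
  have WPsi: "cmod (of_real (W n x) * \<Psi> n (v u n x)) \<le> K * (cmod u)\<^sup>2" if "good n" for n x u
  proof -
    have "W n x * cmod (\<Psi> n (v u n x)) \<le> W n x * (K * (sqrt (A n) * cmod (v u n x))\<^sup>2)"
      using Psi_K[OF that] W0 by (rule mult_left_mono)
    also have "\<dots> = K * (W n x * (A n * (cmod (v u n x))\<^sup>2))"
      using cA(2)[OF that] by (simp add: power_mult_distrib)
    finally show ?thesis unfolding Wrho[OF that] using W0[of n x] by (simp add: norm_mult)
  qed
  have K0: "K \<ge> 0" using C by (simp add: K_def)
  show "char_bound g m' 2"
    unfolding gt
  proof (rule char_bound_power[OF t1 K0 _ _ m'0])
    show "\<forall>\<^sub>F n in sequentially. \<forall>u. cmod u \<le> 1 \<longrightarrow> cmod (of_nat (N n) * t n u - \<i> * of_real (Re (u * m' n))) \<le> K * cmod u powr 2"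
      using good
    proof eventually_elim
      case (elim n)
      show ?case
      proof (intro allI impI)
        fix u
        have "cmod (of_nat (N n) * t n u - \<i> * of_real (Re (u * m' n))) \<le> (LINT x|std_normal_distribution. cmod (of_real (W n x) * \<Psi> n (v u n x)))"
          unfolding NPsi by (rule integral_norm_bound)
        also have "\<dots> \<le> (LINT x|std_normal_distribution. K * (cmod u)\<^sup>2)"
          using WPsi[OF elim, of _ u]
          by (intro integral_mono integrable_norm) (auto intro!: integrable_const_bound[of _ "K * (cmod u)\<^sup>2"])
        also have "\<dots> = K * cmod u powr 2" using prob_space by simp
        finally show "cmod (of_nat (N n) * t n u - \<i> * of_real (Re (u * m' n))) \<le> K * cmod u powr 2" .
      qed
    qed
  qed simp_all
  have "(\<lambda>n. of_nat (N n) * t n u) \<longlonglongrightarrow> - of_real ((cmod u)\<^sup>2 / 8)"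
  proof -
    \<comment> \<open>\<open>J\<close> is the quadratic term on the surviving half line
      \<open>x < 0\<close>. As \<open>\<Psi>\<close> is close to \<open>- Q\<close>, adding
      \<open>J\<close> makes the integrand vanish almost everywhere in the limit.\<close>
    define J where "J n x = of_real (W n x) * (indicator {..<0} x * Q n (v u n x))" for n x
    have [measurable]: "(\<lambda>x. Q n (v u n x)) \<in> borel_measurable borel" for n unfolding Q_def by measurable
    have sk: "filterlim (\<lambda>n. sqrt (\<kappa> n)) at_top sequentially"
      by (rule filterlim_compose[OF sqrt_at_top \<kappa>])
    have WJ: "cmod (J n x) \<le> (cmod u)\<^sup>2 / 2" if "good n" for n x
    proof -
      have "cmod (J n x) \<le> W n x * cmod (Q n (v u n x))"
        using W0[of n x] by (auto simp: J_def norm_mult indicator_def)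
      also have "\<dots> \<le> W n x * ((sqrt (A n) * cmod (v u n x))\<^sup>2 / 2)"
        using Q_le[OF that] W0 by (rule mult_left_mono)
      also have "\<dots> = W n x * (A n * (cmod (v u n x))\<^sup>2) / 2"
        using cA(2)[OF that] by (simp add: power_mult_distrib)
      finally show ?thesis unfolding Wrho[OF that] .
    qed
    have Winf: "(\<lambda>n. W n x) \<longlonglongrightarrow> 0" if "x > 0" for x
    proof -
      have "(\<lambda>n. N n * exp (- \<kappa> n / 2) * exp (- (sqrt (\<kappa> n) * x))) \<longlonglongrightarrow> 1 * 0"
        by (intro tendsto_mult N filterlim_compose[OF exp_at_bot] filterlim_uminus_at_bot[THEN iffD2] filterlim_at_top_mult_tendsto_pos[OF tendsto_const] sk that)
           (use that sk in \<open>auto intro!: filterlim_at_top_mult_tendsto_pos[OF tendsto_const]\<close>)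
      then show ?thesis by (simp add: W_def)
    qed
    have Wm: "filterlim (\<lambda>n. W n x) at_top sequentially" if "x < 0" for x
    proof -
      have "filterlim (\<lambda>n. sqrt (\<kappa> n) * (- x)) at_top sequentially"
        using that by (intro filterlim_at_top_mult_tendsto_pos[OF tendsto_const] sk) auto
      then have "filterlim (\<lambda>n. (N n * exp (- \<kappa> n / 2)) * exp (sqrt (\<kappa> n) * (- x))) at_top sequentially"
        by (intro filterlim_tendsto_pos_mult_at_top[OF N] filterlim_compose[OF exp_at_top]) auto
      then show ?thesis by (simp add: W_def)
    qed
    have R: "(\<lambda>n. CLINT x|std_normal_distribution. of_real (W n x) * \<Psi> n (v u n x) + J n x) \<longlonglongrightarrow> (CLINT x|std_normal_distribution. 0)"
    proof (rule tendsto_integral_dominated_eventually(1)[where w="\<lambda>_. K * (cmod u)\<^sup>2 + (cmod u)\<^sup>2 / 2"])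
      show "eventually (\<lambda>n. \<forall>x. cmod (of_real (W n x) * \<Psi> n (v u n x) + J n x) \<le> K * (cmod u)\<^sup>2 + (cmod u)\<^sup>2 / 2) sequentially"
        using good by eventually_elim (auto intro!: order_trans[OF norm_triangle_ineq] add_mono WPsi WJ)
      show "(\<lambda>x. of_real (W n x) * \<Psi> n (v u n x) + J n x) \<in> borel_measurable std_normal_distribution" for n
        unfolding J_def by measurable
      have "AE x in lborel. x \<noteq> (0::real)" by (rule AE_lborel_singleton)
      then have "AE x in std_normal_distribution. x \<noteq> 0" by (auto simp: AE_density)
      then show "AE x in std_normal_distribution. (\<lambda>n. of_real (W n x) * \<Psi> n (v u n x) + J n x) \<longlonglongrightarrow> 0"
      proof eventually_elim
        case (elim x)
        show ?case
        proof (cases "x > 0")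
          case True
          \<comment> \<open>For \<open>x > 0\<close> the linear bound on \<open>\<Psi>\<close> is
            used: the rescaled modulus grows only like \<open>1 / sqrt (W n x)\<close>, and the
            factor \<open>W n x\<close> outweighs it.\<close>
          have "eventually (\<lambda>n. cmod (of_real (W n x) * \<Psi> n (v u n x) + J n x) \<le> 2 * W n x + sqrt (W n x) * cmod u) sequentially"
            using good
          proof eventually_elim
            case (elim n)
            have "cmod (of_real (W n x) * \<Psi> n (v u n x) + J n x) = W n x * cmod (\<Psi> n (v u n x))"
              using True W0[of n x] by (simp add: J_def norm_mult)
            also have "\<dots> \<le> W n x * (2 + sqrt (A n) * cmod (v u n x))"
              using Psi_le[OF elim] W0 by (rule mult_left_mono)
            also have "\<dots> = 2 * W n x + sqrt (W n x) * sqrt (W n x * (A n * (cmod (v u n x))\<^sup>2))"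
            proof -
              have "sqrt (W n x) * sqrt (W n x * (A n * (cmod (v u n x))\<^sup>2)) = (sqrt (W n x) * sqrt (W n x)) * (sqrt (A n) * cmod (v u n x))"
                by (simp only: real_sqrt_mult mult.assoc real_sqrt_abs abs_norm_cancel)
              also have "sqrt (W n x) * sqrt (W n x) = W n x" using W0[of n x] by simp
              finally show ?thesis by (simp add: distrib_left mult.commute)
            qed
            finally show ?case unfolding Wrho[OF elim] by simp
          qed
          moreover have "(\<lambda>n. 2 * W n x + sqrt (W n x) * cmod u) \<longlonglongrightarrow> 2 * 0 + sqrt 0 * cmod u"
            by (intro tendsto_intros Winf True)
          then have "(\<lambda>n. 2 * W n x + sqrt (W n x) * cmod u) \<longlonglongrightarrow> 0"
            by (simp only: mult_zero_right mult_zero_left real_sqrt_zero add_0)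
          ultimately show ?thesis by (rule Lim_null_comparison)
        next
          case False
          then have x: "x < 0" using elim by simp
          \<comment> \<open>For \<open>x < 0\<close> the rescaled modulus \<open>r\<close> tends to
            0. The weight uses up two of the powers in the error of order \<open>2 + e\<close>, and
            the remaining \<open>r powr e\<close> vanishes.\<close>
          have "eventually (\<lambda>n. cmod (of_real (W n x) * \<Psi> n (v u n x) + J n x) \<le> C * (cmod u)\<^sup>2 * (cmod u * inverse (sqrt (W n x))) powr e) sequentially"
            using good filterlim_at_top_dense[THEN iffD1, OF Wm[OF x], rule_format, of 0]
          proof eventually_elim
            case (elim n)
            define r where "r = sqrt (A n) * cmod (v u n x)"
            have r: "r = cmod u * inverse (sqrt (W n x))"
            proof -
              have "sqrt (W n x) * r = sqrt (W n x * (A n * (cmod (v u n x))\<^sup>2))"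
                by (simp add: r_def real_sqrt_mult)
              then have "sqrt (W n x) * r = cmod u" unfolding Wrho[OF elim(1)] by simp
              then show ?thesis using elim(2) by (simp add: field_simps)
            qed
            have r0: "r \<ge> 0" using cA(2)[OF elim(1)] by (simp add: r_def)
            have "cmod (of_real (W n x) * \<Psi> n (v u n x) + J n x) = W n x * cmod (\<Psi> n (v u n x) + Q n (v u n x))"
            proof -
              have "of_real (W n x) * \<Psi> n (v u n x) + J n x = of_real (W n x) * (\<Psi> n (v u n x) + Q n (v u n x))"
                using x by (simp add: J_def distrib_left)
              then show ?thesis using W0[of n x] by (simp add: norm_mult)
            qed
            also have "\<dots> \<le> W n x * (C * r powr (2 + e))"
              unfolding r_def using Psi_Q[OF elim(1)] W0 by (rule mult_left_mono)
            also have "r powr (2 + e) = r\<^sup>2 * r powr e"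
            proof (cases "r = 0")
              case False
              then show ?thesis using r0 by (simp add: powr_add)
            qed simp
            also have "W n x * (C * (r\<^sup>2 * r powr e)) = C * (W n x * r\<^sup>2) * r powr e" by simp
            also have "W n x * r\<^sup>2 = (cmod u)\<^sup>2"
              using Wrho[OF elim(1), of x u] cA(2)[OF elim(1)] by (simp add: r_def power_mult_distrib)
            finally show ?case by (simp add: r)
          qed
          moreover have "(\<lambda>n. C * (cmod u)\<^sup>2 * (cmod u * inverse (sqrt (W n x))) powr e) \<longlonglongrightarrow> C * (cmod u)\<^sup>2 * (cmod u * 0) powr e"
            using e by (intro tendsto_intros tendsto_inverse_0_at_top filterlim_compose[OF sqrt_at_top Wm[OF x]] tendsto_powr') (auto simp: W0)
          then have "(\<lambda>n. C * (cmod u)\<^sup>2 * (cmod u * inverse (sqrt (W n x))) powr e) \<longlonglongrightarrow> 0"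
            by (simp only: mult_zero_right powr_0)
          ultimately show ?thesis by (rule Lim_null_comparison)
        qed
      qed
    qed (auto intro: prob_space_std_normal)
    define \<omega> where "\<omega> n = 2 * Im (b n)" for n
    \<comment> \<open>\<open>\<eta>\<close> collects the relative pseudo-variance and a phase
      depending on \<open>n\<close>. It may oscillate, but it stays bounded, so the decay of the
      oscillating half-normal integral removes this contribution.\<close>
    define \<eta> where "\<eta> n = u\<^sup>2 * (B n / of_real (A n)) * iexp (\<omega> n * sqrt (\<kappa> n))" for n
    have om: "filterlim \<omega> at_top sequentially"
      unfolding \<omega>_def by (rule filterlim_tendsto_pos_mult_at_top[OF tendsto_const]) (use Imb in auto)
    have Jeq: "(CLINT x|std_normal_distribution. J n x) = of_real ((cmod u)\<^sup>2 / 8) +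
        of_real (Re (\<eta> n * (CLINT x|std_normal_distribution. indicator {..<0} x * iexp (\<omega> n * x))) / 4)"
      if "good n" for n
    proof -
      have J2: "J n x = of_real ((cmod u)\<^sup>2 / 4 * indicator {..<0} x + Re (\<eta> n * (indicator {..<0} x * iexp (\<omega> n * x))) / 4)" for x
      proof -
        have "of_real (W n x) * ((v u n x)\<^sup>2 * B n) = \<eta> n * iexp (\<omega> n * x)"
        proof -
          have "(exp (b n * of_real (x + sqrt (\<kappa> n))))\<^sup>2 = exp (2 * b n * of_real (x + sqrt (\<kappa> n)))"
            by (simp add: exp_double[symmetric] mult.assoc)
          also have "2 * b n * of_real (x + sqrt (\<kappa> n)) =
              of_real (sqrt (\<kappa> n) * x + \<kappa> n) + (\<i> * of_real (\<omega> n * x) + \<i> * of_real (\<omega> n * sqrt (\<kappa> n)))"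
            using \<kappa>0[of n] by (simp add: complex_eq_iff times_complex.sel Reb \<omega>_def algebra_simps)
          finally have e2: "(exp (b n * of_real (x + sqrt (\<kappa> n))))\<^sup>2 = of_real (exp (sqrt (\<kappa> n) * x + \<kappa> n)) * (iexp (\<omega> n * x) * iexp (\<omega> n * sqrt (\<kappa> n)))"
            by (simp only: exp_add exp_of_real)
          have "W n x * (c n)\<^sup>2 * exp (sqrt (\<kappa> n) * x + \<kappa> n) = (c n)\<^sup>2 * (N n * (exp (- \<kappa> n / 2) * exp (- sqrt (\<kappa> n) * x) * exp (sqrt (\<kappa> n) * x + \<kappa> n)))"
            by (simp add: W_def mult_ac)
          also have "exp (- \<kappa> n / 2) * exp (- sqrt (\<kappa> n) * x) * exp (sqrt (\<kappa> n) * x + \<kappa> n) = exp (\<kappa> n / 2)"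
            unfolding mult_exp_exp by simp
          also have "(c n)\<^sup>2 * (real (N n) * exp (\<kappa> n / 2)) = 1 / A n"
            using cA(1)[OF that] cA(2)[OF that] by (simp add: nonzero_eq_divide_eq mult_ac)
          finally have w: "W n x * (c n)\<^sup>2 * exp (sqrt (\<kappa> n) * x + \<kappa> n) = 1 / A n" .
          have "of_real (W n x) * ((v u n x)\<^sup>2 * B n) = of_real (W n x * (c n)\<^sup>2 * exp (sqrt (\<kappa> n) * x + \<kappa> n)) * (u\<^sup>2 * B n * (iexp (\<omega> n * x) * iexp (\<omega> n * sqrt (\<kappa> n))))"
            unfolding v_def power_mult_distrib e2 by (simp add: mult_ac)
          then show ?thesis unfolding w \<eta>_def by (simp add: mult_ac)
        qed
        then have "W n x * Re ((v u n x)\<^sup>2 * B n) = Re (\<eta> n * iexp (\<omega> n * x))"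
          by (metis Re_mult_real(2))
        moreover have "W n x * (A n * (cmod (v u n x))\<^sup>2) = (cmod u)\<^sup>2" by (rule Wrho[OF that])
        ultimately have "W n x * (A n * (cmod (v u n x))\<^sup>2 / 4 + Re ((v u n x)\<^sup>2 * B n) / 4) = (cmod u)\<^sup>2 / 4 + Re (\<eta> n * iexp (\<omega> n * x)) / 4"
          by (simp add: distrib_left)
        then have "of_real (W n x) * Q n (v u n x) = complex_of_real ((cmod u)\<^sup>2 / 4 + Re (\<eta> n * iexp (\<omega> n * x)) / 4)"
          unfolding Q_def by (simp only: of_real_mult[symmetric])
        then show ?thesis by (cases "x < 0") (auto simp: J_def)
      qed
      have i1: "integrable std_normal_distribution (\<lambda>x. indicator {..<0} x :: real)"
        by (rule integrable_const_bound[of _ 1]) (auto simp: indicator_def)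
      have i2: "integrable std_normal_distribution (\<lambda>x. \<eta> n * (indicator {..<0} x * iexp (\<omega> n * x)))"
        by (rule integrable_const_bound[of _ "cmod (\<eta> n)"]) (auto simp: indicator_def norm_mult simp del: of_real_mult)
      have half: "(LINT x|std_normal_distribution. indicator {..<0} x :: real) = 1 / 2"
      proof -
        have i3: "integrable std_normal_distribution (\<lambda>x. indicator {0<..} x :: real)"
          by (rule integrable_const_bound[of _ 1]) (auto simp: indicator_def)
        have "(LINT x|std_normal_distribution. indicator {..<0} x :: real) = (LINT x|lborel. std_normal_density x * indicator {..<0} x)"
          by (subst integral_density) auto
        also have "\<dots> = (LINT x|lborel. std_normal_density (- x) * indicator {..<0} (- x))"
          by (subst lborel_integral_real_affine[where c="-1" and t=0]) auto
        also have "\<dots> = (LINT x|lborel. std_normal_density x * indicator {0<..} x)"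
          by (intro Bochner_Integration.integral_cong refl) (auto simp: std_normal_density_def indicator_def)
        also have "\<dots> = (LINT x|std_normal_distribution. indicator {0<..} x)"
          by (subst integral_density) auto
        finally have eq: "(LINT x|std_normal_distribution. indicator {..<0} x :: real) = (LINT x|std_normal_distribution. indicator {0<..} x)" .
        have "AE x in lborel. x \<noteq> (0::real)" by (rule AE_lborel_singleton)
        then have "AE x in std_normal_distribution. x \<noteq> 0" by (auto simp: AE_density)
        then have "AE x in std_normal_distribution. indicator {..<0} x + indicator {0<..} x = (1::real)"
          by eventually_elim (auto simp: indicator_def)
        then have "(LINT x|std_normal_distribution. indicator {..<0} x + indicator {0<..} x :: real) = (LINT x|std_normal_distribution. 1)"
          by (intro integral_cong_AE) auto
        then show ?thesis using eq i1 i3 prob_space by simp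
      qed
      have "(CLINT x|std_normal_distribution. J n x) = of_real (LINT x|std_normal_distribution.
          (cmod u)\<^sup>2 / 4 * indicator {..<0} x + Re (\<eta> n * (indicator {..<0} x * iexp (\<omega> n * x))) / 4)"
        unfolding J2 by (rule integral_complex_of_real)
      also have "(LINT x|std_normal_distribution. (cmod u)\<^sup>2 / 4 * indicator {..<0} x + Re (\<eta> n * (indicator {..<0} x * iexp (\<omega> n * x))) / 4)
        = (cmod u)\<^sup>2 / 4 * (1 / 2) + (LINT x|std_normal_distribution. Re (\<eta> n * (indicator {..<0} x * iexp (\<omega> n * x)))) / 4"
        using i1 integrable_Re[OF i2] by (subst Bochner_Integration.integral_add) (use half in auto)
      also have "(LINT x|std_normal_distribution. Re (\<eta> n * (indicator {..<0} x * iexp (\<omega> n * x)))) = Re (\<eta> n * (CLINT x|std_normal_distribution. indicator {..<0} x * iexp (\<omega> n * x)))"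
        by (subst integral_Re[OF i2], subst integral_mult_right_zero) simp
      finally show ?thesis by simp
    qed
    have \<eta>b: "eventually (\<lambda>n. cmod (\<eta> n) \<le> (cmod u)\<^sup>2) sequentially"
      using good
    proof eventually_elim
      case (elim n)
      have "cmod (B n / of_real (A n)) \<le> 1"
        using elim by (auto simp: norm_divide good_def quad_expansion_def)
      then have "cmod (u\<^sup>2) * cmod (B n / of_real (A n)) \<le> cmod (u\<^sup>2)" by (intro mult_left_le) auto
      then show ?case unfolding \<eta>_def norm_mult norm_exp_i_times by (simp add: norm_power)
    qed
    have Jlim: "(\<lambda>n. CLINT x|std_normal_distribution. J n x) \<longlonglongrightarrow> of_real ((cmod u)\<^sup>2 / 8) + of_real (Re 0 / 4)"
    proof (rule Lim_transform_eventually)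
      have "(\<lambda>n. \<eta> n * (CLINT x|std_normal_distribution. indicator {..<0} x * iexp (\<omega> n * x))) \<longlonglongrightarrow> 0"
      proof (rule Lim_null_comparison)
        show "eventually (\<lambda>n. cmod (\<eta> n * (CLINT x|std_normal_distribution. indicator {..<0} x * iexp (\<omega> n * x))) \<le>
          (cmod u)\<^sup>2 * cmod (CLINT x|std_normal_distribution. indicator {..<0} x * iexp (\<omega> n * x))) sequentially"
          using \<eta>b by eventually_elim (simp add: norm_mult mult_right_mono)
        show "(\<lambda>n. (cmod u)\<^sup>2 * cmod (CLINT x|std_normal_distribution. indicator {..<0} x * iexp (\<omega> n * x))) \<longlonglongrightarrow> 0"
          by (intro tendsto_mult_right_zero tendsto_norm_zero Riemann_Lebesgue_half_normal om)
      qed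
      then show "(\<lambda>n. of_real ((cmod u)\<^sup>2 / 8) + complex_of_real (Re (\<eta> n * (CLINT x|std_normal_distribution. indicator {..<0} x * iexp (\<omega> n * x))) / 4)) \<longlonglongrightarrow> of_real ((cmod u)\<^sup>2 / 8) + of_real (Re 0 / 4)"
        by (intro tendsto_intros) auto
      show "eventually (\<lambda>n. of_real ((cmod u)\<^sup>2 / 8) + complex_of_real (Re (\<eta> n * (CLINT x|std_normal_distribution. indicator {..<0} x * iexp (\<omega> n * x))) / 4) = (CLINT x|std_normal_distribution. J n x)) sequentially"
        using good by eventually_elim (rule Jeq[symmetric])
    qed
    have "(\<lambda>n. \<i> * of_real (Re (u * m' n))) \<longlonglongrightarrow> \<i> * of_real (Re (u * 0))"
      by (intro tendsto_intros m'0)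
    from tendsto_add[OF this tendsto_diff[OF R Jlim]]
    have L: "(\<lambda>n. \<i> * of_real (Re (u * m' n)) + ((CLINT x|std_normal_distribution. of_real (W n x) * \<Psi> n (v u n x) + J n x) - (CLINT x|std_normal_distribution. J n x))) \<longlonglongrightarrow> - of_real ((cmod u)\<^sup>2 / 8)"
      by simp
    show ?thesis
    proof (rule Lim_transform_eventually[OF L])
      show "eventually (\<lambda>n. \<i> * of_real (Re (u * m' n)) + ((CLINT x|std_normal_distribution. of_real (W n x) * \<Psi> n (v u n x) + J n x) - (CLINT x|std_normal_distribution. J n x)) = of_nat (N n) * t n u) sequentially"
        using good
      proof eventually_elim
        case (elim n)
        have i1: "integrable std_normal_distribution (\<lambda>x. of_real (W n x) * \<Psi> n (v u n x))"
          by (rule integrable_const_bound[OF AE_I2[OF WPsi[OF elim]]]) measurable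
        have i2: "integrable std_normal_distribution (\<lambda>x. J n x)"
          by (rule integrable_const_bound[OF AE_I2[OF WJ[OF elim]]]) (unfold J_def, measurable)
        show ?case
          unfolding Bochner_Integration.integral_add[OF i1 i2] NPsi[symmetric] by simp
      qed
    qed
  qed
  then have "(\<lambda>n. (1 + t n u) ^ N n) \<longlonglongrightarrow> exp (- of_real ((cmod u)\<^sup>2 / 8))"
    by (rule power_tendsto_exp[OF Ntop])
  then show "(\<lambda>n. g n u) \<longlonglongrightarrow> of_real (exp (- (cmod u)\<^sup>2 / 8))"
    unfolding gt by (simp add: exp_of_real[symmetric])
qed

section \<open>The extremal levels\<close>

lemma integrable_exp_halflines:
  assumes a: "a > 0" and b: "b > 0"
  shows "integrable lborel (\<lambda>y::real. if y \<le> 0 then exp (a * y) else exp (- b * y))"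
proof -
  have pos: "integrable lborel (\<lambda>y. indicator {0..} y * exp (- c * y))" if "c > 0" for c :: real
  proof -
    interpret E: prob_space "density lborel (exponential_density c)"
      by (rule prob_space_exponential_density) fact
    have "emeasure (density lborel (exponential_density c)) UNIV = 1"
      using E.emeasure_space_1 by simp
    then have "(\<integral>\<^sup>+x. ennreal (exponential_density c x) \<partial>lborel) = 1"
      by (simp add: emeasure_density)
    then have "integrable lborel (exponential_density c)"
      using that by (intro integrableI_bounded) (auto simp: exponential_density_nonneg)
    then have "integrable lborel (\<lambda>y. inverse c * exponential_density c y)" by (rule integrable_mult_right)
    then show ?thesis
      by (rule Bochner_Integration.integrable_bound)
        (use that in \<open>auto simp: exponential_density_def indicator_def mult.commute\<close>)
  qed
  have "integrable lborel (\<lambda>y. indicator {0..} (- y) * exp (- a * (- y)))"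
    using lborel_integrable_real_affine[OF pos[OF a], of "-1" 0] by simp
  from Bochner_Integration.integrable_add[OF this pos[OF b]]
  show ?thesis
    by (rule Bochner_Integration.integrable_bound) (auto simp: indicator_def)
qed

text \<open>Passing an extremal level can multiply the mean by a factor of order \<open>n\<close>;
  decay faster than every power is stable under this.\<close>

definition rapidly_decreasing :: "(nat \<Rightarrow> complex) \<Rightarrow> bool" where
  "rapidly_decreasing m \<longleftrightarrow> (\<forall>k. (\<lambda>n. real n ^ k * cmod (m n)) \<longlonglongrightarrow> 0)"

lemma rapidly_decreasing_tendsto: "rapidly_decreasing m \<Longrightarrow> m \<longlonglongrightarrow> 0"
  unfolding rapidly_decreasing_def by (drule spec[of _ 0]) (simp add: tendsto_norm_zero_iff)

lemma rapidly_decreasing_mult: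
  assumes m: "rapidly_decreasing m" and M: "eventually (\<lambda>n. cmod (M n) \<le> K * real n) sequentially"
  shows "rapidly_decreasing (\<lambda>n. m n * M n)"
  unfolding rapidly_decreasing_def
proof
  fix k
  have "(\<lambda>n. K * (real n ^ Suc k * cmod (m n))) \<longlonglongrightarrow> 0"
    using m[unfolded rapidly_decreasing_def] by (intro tendsto_mult_right_zero) blast
  moreover have "eventually (\<lambda>n. norm (real n ^ k * cmod (m n * M n)) \<le> K * (real n ^ Suc k * cmod (m n))) sequentially"
    using M
  proof eventually_elim
    case (elim n)
    have "real n ^ k * cmod (m n) * cmod (M n) \<le> real n ^ k * cmod (m n) * (K * real n)"
      using elim by (intro mult_left_mono) auto
    then show ?case by (simp add: norm_mult abs_mult mult_ac)
  qed
  ultimately show "(\<lambda>n. real n ^ k * cmod (m n * M n)) \<longlonglongrightarrow> 0"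
    by (rule Lim_null_comparison[rotated])
qed

text \<open>In the application \<open>bt\<close> is \<open>\<beta>\<close> divided by the
  \<open>\<sigma>\<close> of the level, so that the coefficient of the Gaussian is
  \<open>bt * sqrt \<kappa>\<close>. The condition comparing \<open>1 - Re bt\<close> with
  \<open>Im bt\<close> is what makes the mean decay when \<open>Re bt < 1\<close>.\<close>

locale extremal_level =
  fixes N :: "nat \<Rightarrow> nat" and \<kappa>\<^sub>0 :: real and bt :: complex
  assumes \<kappa>\<^sub>0: "\<kappa>\<^sub>0 > 0" and N: "(\<lambda>n. N n * exp (- (n * \<kappa>\<^sub>0) / 2)) \<longlonglongrightarrow> 1"
    and s: "Re bt > 0" and w: "\<bar>1 - Re bt\<bar> < Im bt"
begin

definition \<kappa> :: "nat \<Rightarrow> real" where "\<kappa> n = n * \<kappa>\<^sub>0"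
text \<open>The logarithmic correction to the position of the maximum of Gaussian variables: its
  exponential cancels the normalizing factor of the density of variance
  \<open>\<kappa> n\<close>.\<close>

definition logc :: "nat \<Rightarrow> real" where "logc n = ln (2 * pi * \<kappa> n) / 2"

text \<open>The centring of the extremal process of \<open>N n\<close> Gaussians of variance \<open>\<kappa> n\<close>.\<close>

definition centre :: "nat \<Rightarrow> real" where "centre n = \<kappa> n - logc n"

text \<open>The density of the mean measure of \<open>N n\<close> independent points
  \<open>sqrt (\<kappa> n) * x - centre n\<close> with \<open>x\<close> standard normal.\<close>

definition intensity :: "nat \<Rightarrow> real \<Rightarrow> real" where
  "intensity n y = N n * std_normal_density ((y + centre n) / sqrt (\<kappa> n)) / sqrt (\<kappa> n)"

lemma \<kappa>_pos: "n > 0 \<Longrightarrow> \<kappa> n > 0" using \<kappa>\<^sub>0 by (simp add: \<kappa>_def)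

lemma \<kappa>_top: "filterlim \<kappa> at_top sequentially"
  unfolding \<kappa>_def using \<kappa>\<^sub>0
  by (intro filterlim_at_top_mult_tendsto_pos[OF tendsto_const] filterlim_real_sequentially)

lemma N_top: "filterlim (\<lambda>n. real (N n)) at_top sequentially"
proof -
  have "filterlim (\<lambda>n. \<kappa> n * (1 / 2)) at_top sequentially"
    by (intro filterlim_at_top_mult_tendsto_pos[OF tendsto_const] \<kappa>_top) simp
  then have "filterlim (\<lambda>n. (N n * exp (- (n * \<kappa>\<^sub>0) / 2)) * exp (\<kappa> n * (1 / 2))) at_top sequentially"
    by (intro filterlim_tendsto_pos_mult_at_top[OF N] filterlim_compose[OF exp_at_top]) auto
  then show ?thesis by (simp add: mult_exp_exp mult.assoc \<kappa>_def)
qed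

lemma intensity_measurable [measurable]: "intensity n \<in> borel_measurable borel"
  unfolding intensity_def by measurable

lemma intensity_nonneg: "intensity n y \<ge> 0"
  by (cases "\<kappa> n \<ge> 0") (auto simp: intensity_def \<kappa>_def \<kappa>\<^sub>0 less_imp_le)

lemma integral_intensity:
  fixes F :: "real \<Rightarrow> complex"
  assumes n: "n > 0" and [measurable]: "F \<in> borel_measurable borel"
  shows "of_nat (N n) * (CLINT x|std_normal_distribution. F (sqrt (\<kappa> n) * x - centre n)) = (CLINT y|lborel. intensity n y *\<^sub>R F y)"
    and "integrable std_normal_distribution (\<lambda>x. F (sqrt (\<kappa> n) * x - centre n)) \<Longrightarrow> integrable lborel (\<lambda>y. intensity n y *\<^sub>R F y)"
proof -
  let ?r = "sqrt (\<kappa> n)"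
  have r: "?r > 0" using \<kappa>_pos[OF n] by simp
  have e: "?r * (centre n / ?r + inverse ?r * y) - centre n = y" "centre n / ?r + inverse ?r * y = (y + centre n) / ?r" for y
    using r by (simp_all add: field_simps)
  have "(CLINT x|std_normal_distribution. F (?r * x - centre n)) = (CLINT x|lborel. std_normal_density x *\<^sub>R F (?r * x - centre n))"
    by (subst integral_density) auto
  also have "\<dots> = \<bar>inverse ?r\<bar> *\<^sub>R (CLINT y|lborel. std_normal_density (centre n / ?r + inverse ?r * y) *\<^sub>R F (?r * (centre n / ?r + inverse ?r * y) - centre n))"
    using r by (intro lborel_integral_real_affine) auto
  finally have "of_nat (N n) * (CLINT x|std_normal_distribution. F (?r * x - centre n)) =
      of_real (N n * inverse ?r) * (CLINT y|lborel. std_normal_density ((y + centre n) / ?r) *\<^sub>R F y)"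
    unfolding e using r by (simp add: scaleR_conv_of_real)
  also have "\<dots> = (CLINT y|lborel. of_real (N n * inverse ?r) * (std_normal_density ((y + centre n) / ?r) *\<^sub>R F y))"
    by (rule integral_mult_right_zero[symmetric])
  also have "\<dots> = (CLINT y|lborel. intensity n y *\<^sub>R F y)"
    by (intro Bochner_Integration.integral_cong refl) (simp add: intensity_def scaleR_conv_of_real field_simps)
  finally show "of_nat (N n) * (CLINT x|std_normal_distribution. F (?r * x - centre n)) = (CLINT y|lborel. intensity n y *\<^sub>R F y)" .
  assume "integrable std_normal_distribution (\<lambda>x. F (?r * x - centre n))"
  then have "integrable lborel (\<lambda>x. std_normal_density x *\<^sub>R F (?r * x - centre n))"
    by (subst (asm) integrable_density) auto
  then have "integrable lborel (\<lambda>y. std_normal_density (centre n / ?r + inverse ?r * y) *\<^sub>R F (?r * (centre n / ?r + inverse ?r * y) - centre n))"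
    using r by (intro lborel_integrable_real_affine) auto
  then have "integrable lborel (\<lambda>y. of_real (N n * inverse ?r) * (std_normal_density ((y + centre n) / ?r) *\<^sub>R F y))"
    unfolding e(1) unfolding e(2) by (rule integrable_mult_right)
  then show "integrable lborel (\<lambda>y. intensity n y *\<^sub>R F y)"
    by (rule Bochner_Integration.integrable_cong[THEN iffD1, rotated -1])
       (simp_all add: intensity_def scaleR_conv_of_real field_simps)
qed

section \<open>Convergence of the intensity to \<open>exp (- y)\<close>, with uniform bounds\<close>

definition amplitude :: "nat \<Rightarrow> real" where
  "amplitude n = N n * exp (- (n * \<kappa>\<^sub>0) / 2) * exp (- ((logc n)\<^sup>2 / (2 * \<kappa> n)))"

text \<open>Expanding the square around the centre leaves three effects: a constant close to 1, a
  slope \<open>1 - logc n / \<kappa> n\<close> that lies slightly below 1 for large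
  \<open>n\<close>, and a Gaussian cutoff on the scale \<open>sqrt (\<kappa> n)\<close>.\<close>

lemma intensity_eq:
  assumes n: "n > 0"
  shows "intensity n y = amplitude n * exp (- (1 - logc n / \<kappa> n) * y) * exp (- (y\<^sup>2 / (2 * \<kappa> n)))"
proof -
  have k: "\<kappa> n > 0" by (rule \<kappa>_pos[OF n])
  have e: "exp (logc n) = sqrt (2 * pi * \<kappa> n)"
  proof -
    have "exp (logc n) = exp (ln (2 * pi * \<kappa> n)) powr (1/2)"
      unfolding exp_powr_real by (simp add: logc_def)
    then show ?thesis using k by (simp add: powr_half_sqrt)
  qed
  have "((y + centre n) / sqrt (\<kappa> n))\<^sup>2 / 2 = \<kappa> n / 2 - logc n + (logc n)\<^sup>2 / (2 * \<kappa> n) + (1 - logc n / \<kappa> n) * y + y\<^sup>2 / (2 * \<kappa> n)"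
  proof -
    have a: "((y + centre n) / sqrt (\<kappa> n))\<^sup>2 / 2 = (y + (\<kappa> n - logc n))\<^sup>2 / (2 * \<kappa> n)"
      using k by (simp add: power_divide centre_def)
    show ?thesis unfolding a using k by (simp add: power2_eq_square field_simps)
  qed
  then have "intensity n y = N n / (sqrt (2 * pi) * sqrt (\<kappa> n)) * exp (- (\<kappa> n / 2 - logc n + (logc n)\<^sup>2 / (2 * \<kappa> n) + (1 - logc n / \<kappa> n) * y + y\<^sup>2 / (2 * \<kappa> n)))"
    by (simp add: intensity_def std_normal_density_def)
  also have "- (\<kappa> n / 2 - logc n + (logc n)\<^sup>2 / (2 * \<kappa> n) + (1 - logc n / \<kappa> n) * y + y\<^sup>2 / (2 * \<kappa> n)) =
      - \<kappa> n / 2 + logc n + - ((logc n)\<^sup>2 / (2 * \<kappa> n)) + - (1 - logc n / \<kappa> n) * y + - (y\<^sup>2 / (2 * \<kappa> n))"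
    by (simp add: algebra_simps)
  also have "exp \<dots> = exp (- \<kappa> n / 2) * sqrt (2 * pi * \<kappa> n) * exp (- ((logc n)\<^sup>2 / (2 * \<kappa> n))) * exp (- (1 - logc n / \<kappa> n) * y) * exp (- (y\<^sup>2 / (2 * \<kappa> n)))"
    unfolding exp_add e ..
  also have "N n / (sqrt (2 * pi) * sqrt (\<kappa> n)) * \<dots> = amplitude n * exp (- (1 - logc n / \<kappa> n) * y) * exp (- (y\<^sup>2 / (2 * \<kappa> n)))"
    using k n \<kappa>\<^sub>0 by (simp add: amplitude_def \<kappa>_def real_sqrt_mult)
  finally show ?thesis .
qed

lemma logc_limits:
  shows "(\<lambda>n. logc n / \<kappa> n) \<longlonglongrightarrow> 0" and "(\<lambda>n. (logc n)\<^sup>2 / (2 * \<kappa> n)) \<longlonglongrightarrow> 0"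
    and "eventually (\<lambda>n. logc n \<ge> 0) sequentially"
proof -
  have "((\<lambda>x::real. ln (2 * pi * x) / 2 / x) \<longlongrightarrow> 0) at_top" by real_asymp
  then show "(\<lambda>n. logc n / \<kappa> n) \<longlonglongrightarrow> 0"
    unfolding logc_def by (rule filterlim_compose[OF _ \<kappa>_top])
  have "((\<lambda>x::real. (ln (2 * pi * x) / 2)\<^sup>2 / (2 * x)) \<longlongrightarrow> 0) at_top" by real_asymp
  then show "(\<lambda>n. (logc n)\<^sup>2 / (2 * \<kappa> n)) \<longlonglongrightarrow> 0"
    unfolding logc_def by (rule filterlim_compose[OF _ \<kappa>_top])
  have "eventually (\<lambda>x::real. ln (2 * pi * x) / 2 \<ge> 0) at_top" by real_asymp
  then show "eventually (\<lambda>n. logc n \<ge> 0) sequentially"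
    unfolding logc_def by (rule eventually_compose_filterlim[OF _ \<kappa>_top])
qed

lemma amplitude_tendsto: "amplitude \<longlonglongrightarrow> 1"
proof -
  have "(\<lambda>n. N n * exp (- (n * \<kappa>\<^sub>0) / 2) * exp (- ((logc n)\<^sup>2 / (2 * \<kappa> n)))) \<longlonglongrightarrow> 1 * exp (- 0)"
    by (intro tendsto_mult N tendsto_exp tendsto_minus logc_limits)
  then show ?thesis by (simp add: amplitude_def[abs_def])
qed

lemma intensity_tendsto: "(\<lambda>n. intensity n y) \<longlonglongrightarrow> exp (- y)"
proof (rule Lim_transform_eventually)
  have "(\<lambda>n. y\<^sup>2 / (2 * \<kappa> n)) \<longlonglongrightarrow> 0"
    by (intro tendsto_divide_0[OF tendsto_const] filterlim_at_top_imp_at_infinity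
        filterlim_tendsto_pos_mult_at_top[OF tendsto_const] \<kappa>_top) simp
  then have "(\<lambda>n. amplitude n * exp (- (1 - logc n / \<kappa> n) * y) * exp (- (y\<^sup>2 / (2 * \<kappa> n)))) \<longlonglongrightarrow> 1 * exp (- (1 - 0) * y) * exp (- 0)"
    by (intro tendsto_intros amplitude_tendsto logc_limits)
  then show "(\<lambda>n. amplitude n * exp (- (1 - logc n / \<kappa> n) * y) * exp (- (y\<^sup>2 / (2 * \<kappa> n)))) \<longlonglongrightarrow> exp (- y)"
    by simp
  show "eventually (\<lambda>n. amplitude n * exp (- (1 - logc n / \<kappa> n) * y) * exp (- (y\<^sup>2 / (2 * \<kappa> n))) = intensity n y) sequentially"
    using eventually_gt_at_top[of 0] by eventually_elim (simp add: intensity_eq)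
qed

text \<open>The slope falling short of 1 costs an arbitrary \<open>\<eta>\<close> for
  \<open>y > 0\<close> and is favourable for \<open>y <= 0\<close>. The second bound retains the
  Gaussian cutoff, the only source of decay at minus infinity when \<open>Re bt = 1\<close>.\<close>

lemma intensity_bounds:
  assumes \<eta>: "\<eta> > 0"
  shows "eventually (\<lambda>n. \<forall>y. intensity n y \<le> 2 * (if y \<le> 0 then exp (- y) else exp (- (1 - \<eta>) * y))) sequentially"
    and "eventually (\<lambda>n. \<forall>y\<le>0. intensity n y \<le> 2 * exp (- y) * exp (- (y\<^sup>2 / (2 * \<kappa> n)))) sequentially"
proof -
  have ev: "eventually (\<lambda>n. n > 0 \<and> amplitude n < 2 \<and> amplitude n > 0 \<and> logc n / \<kappa> n < \<eta> \<and> logc n \<ge> 0) sequentially"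
    using eventually_gt_at_top[of 0] order_tendstoD(2)[OF amplitude_tendsto, of 2, simplified] order_tendstoD(1)[OF amplitude_tendsto, of 0, simplified]
      order_tendstoD(2)[OF logc_limits(1) \<eta>] logc_limits(3)
    by eventually_elim auto
  show b2: "eventually (\<lambda>n. \<forall>y\<le>0. intensity n y \<le> 2 * exp (- y) * exp (- (y\<^sup>2 / (2 * \<kappa> n)))) sequentially"
    using ev
  proof eventually_elim
    case (elim n)
    have k: "\<kappa> n > 0" using elim by (intro \<kappa>_pos) auto
    show ?case
    proof (intro allI impI)
      fix y :: real assume y: "y \<le> 0"
      have "(logc n / \<kappa> n) * y \<le> 0" using y elim k by (intro mult_nonneg_nonpos) auto
      then have "- (1 - logc n / \<kappa> n) * y \<le> - y" by (simp add: algebra_simps)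
      then show "intensity n y \<le> 2 * exp (- y) * exp (- (y\<^sup>2 / (2 * \<kappa> n)))"
        using elim by (subst intensity_eq) (auto intro!: mult_mono)
    qed
  qed
  show "eventually (\<lambda>n. \<forall>y. intensity n y \<le> 2 * (if y \<le> 0 then exp (- y) else exp (- (1 - \<eta>) * y))) sequentially"
    using ev b2
  proof eventually_elim
    case (elim n)
    have k: "\<kappa> n > 0" using elim by (intro \<kappa>_pos) auto
    show ?case
    proof
      fix y :: real
      have le1: "exp (- (y\<^sup>2 / (2 * \<kappa> n))) \<le> 1" using k by simp
      show "intensity n y \<le> 2 * (if y \<le> 0 then exp (- y) else exp (- (1 - \<eta>) * y))"
      proof (cases "y \<le> 0")
        case True
        then have "intensity n y \<le> 2 * exp (- y) * exp (- (y\<^sup>2 / (2 * \<kappa> n)))" using elim by blast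
        also have "\<dots> \<le> 2 * exp (- y) * 1" using le1 by (intro mult_left_mono) auto
        finally show ?thesis using True by simp
      next
        case False
        have "(logc n / \<kappa> n) * y \<le> \<eta> * y" using False elim by (intro mult_right_mono) auto
        then have "- (1 - logc n / \<kappa> n) * y \<le> - (1 - \<eta>) * y" by (simp add: algebra_simps)
        then have "exp (- (1 - logc n / \<kappa> n) * y) \<le> exp (- (1 - \<eta>) * y)" by (simp only: exp_le_cancel_iff)
        then have a: "amplitude n * exp (- (1 - logc n / \<kappa> n) * y) \<le> 2 * exp (- (1 - \<eta>) * y)"
          using elim by (intro mult_mono) auto
        have "intensity n y \<le> 2 * exp (- (1 - \<eta>) * y) * 1"
          unfolding intensity_eq[OF elim(1)[THEN conjunct1]] by (rule mult_mono[OF a le1]) auto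
        then show ?thesis using False by simp
      qed
    qed
  qed
qed

text \<open>For \<open>Re bt >= 1\<close> the function \<open>exp (Re bt * y)\<close> is not
  integrable against \<open>exp (- y)\<close> at plus infinity, so the mean can be subtracted only
  on the small points. For \<open>Re bt < 1\<close> subtracting it everywhere allows the oscillation
  to act on the full Gaussian.\<close>

definition corr_set :: "real set" where "corr_set = (if Re bt < 1 then UNIV else {..0})"

definition corr_mean :: "nat \<Rightarrow> complex" where
  "corr_mean n = (CLINT y|lborel. intensity n y *\<^sub>R (indicator corr_set y * exp (bt * of_real y)))"

lemma corr_set_measurable [measurable]: "corr_set \<in> sets borel" by (simp add: corr_set_def)

lemma corr_integrable:
  assumes n: "n > 0"
  shows "integrable lborel (\<lambda>y. intensity n y *\<^sub>R (indicator corr_set y * exp (bt * of_real y)))"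
proof -
  have e: "exp (bt * of_real (sqrt (\<kappa> n) * x - centre n)) = exp (- bt * of_real (centre n)) * exp ((bt * of_real (sqrt (\<kappa> n))) * of_real x)" for x
    by (simp add: exp_add[symmetric] algebra_simps)
  have "integrable lborel (\<lambda>y. intensity n y *\<^sub>R (exp (bt * of_real y)))"
  proof (rule integral_intensity(2)[OF n])
    show "integrable std_normal_distribution (\<lambda>x. exp (bt * complex_of_real (sqrt (\<kappa> n) * x - centre n)))"
      unfolding e by (intro integrable_mult_right std_normal_exp)
  qed measurable
  then show ?thesis
    by (rule Bochner_Integration.integrable_bound) (auto simp: indicator_def)
qed

text \<open>For \<open>Re bt < 1\<close> the oscillation makes the full mean exponentially small; for
  \<open>Re bt \<ge> 1\<close> only the mean of the small points enters, and a crude bound suffices.\<close>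

lemma corr_mean_bound: "\<exists>K. eventually (\<lambda>n. cmod (corr_mean n) \<le> K * real n) sequentially"
proof (cases "Re bt < 1")
  case True
  define s where "s = Re bt"
  \<comment> \<open>The rate from the exact Gaussian mean: the modulus of \<open>corr_mean n\<close>
    behaves like \<open>exp (- D * \<kappa> n)\<close> up to a power of \<open>\<kappa> n\<close>,
    and positivity of \<open>D\<close> is the locale assumption on \<open>bt\<close>.\<close>
  define D where "D = ((Im bt)\<^sup>2 - (1 - s)\<^sup>2) / 2"
  have D: "D > 0" using w power_strict_mono[of "\<bar>1 - s\<bar>" "Im bt" 2] by (simp add: D_def s_def)
  have M: "cmod (corr_mean n) = N n * exp (- (n * \<kappa>\<^sub>0) / 2) * exp (s * logc n - D * \<kappa> n)" if n: "n > 0" for n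
  proof -
    have e: "exp (bt * of_real (sqrt (\<kappa> n) * x - centre n)) = exp (- bt * of_real (centre n)) * exp ((bt * of_real (sqrt (\<kappa> n))) * of_real x)" for x
      by (simp add: exp_add[symmetric] algebra_simps)
    have "corr_mean n = of_nat (N n) * (CLINT x|std_normal_distribution. exp (bt * of_real (sqrt (\<kappa> n) * x - centre n)))"
      using True by (subst integral_intensity(1)[OF n]) (auto simp: corr_mean_def corr_set_def)
    also have "\<dots> = of_nat (N n) * (exp (- bt * of_real (centre n)) * exp ((bt * of_real (sqrt (\<kappa> n)))\<^sup>2 / 2))"
      unfolding e by (subst integral_mult_right_zero, subst std_normal_exp) simp
    also have "(bt * of_real (sqrt (\<kappa> n)))\<^sup>2 = bt\<^sup>2 * of_real (\<kappa> n)"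
      using \<kappa>_pos[OF n] by (simp add: power_mult_distrib flip: of_real_power)
    finally have "cmod (corr_mean n) = N n * (exp (- s * centre n) * exp ((s\<^sup>2 - (Im bt)\<^sup>2) * \<kappa> n / 2))"
      by (simp add: norm_mult s_def Re_power2)
    also have "exp (- s * centre n) * exp ((s\<^sup>2 - (Im bt)\<^sup>2) * \<kappa> n / 2) = exp (- (n * \<kappa>\<^sub>0) / 2 + (s * logc n - D * \<kappa> n))"
    proof -
      have "- s * centre n + (s\<^sup>2 - (Im bt)\<^sup>2) * \<kappa> n / 2 = - \<kappa> n / 2 + (s * logc n - D * \<kappa> n)"
        unfolding centre_def D_def by (simp add: power2_eq_square field_simps)
      then show ?thesis unfolding mult_exp_exp \<kappa>_def by (simp only:)
    qed
    finally show ?thesis by (simp only: exp_add mult.assoc)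
  qed
  have "((\<lambda>x::real. exp (s * (ln (2 * pi * x) / 2) - D * x)) \<longlongrightarrow> 0) at_top"
    using D by real_asymp
  then have "(\<lambda>n. exp (s * logc n - D * \<kappa> n)) \<longlonglongrightarrow> 0"
    unfolding logc_def by (rule filterlim_compose[OF _ \<kappa>_top])
  from tendsto_mult[OF N this] have "(\<lambda>n. N n * exp (- (n * \<kappa>\<^sub>0) / 2) * exp (s * logc n - D * \<kappa> n)) \<longlonglongrightarrow> 0" by simp
  then have "eventually (\<lambda>n. N n * exp (- (n * \<kappa>\<^sub>0) / 2) * exp (s * logc n - D * \<kappa> n) < 1) sequentially"
    by (rule order_tendstoD) simp
  then have "eventually (\<lambda>n. cmod (corr_mean n) \<le> 1 * real n) sequentially"
    using eventually_gt_at_top[of 0] by eventually_elim (simp add: M)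
  then show ?thesis by blast
next
  case False
  have "eventually (\<lambda>n. cmod (corr_mean n) \<le> 2 * sqrt (2 * pi * \<kappa>\<^sub>0) * real n) sequentially"
    using intensity_bounds(2)[OF zero_less_one] eventually_gt_at_top[of 0]
  proof eventually_elim
    case (elim n)
    have k: "\<kappa> n > 0" using elim by (intro \<kappa>_pos)
    have nd: "exp (- (y\<^sup>2 / (2 * \<kappa> n))) = sqrt (2 * pi * \<kappa> n) * normal_density 0 (sqrt (\<kappa> n)) y" for y
      using k by (simp add: normal_density_def)
    have I: "integrable lborel (\<lambda>y. 2 * (sqrt (2 * pi * \<kappa> n) * normal_density 0 (sqrt (\<kappa> n)) y))"
      using k by (intro integrable_mult_right integrable_normal_density) auto
    have "cmod (corr_mean n) \<le> (LINT y|lborel. cmod (intensity n y *\<^sub>R (indicator corr_set y * exp (bt * of_real y))))"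
      unfolding corr_mean_def by (rule integral_norm_bound)
    also have "\<dots> \<le> (LINT y|lborel. 2 * (sqrt (2 * pi * \<kappa> n) * normal_density 0 (sqrt (\<kappa> n)) y))"
    proof (rule integral_mono[OF integrable_norm[OF corr_integrable[OF elim(2)]] I])
      fix y :: real
      show "cmod (intensity n y *\<^sub>R (indicator corr_set y * exp (bt * of_real y))) \<le> 2 * (sqrt (2 * pi * \<kappa> n) * normal_density 0 (sqrt (\<kappa> n)) y)"
      proof (cases "y \<le> 0")
        case True
        have "cmod (intensity n y *\<^sub>R (indicator corr_set y * exp (bt * of_real y))) = intensity n y * exp (Re bt * y)"
          using True False intensity_nonneg[of n y] by (simp add: corr_set_def)
        also have "\<dots> \<le> 2 * exp (- y) * exp (- (y\<^sup>2 / (2 * \<kappa> n))) * exp (Re bt * y)"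
          using elim(1) True by (intro mult_right_mono) auto
        also have "\<dots> = 2 * exp (- (y\<^sup>2 / (2 * \<kappa> n))) * exp ((Re bt - 1) * y)"
          by (simp add: mult_exp_exp algebra_simps)
        also have "\<dots> \<le> 2 * exp (- (y\<^sup>2 / (2 * \<kappa> n))) * 1"
          using True False by (intro mult_left_mono) (auto simp: mult_nonneg_nonpos)
        finally show ?thesis by (simp add: nd)
      qed (use False k in \<open>simp add: corr_set_def\<close>)
    qed
    also have "\<dots> = 2 * sqrt (2 * pi * \<kappa> n)"
      using k by simp
    also have "\<dots> \<le> 2 * sqrt (2 * pi * \<kappa>\<^sub>0) * real n"
    proof -
      have "sqrt (real n) \<le> real n" using elim(2) by (simp add: real_le_lsqrt power2_eq_square)
      then show ?thesis using \<kappa>\<^sub>0 by (simp add: \<kappa>_def real_sqrt_mult mult_left_mono)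
    qed
    finally show ?case .
  qed
  then show ?thesis by blast
qed

text \<open>The two half lines call for different exponents. Towards minus infinity an error of
  order \<open>p\<close> weighted by \<open>exp (- y)\<close> gives
  \<open>exp ((p * Re bt - 1) * y)\<close>, integrable as \<open>p * Re bt > 1\<close>; towards plus
  infinity one can afford only exponents with product below 1. The smaller exponent \<open>q\<close>
  is what the next level inherits.\<close>

lemma level_limit:
  fixes g :: "nat \<Rightarrow> complex \<Rightarrow> complex" and h :: "real \<Rightarrow> real"
  assumes gm[measurable]: "\<And>n. g n \<in> borel_measurable borel" and g1: "\<And>n v. cmod (g n v) \<le> 1"
    and lim: "\<And>v. (\<lambda>n. g n v) \<longlonglongrightarrow> of_real (h ((cmod v)\<^sup>2))"
    and m: "rapidly_decreasing m" and cb: "char_bound g m p"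
    and p: "p * Re bt > 1" and q: "0 < q" "q * Re bt < 1" "q \<le> p" "q \<le> 2"
  defines "g' \<equiv> (\<lambda>n u. (CLINT x|std_normal_distribution. g n (u * exp (bt * of_real (sqrt (\<kappa> n) * x - centre n)))) ^ N n)"
  shows "t \<ge> 0 \<Longrightarrow> integrable lborel (\<lambda>y. (1 - h (t * exp (2 * Re bt * y))) * exp (- y))"
    and "(\<lambda>n. g' n u) \<longlonglongrightarrow> of_real (exp (- (LINT y|lborel. (1 - h ((cmod u)\<^sup>2 * exp (2 * Re bt * y))) * exp (- y))))"
    and "\<exists>m'. rapidly_decreasing m' \<and> char_bound g' m' q"
proof -
  interpret G: prob_space std_normal_distribution by (rule prob_space_std_normal)
  let ?s = "Re bt"
  \<comment> \<open>When \<open>Re bt < 1\<close> the mean is subtracted on the whole line, so the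
    integrand grows linearly for large arguments and the exponent there must be at least 1.\<close>
  define r where "r = (if ?s < 1 then max q 1 else q)"
  \<comment> \<open>Half of the gap \<open>1 - Re bt * r\<close>: this half is given away in the
    intensity bound, the other half remains as the decay rate of \<open>Dom\<close>.\<close>
  define \<eta> where "\<eta> = (1 - ?s * r) / 2"
  define v where "v u y = u * exp (bt * complex_of_real y)" for u y
  define t where "t n u = (CLINT x|std_normal_distribution. g n (u * exp (bt * of_real (sqrt (\<kappa> n) * x - centre n)))) - 1" for n u
  \<comment> \<open>The intensity times \<open>1 - g\<close>, with the mean term added on
    \<open>corr_set\<close>. Integrating that term gives \<open>corr_mean\<close>, which is taken
    out again in \<open>Nt\<close>.\<close>
  define \<Theta> where "\<Theta> n u y = intensity n y *\<^sub>R ((1 - g n (v u y)) + indicator corr_set y * (\<i> * of_real (Re (v u y * m n))))" for n u y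
  define Dom where "Dom y = 2 * (if y \<le> 0 then exp ((?s * p - 1) * y) else exp (- \<eta> * y))" for y
  have p1: "p > 1" if "?s < 1"
  proof (rule ccontr)
    assume "\<not> p > 1"
    then have "p * ?s \<le> 1 * ?s" using s by (intro mult_right_mono) auto
    then show False using p that by simp
  qed
  have p0: "p > 0" using q by linarith
  have r: "q \<le> r" "r \<le> p" "?s * r < 1" "?s < 1 \<Longrightarrow> r \<ge> 1" "?s \<ge> 1 \<Longrightarrow> r = q"
    using q p1 by (auto simp: r_def mult.commute max_def)
  have q1: "q < 1" if "?s \<ge> 1"
  proof -
    have "q * 1 \<le> q * ?s" using q that by (intro mult_left_mono) auto
    then show ?thesis using q(2) by linarith
  qed
  have \<eta>: "\<eta> > 0" using r by (simp add: \<eta>_def)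
  have DomI: "integrable lborel Dom"
    unfolding Dom_def using p \<eta> by (intro integrable_mult_right integrable_exp_halflines) (auto simp: mult.commute)
  have Dom0: "Dom y \<ge> 0" for y by (simp add: Dom_def)
  have nv: "cmod (v u y) = cmod u * exp (?s * y)" for u y by (simp add: v_def norm_mult)
  have [measurable]: "(\<lambda>y. v u y) \<in> borel_measurable borel" for u unfolding v_def by measurable
  have \<Theta>m[measurable]: "(\<lambda>y. \<Theta> n u y) \<in> borel_measurable borel" for n u unfolding \<Theta>_def by measurable
  have t1: "cmod (1 + t n u) \<le> 1" for n u
    unfolding t_def using norm_integral_std_normal_le[of "\<lambda>x. g n (u * exp (bt * of_real (sqrt (\<kappa> n) * x - centre n)))"] g1 by simp
  have g't: "g' = (\<lambda>n u. (1 + t n u) ^ N n)" by (simp add: g'_def t_def)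
  obtain C where C: "C \<ge> 0" and cb': "eventually (\<lambda>n. \<forall>v. cmod v \<le> 1 \<longrightarrow> cmod (g n v - 1 - \<i> * of_real (Re (v * m n))) \<le> C * cmod v powr p) sequentially"
    using cb unfolding char_bound_def by blast
  define good where "good n \<longleftrightarrow> n > 0 \<and> (\<forall>v. cmod v \<le> 1 \<longrightarrow> cmod (g n v - 1 - \<i> * of_real (Re (v * m n))) \<le> C * cmod v powr p)
     \<and> cmod (m n) < 1 \<and> (\<forall>y. intensity n y \<le> 2 * (if y \<le> 0 then exp (- y) else exp (- (1 - \<eta>) * y)))" for n
  have m0: "m \<longlonglongrightarrow> 0" by (rule rapidly_decreasing_tendsto[OF m])
  have good: "eventually good sequentially"
    unfolding good_def using cb' eventually_gt_at_top[of 0] order_tendstoD(2)[OF tendsto_norm_zero[OF m0] zero_less_one] intensity_bounds(1)[OF \<eta>]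
    by eventually_elim auto
  have Rev: "\<bar>Re (z * m n)\<bar> \<le> cmod z" if "good n" for n z
  proof -
    have "\<bar>Re (z * m n)\<bar> \<le> cmod z * cmod (m n)" using abs_Re_le_cmod[of "z * m n"] by (simp add: norm_mult)
    also have "\<dots> \<le> cmod z" using that by (intro mult_left_le) (auto simp: good_def)
    finally show ?thesis .
  qed
  have \<Psi>1: "cmod ((1 - g n z) + \<i> * of_real (Re (z * m n))) \<le> C * cmod z powr p" if "good n" "cmod z \<le> 1" for n z
  proof -
    have "cmod ((1 - g n z) + \<i> * of_real (Re (z * m n))) = cmod (g n z - 1 - \<i> * of_real (Re (z * m n)))"
      by (subst norm_minus_cancel[symmetric]) simp
    then show ?thesis using that by (simp add: good_def)
  qed
  have \<Psi>2: "cmod ((1 - g n z) + \<i> * of_real (Re (z * m n))) \<le> 2 + cmod z" if "good n" for n z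
  proof -
    have "cmod (1 - g n z) \<le> 2" using norm_triangle_ineq4[of 1 "g n z"] g1[of n z] by simp
    moreover have "cmod (\<i> * complex_of_real (Re (z * m n))) \<le> cmod z" using Rev[OF that] by (simp add: norm_mult)
    ultimately show ?thesis by (intro order_trans[OF norm_triangle_ineq] add_mono)
  qed
  text \<open>Small points \<open>y \<le> 0\<close> are controlled by the exponent \<open>p\<close>, large ones by \<open>r\<close>.\<close>
  have \<Theta>_small: "cmod (\<Theta> n u y) \<le> (C + 3 * max 1 (cmod u)) * cmod u powr p * Dom y" if "good n" "y \<le> 0" for n u y
  proof -
    have yD: "y \<in> corr_set" using that by (simp add: corr_set_def)
    let ?z = "v u y"
    have zu: "cmod ?z \<le> cmod u" using that s by (simp add: nv mult_left_le mult_nonneg_nonpos)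
    have "cmod ((1 - g n ?z) + \<i> * of_real (Re (?z * m n))) \<le> (C + 3 * max 1 (cmod u)) * cmod ?z powr p"
    proof (cases "cmod ?z \<le> 1")
      case True
      have "C * cmod ?z powr p \<le> (C + 3 * max 1 (cmod u)) * cmod ?z powr p" by (intro mult_right_mono) auto
      then show ?thesis using \<Psi>1[OF that(1) True] by linarith
    next
      case False
      have "2 + cmod ?z \<le> 3 * max 1 (cmod u)" using zu by (simp add: max_def)
      also have "\<dots> \<le> C + 3 * max 1 (cmod u)" using C by simp
      also have "\<dots> \<le> (C + 3 * max 1 (cmod u)) * cmod ?z powr p"
        using False C p0 ge_one_powr_ge_zero[of "cmod ?z" p] by (intro mult_right_le_one_le[THEN order_trans, OF _ _ order_refl] mult_le_cancel_left1[THEN iffD2]) auto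
      finally show ?thesis using \<Psi>2[OF that(1), of ?z] by linarith
    qed
    then have "cmod (\<Theta> n u y) \<le> intensity n y * ((C + 3 * max 1 (cmod u)) * cmod ?z powr p)"
      using yD intensity_nonneg[of n y] by (simp add: \<Theta>_def mult_left_mono)
    also have "\<dots> \<le> (2 * exp (- y)) * ((C + 3 * max 1 (cmod u)) * cmod ?z powr p)"
    proof (rule mult_right_mono)
      have "intensity n y \<le> 2 * (if y \<le> 0 then exp (- y) else exp (- (1 - \<eta>) * y))"
        using that(1) unfolding good_def by blast
      then show "intensity n y \<le> 2 * exp (- y)" using that(2) by simp
    qed (use C in simp)
    also have "cmod ?z powr p = cmod u powr p * exp (?s * p * y)"
      by (simp add: nv powr_mult exp_powr_real mult_ac)
    also have "(2 * exp (- y)) * ((C + 3 * max 1 (cmod u)) * (cmod u powr p * exp (?s * p * y))) =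
        (C + 3 * max 1 (cmod u)) * cmod u powr p * (2 * (exp (- y) * exp (?s * p * y)))"
      by (simp only: mult_ac)
    also have "exp (- y) * exp (?s * p * y) = exp ((?s * p - 1) * y)"
      by (simp add: mult_exp_exp algebra_simps)
    finally show ?thesis using that by (simp add: Dom_def)
  qed
  have \<Theta>_large: "cmod (\<Theta> n u y) \<le> (C + 3) * cmod u powr r * Dom y" if "good n" "y > 0" for n u y
  proof -
    let ?z = "v u y"
    have "cmod ((1 - g n ?z) + indicator corr_set y * (\<i> * of_real (Re (?z * m n)))) \<le> (C + 3) * cmod ?z powr r"
    proof (cases "?s < 1")
      case True
      then have i: "indicator corr_set y = (1 :: complex)" by (simp add: corr_set_def)
      show ?thesis
      proof (cases "cmod ?z \<le> 1")
        case z: True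
        have "C * cmod ?z powr p \<le> (C + 3) * cmod ?z powr r"
          using r z C by (intro mult_mono powr_mono') auto
        then show ?thesis using \<Psi>1[OF that(1) z] i by simp
      next
        case False
        have "cmod ?z powr 1 \<le> cmod ?z powr r" using False r(4)[OF True] by (intro powr_mono) auto
        then have "2 + cmod ?z \<le> 3 * cmod ?z powr r" using False by simp
        also have "\<dots> \<le> (C + 3) * cmod ?z powr r" using C by (intro mult_right_mono) auto
        finally show ?thesis using \<Psi>2[OF that(1), of ?z] i by simp
      qed
    next
      case False
      then have i: "indicator corr_set y = (0 :: complex)" using that by (simp add: corr_set_def)
      have r1: "r \<le> 1" using r(5) q1 False by simp
      have "cmod (1 - g n ?z) \<le> (C + 3) * cmod ?z powr r"
      proof (cases "cmod ?z \<le> 1")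
        case z: True
        have "cmod (1 - g n ?z) \<le> C * cmod ?z powr p + cmod ?z"
          using \<Psi>1[OF that(1) z] Rev[OF that(1), of ?z] norm_triangle_ineq4[of "(1 - g n ?z) + \<i> * of_real (Re (?z * m n))" "\<i> * of_real (Re (?z * m n))"]
          by (simp add: norm_mult)
        also have "C * cmod ?z powr p + cmod ?z \<le> C * cmod ?z powr r + 3 * cmod ?z powr r"
        proof (rule add_mono)
          show "C * cmod ?z powr p \<le> C * cmod ?z powr r"
            using r z C by (intro mult_left_mono powr_mono') auto
          have "cmod ?z powr 1 \<le> cmod ?z powr r" using r1 z by (intro powr_mono') auto
          moreover have "0 \<le> cmod ?z powr r" by simp
          moreover have "cmod ?z powr 1 = cmod ?z" by simp
          ultimately show "cmod ?z \<le> 3 * cmod ?z powr r" by linarith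
        qed
        finally show ?thesis by (simp add: distrib_right)
      next
        case z: False
        have "cmod (1 - g n ?z) \<le> 2" using norm_triangle_ineq4[of 1 "g n ?z"] g1[of n ?z] by simp
        also have "2 \<le> (C + 3) * 1" using C by simp
        also have "\<dots> \<le> (C + 3) * cmod ?z powr r"
          using z C r q by (intro mult_left_mono ge_one_powr_ge_zero) auto
        finally show ?thesis .
      qed
      then show ?thesis using i by simp
    qed
    then have "cmod (\<Theta> n u y) \<le> intensity n y * ((C + 3) * cmod ?z powr r)"
      using intensity_nonneg[of n y] by (simp add: \<Theta>_def mult_left_mono)
    also have "\<dots> \<le> (2 * exp (- (1 - \<eta>) * y)) * ((C + 3) * cmod ?z powr r)"
    proof (rule mult_right_mono)
      have "intensity n y \<le> 2 * (if y \<le> 0 then exp (- y) else exp (- (1 - \<eta>) * y))"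
        using that(1) unfolding good_def by blast
      then show "intensity n y \<le> 2 * exp (- (1 - \<eta>) * y)" using that(2) by simp
    qed (use C in simp)
    also have "cmod ?z powr r = cmod u powr r * exp (?s * r * y)"
      by (simp add: nv powr_mult exp_powr_real mult_ac)
    also have "(2 * exp (- (1 - \<eta>) * y)) * ((C + 3) * (cmod u powr r * exp (?s * r * y))) =
        (C + 3) * cmod u powr r * (2 * (exp (- (1 - \<eta>) * y) * exp (?s * r * y)))"
      by (simp only: mult_ac)
    also have "exp (- (1 - \<eta>) * y) * exp (?s * r * y) = exp (- \<eta> * y)"
    proof -
      have "- (1 - \<eta>) + ?s * r = - \<eta>" by (simp add: \<eta>_def field_simps)
      then have "- (1 - \<eta>) * y + ?s * r * y = - \<eta> * y" by (simp only: distrib_right[symmetric])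
      then show ?thesis by (simp only: mult_exp_exp)
    qed
    finally show ?thesis using that by (simp add: Dom_def)
  qed
  define K where "K u = (C + 3 * max 1 (cmod u)) * (cmod u powr p + cmod u powr r)" for u
  have \<Theta>_le: "cmod (\<Theta> n u y) \<le> K u * Dom y" if "good n" for n u y
  proof (cases "y \<le> 0")
    case True
    have "(C + 3 * max 1 (cmod u)) * cmod u powr p * Dom y \<le> K u * Dom y"
      unfolding K_def using C Dom0 by (intro mult_right_mono mult_left_mono) auto
    then show ?thesis using \<Theta>_small[OF that True, of u] by linarith
  next
    case False
    have "(C + 3) * cmod u powr r * Dom y \<le> K u * Dom y"
      unfolding K_def using C Dom0 by (intro mult_right_mono mult_mono) auto
    then show ?thesis using \<Theta>_large[OF that, of y u] False by simp
  qed
  have \<Theta>lim: "(\<lambda>n. \<Theta> n u y) \<longlonglongrightarrow> of_real ((1 - h ((cmod u)\<^sup>2 * exp (2 * ?s * y))) * exp (- y))" for u y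
  proof -
    have "(\<lambda>n. \<Theta> n u y) \<longlonglongrightarrow> exp (- y) *\<^sub>R ((1 - of_real (h ((cmod (v u y))\<^sup>2))) + indicator corr_set y * (\<i> * of_real (Re (v u y * 0))))"
      unfolding \<Theta>_def by (intro tendsto_intros intensity_tendsto lim m0)
    moreover have "(cmod (v u y))\<^sup>2 = (cmod u)\<^sup>2 * exp (2 * ?s * y)"
      by (simp add: nv power_mult_distrib exp_double[symmetric] mult.assoc)
    ultimately show ?thesis by (simp add: scaleR_conv_of_real mult.commute)
  qed
  have KI: "integrable lborel (\<lambda>y. K u * Dom y)" for u using DomI by (rule integrable_mult_right)
  have ev_le: "eventually (\<lambda>n. \<forall>y. cmod (\<Theta> n u y) \<le> K u * Dom y) sequentially" for u
    using good by eventually_elim (auto intro: \<Theta>_le)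
  have \<Theta>_lim_m: "(\<lambda>y. complex_of_real ((1 - h ((cmod u)\<^sup>2 * exp (2 * ?s * y))) * exp (- y))) \<in> borel_measurable lborel" for u
    by (rule borel_measurable_LIMSEQ_metric[OF _ \<Theta>lim]) (simp add: \<Theta>m)
  have \<Theta>_int: "(\<lambda>n. CLINT y|lborel. \<Theta> n u y) \<longlonglongrightarrow> of_real (LINT y|lborel. (1 - h ((cmod u)\<^sup>2 * exp (2 * ?s * y))) * exp (- y))"
      and lim_int: "complex_integrable lborel (\<lambda>y. of_real ((1 - h ((cmod u)\<^sup>2 * exp (2 * ?s * y))) * exp (- y)))" for u
    using tendsto_integral_dominated_eventually[OF KI ev_le _ AE_I2[OF \<Theta>lim] \<Theta>_lim_m] by (simp_all only: integral_complex_of_real) (simp_all add: \<Theta>m)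
  show "integrable lborel (\<lambda>y. (1 - h (t * exp (2 * ?s * y))) * exp (- y))" if "t \<ge> 0" for t
    using integrable_Re[OF lim_int[of "of_real (sqrt t)"]] that by simp
  have \<Theta>I: "complex_integrable lborel (\<lambda>y. \<Theta> n u y)" if "good n" for n u
    by (rule Bochner_Integration.integrable_bound[OF KI[of u]]) (use \<Theta>_le[OF that, of u] in \<open>auto intro!: AE_I2 order_trans[OF _ abs_ge_self]\<close>)
  define mM where "mM n = m n * corr_mean n" for n
  have Nt: "of_nat (N n) * t n u = \<i> * of_real (Re (u * mM n)) - (CLINT y|lborel. \<Theta> n u y)" if "good n" for n u
  proof -
    have n: "n > 0" using that by (simp add: good_def)
    have "t n u = (CLINT x|std_normal_distribution. g n (u * exp (bt * of_real (sqrt (\<kappa> n) * x - centre n))) - 1)"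
      unfolding t_def using G.prob_space by (subst Bochner_Integration.integral_diff) (auto intro!: G.integrable_const_bound[of _ 1] g1)
    then have "of_nat (N n) * t n u = (CLINT y|lborel. intensity n y *\<^sub>R (g n (v u y) - 1))"
      unfolding v_def by (subst integral_intensity(1)[OF n, symmetric]) auto
    also have "\<dots> = (CLINT y|lborel. \<i> * of_real (Re ((u * m n) * (intensity n y *\<^sub>R (indicator corr_set y * exp (bt * of_real y))))) - \<Theta> n u y)"
    proof (intro Bochner_Integration.integral_cong refl)
      fix y
      have "(u * m n) * (intensity n y *\<^sub>R (indicator corr_set y * exp (bt * of_real y))) = of_real (intensity n y * indicator corr_set y) * (v u y * m n)"
        by (cases "y \<in> corr_set") (simp_all add: v_def scaleR_conv_of_real mult_ac)
      then have "Re ((u * m n) * (intensity n y *\<^sub>R (indicator corr_set y * exp (bt * of_real y)))) = intensity n y * indicator corr_set y * Re (v u y * m n)"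
        by (simp only: Re_mult_real)
      then show "intensity n y *\<^sub>R (g n (v u y) - 1) = \<i> * of_real (Re ((u * m n) * (intensity n y *\<^sub>R (indicator corr_set y * exp (bt * of_real y))))) - \<Theta> n u y"
        by (cases "y \<in> corr_set") (simp_all add: \<Theta>_def scaleR_conv_of_real algebra_simps)
    qed
    also have "\<dots> = (CLINT y|lborel. \<i> * of_real (Re ((u * m n) * (intensity n y *\<^sub>R (indicator corr_set y * exp (bt * of_real y)))))) - (CLINT y|lborel. \<Theta> n u y)"
      using corr_integrable[OF n] by (intro Bochner_Integration.integral_diff \<Theta>I[OF that] integrable_mult_right integrable_of_real integrable_Re)
    also have "(CLINT y|lborel. \<i> * of_real (Re ((u * m n) * (intensity n y *\<^sub>R (indicator corr_set y * exp (bt * of_real y)))))) = \<i> * of_real (Re (u * mM n))"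
    proof -
      have "(LINT y|lborel. Re ((u * m n) * (intensity n y *\<^sub>R (indicator corr_set y * exp (bt * of_real y))))) = Re ((u * m n) * corr_mean n)"
        unfolding corr_mean_def integral_mult_right_zero[symmetric]
        using corr_integrable[OF n] by (intro integral_Re integrable_mult_right)
      then show ?thesis
        by (simp only: integral_mult_right_zero integral_complex_of_real mM_def mult.assoc)
    qed
    finally show ?thesis .
  qed
  have mM: "rapidly_decreasing mM"
    unfolding mM_def using rapidly_decreasing_mult[OF m] corr_mean_bound by blast
  have mM0: "mM \<longlonglongrightarrow> 0" by (rule rapidly_decreasing_tendsto[OF mM])
  have "(\<lambda>n. \<i> * of_real (Re (u * mM n)) - (CLINT y|lborel. \<Theta> n u y)) \<longlonglongrightarrow> \<i> * of_real (Re (u * 0)) - of_real (LINT y|lborel. (1 - h ((cmod u)\<^sup>2 * exp (2 * ?s * y))) * exp (- y))"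
    by (intro tendsto_intros mM0 \<Theta>_int)
  then have "(\<lambda>n. of_nat (N n) * t n u) \<longlonglongrightarrow> \<i> * of_real (Re (u * 0)) - of_real (LINT y|lborel. (1 - h ((cmod u)\<^sup>2 * exp (2 * ?s * y))) * exp (- y))"
    by (rule Lim_transform_eventually) (use good in \<open>eventually_elim, simp add: Nt\<close>)
  then have "(\<lambda>n. of_nat (N n) * t n u) \<longlonglongrightarrow> - of_real (LINT y|lborel. (1 - h ((cmod u)\<^sup>2 * exp (2 * ?s * y))) * exp (- y))" by simp
  from power_tendsto_exp[OF N_top this]
  show "(\<lambda>n. g' n u) \<longlonglongrightarrow> of_real (exp (- (LINT y|lborel. (1 - h ((cmod u)\<^sup>2 * exp (2 * ?s * y))) * exp (- y))))"
    unfolding g't by (simp add: exp_of_real[symmetric])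
  define I where "I = (LINT y|lborel. Dom y)"
  have I0: "I \<ge> 0" unfolding I_def by (simp add: Dom0)
  have \<Theta>q: "cmod (CLINT y|lborel. \<Theta> n u y) \<le> ((C + 3) * 2 * I) * cmod u powr q" if "good n" "cmod u \<le> 1" for n u
  proof -
    have "cmod (CLINT y|lborel. \<Theta> n u y) \<le> (LINT y|lborel. cmod (\<Theta> n u y))" by (rule integral_norm_bound)
    also have "\<dots> \<le> (LINT y|lborel. K u * Dom y)"
      using \<Theta>_le[OF that(1)] \<Theta>I[OF that(1)] KI by (intro integral_mono integrable_norm) auto
    also have "\<dots> = K u * I" by (simp add: I_def)
    also have "K u \<le> (C + 3) * (cmod u powr q + cmod u powr q)"
    proof -
      have "cmod u powr p \<le> cmod u powr q" "cmod u powr r \<le> cmod u powr q"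
        by (rule powr_mono'; use that q r in simp)+
      moreover have "max 1 (cmod u) = 1" using that by simp
      ultimately show ?thesis unfolding K_def using C by (intro mult_mono) auto
    qed
    finally have "cmod (CLINT y|lborel. \<Theta> n u y) \<le> (C + 3) * (cmod u powr q + cmod u powr q) * I"
      using I0 by (simp add: mult_right_mono)
    then show ?thesis by (simp add: algebra_simps)
  qed
  define C2 where "C2 = (C + 3) * 2 * I + 1"
  \<comment> \<open>For \<open>Re bt >= 1\<close> the exponent \<open>q\<close> is below 1, so the
    mean term is itself of order \<open>q\<close> and goes into the error.\<close>
  define m' where "m' n = (if ?s < 1 then mM n else 0)" for n
  have "rapidly_decreasing m'"
    using mM unfolding m'_def by (cases "?s < 1") (auto simp: rapidly_decreasing_def)
  moreover have "char_bound g' m' q"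
    unfolding g't
  proof (rule char_bound_power[OF t1])
    show "C2 \<ge> 0" using C I0 by (simp add: C2_def)
    show "0 < q" "q \<le> 2" using q by auto
    show "m' \<longlonglongrightarrow> 0" by (rule rapidly_decreasing_tendsto) fact
    show "eventually (\<lambda>n. \<forall>u. cmod u \<le> 1 \<longrightarrow> cmod (of_nat (N n) * t n u - \<i> * of_real (Re (u * m' n))) \<le> C2 * cmod u powr q) sequentially"
      using good order_tendstoD(2)[OF tendsto_norm_zero[OF mM0] zero_less_one]
    proof eventually_elim
      case (elim n)
      show ?case
      proof (intro allI impI)
        fix u assume u: "cmod u \<le> 1"
        have a: "cmod (\<i> * complex_of_real (Re (u * mM n)) - \<i> * of_real (Re (u * m' n))) \<le> cmod u powr q"
        proof (cases "?s < 1")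
          case False
          have "cmod (\<i> * complex_of_real (Re (u * mM n)) - \<i> * of_real (Re (u * m' n))) \<le> cmod u * cmod (mM n)"
            using False abs_Re_le_cmod[of "u * mM n"] by (simp add: m'_def norm_mult)
          also have "\<dots> \<le> cmod u powr 1" using elim by (simp add: mult_left_le)
          also have "\<dots> \<le> cmod u powr q" using q1 False u by (intro powr_mono') auto
          finally show ?thesis .
        qed (simp add: m'_def)
        have eq: "of_nat (N n) * t n u - \<i> * of_real (Re (u * m' n)) =
          (\<i> * complex_of_real (Re (u * mM n)) - \<i> * of_real (Re (u * m' n))) - (CLINT y|lborel. \<Theta> n u y)"
          by (simp add: Nt[OF elim(1)])
        have "cmod (of_nat (N n) * t n u - \<i> * of_real (Re (u * m' n))) \<le> cmod u powr q + ((C + 3) * 2 * I) * cmod u powr q"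
          unfolding eq by (rule order_trans[OF norm_triangle_ineq4 add_mono[OF a \<Theta>q[OF elim(1) u]]])
        then show "cmod (of_nat (N n) * t n u - \<i> * of_real (Re (u * m' n))) \<le> C2 * cmod u powr q"
          by (simp add: C2_def algebra_simps)
      qed
    qed
  qed
  ultimately show "\<exists>m'. rapidly_decreasing m' \<and> char_bound g' m' q" by blast
qed

end

section \<open>The recursion over the levels\<close>

declare times_complex.sel [simp]


text \<open>The map \<open>x = exp (- y)\<close> carries the intensity \<open>exp (- y) dy\<close>
  of the extremal process to Lebesgue measure on the positive half line. This is how the limit over
  the extremal points becomes an integral over a unit intensity Poisson process, with
  \<open>exp (2 * Re bt * y)\<close> turning into a negative power of \<open>x\<close>.\<close>

lemma exp_change_of_variables:
  fixes F :: "real \<Rightarrow> real"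
  assumes [measurable]: "F \<in> borel_measurable borel"
    and I: "integrable lborel (\<lambda>y. F (exp (- y)) * exp (- y))"
  shows "integrable lborel (\<lambda>x. indicator {0<..} x * F x)"
    and "(LINT x|lborel. indicator {0<..} x * F x) = (LINT y|lborel. F (exp (- y)) * exp (- y))"
proof -
  have im: "(\<lambda>y::real. exp (- y)) ` UNIV = {0<..}"
  proof (intro set_eqI iffI)
    fix x :: real assume "x \<in> {0<..}"
    then have "x = exp (- (- ln x))" by simp
    then show "x \<in> range (\<lambda>y. exp (- y))" by blast
  qed auto
  have I': "integrable lborel (\<lambda>y. \<bar>- exp (- y)\<bar> * F (exp (- y)))" using I by (simp add: mult.commute)
  have "(\<lambda>y. \<bar>- exp (- y)\<bar> * F (exp (- y))) absolutely_integrable_on UNIV"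
    using I' by (simp add: set_integrable_def integrable_completion)
  moreover have "integral UNIV (\<lambda>y. \<bar>- exp (- y)\<bar> * F (exp (- y))) = (LINT y|lborel. F (exp (- y)) * exp (- y))"
    using integral_lborel[OF I'] by (simp add: mult.commute)
  moreover have "((\<lambda>y::real. exp (- y)) has_field_derivative - exp (- x)) (at x within UNIV)" for x
    by (auto intro!: derivative_eq_intros)
  ultimately have "F absolutely_integrable_on {0<..} \<and> integral {0<..} F = (LINT y|lborel. F (exp (- y)) * exp (- y))"
    using has_absolute_integral_change_of_variables_1'[of UNIV "\<lambda>y::real. exp (- y)" "\<lambda>y. - exp (- y)" F "LINT y|lborel. F (exp (- y)) * exp (- y)"]
    unfolding im by (simp add: inj_on_def)
  then have a: "F absolutely_integrable_on {0<..}" and b: "integral {0<..} F = (LINT y|lborel. F (exp (- y)) * exp (- y))" by auto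
  have "integrable lebesgue (\<lambda>x. indicator {0<..} x * F x)" using a by (simp add: set_integrable_def)
  then show "integrable lborel (\<lambda>x. indicator {0<..} x * F x)" by (subst (asm) integrable_completion) auto
  have "(LINT x|lborel. indicator {0<..} x * F x) = (LINT x|lebesgue. indicator {0<..} x * F x)"
    by (rule integral_completion[symmetric]) measurable
  also have "\<dots> = integral {0<..} F"
    using set_lebesgue_integral_eq_integral(2)[OF a] by (simp add: set_lebesgue_integral_def)
  finally show "(LINT x|lborel. indicator {0<..} x * F x) = (LINT y|lborel. F (exp (- y)) * exp (- y))" using b by simp
qed

section \<open>Characteristic functions of complex Gaussian mixtures\<close>

lemma char_normal_half:
  assumes "\<sigma> > 0"
  shows "(CLINT x|density lborel (\<lambda>x. ennreal (normal_density 0 \<sigma> x)). iexp (t * x)) = exp (- of_real (\<sigma>\<^sup>2 * t\<^sup>2 / 2))"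
proof -
  have "(CLINT x|density lborel (\<lambda>x. ennreal (normal_density 0 \<sigma> x)). iexp (t * x)) = (CLINT x|lborel. normal_density 0 \<sigma> x *\<^sub>R iexp (t * x))"
    by (subst integral_density) auto
  also have "\<dots> = \<bar>\<sigma>\<bar> *\<^sub>R (CLINT x|lborel. normal_density 0 \<sigma> (0 + \<sigma> * x) *\<^sub>R iexp (t * (0 + \<sigma> * x)))"
    using assms by (intro lborel_integral_real_affine) auto
  also have "\<dots> = \<bar>\<sigma>\<bar> *\<^sub>R (CLINT x|lborel. (1 / \<sigma>) *\<^sub>R (std_normal_density x *\<^sub>R iexp ((\<sigma> * t) * x)))"
  proof -
    have "normal_density 0 \<sigma> (0 + \<sigma> * x) = 1 / \<sigma> * std_normal_density x" for x
      using assms by (simp add: normal_density_def real_sqrt_mult power_mult_distrib)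
    then show ?thesis by (simp add: mult_ac)
  qed
  also have "\<dots> = (CLINT x|lborel. std_normal_density x *\<^sub>R iexp ((\<sigma> * t) * x))"
    using assms by (subst integral_scaleR_right) auto
  also have "\<dots> = (CLINT x|std_normal_distribution. iexp ((\<sigma> * t) * x))"
    by (subst integral_density) auto
  also have "\<dots> = char std_normal_distribution (\<sigma> * t)" by (simp add: char_def)
  also have "\<dots> = exp (- of_real (\<sigma>\<^sup>2 * t\<^sup>2 / 2))"
    by (simp add: char_std_normal_distribution power_mult_distrib exp_of_real[symmetric])
  finally show ?thesis .
qed

lemma std_complex_normal_char:
  "(CLINT y|std_complex_normal. iexp (Re (w * y))) = of_real (exp (- (cmod w)\<^sup>2 / 4))"
proof -
  define g where "g = density lborel (\<lambda>x. ennreal (normal_density 0 (sqrt (1/2)) x))"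
  interpret g: prob_space g unfolding g_def by (rule prob_space_normal_density) simp
  interpret gg: pair_prob_space g g ..
  have [measurable_cong]: "sets g = sets borel" by (simp add: g_def)
  have [measurable]: "(\<lambda>(x, y). Complex x y) \<in> borel_measurable (g \<Otimes>\<^sub>M g)"
    unfolding case_prod_unfold Complex_eq by measurable
  have R: "Re (w * Complex x y) = Re w * x + (- Im w) * y" for x y by (simp add: times_complex.sel)
  have "(CLINT y|std_complex_normal. iexp (Re (w * y))) = (CLINT p|g \<Otimes>\<^sub>M g. iexp (Re (w * (case p of (x, y) \<Rightarrow> Complex x y))))"
    unfolding std_complex_normal_def Let_def g_def[symmetric] by (rule integral_distr) measurable
  also have "\<dots> = (CLINT p|g \<Otimes>\<^sub>M g. (case p of (x, y) \<Rightarrow> iexp (Re w * x) * iexp ((- Im w) * y)))"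
  proof (intro Bochner_Integration.integral_cong refl)
    fix p :: "real \<times> real"
    show "iexp (Re (w * (case p of (x, y) \<Rightarrow> Complex x y))) = (case p of (x, y) \<Rightarrow> iexp (Re w * x) * iexp ((- Im w) * y))"
      by (cases p) (simp only: prod.case R of_real_add distrib_left exp_add)
  qed
  also have "\<dots> = (CLINT x|g. CLINT y|g. iexp (Re w * x) * iexp ((- Im w) * y))"
    by (rule gg.integral_fst[symmetric]) (auto intro!: gg.integrable_const_bound[of _ 1] simp: case_prod_unfold norm_mult simp del: of_real_mult)
  also have "\<dots> = (CLINT x|g. iexp (Re w * x)) * (CLINT y|g. iexp ((- Im w) * y))"
    by (simp only: integral_mult_right_zero integral_mult_left_zero)
  also have "\<dots> = exp (- of_real ((sqrt (1/2))\<^sup>2 * (Re w)\<^sup>2 / 2)) * exp (- of_real ((sqrt (1/2))\<^sup>2 * (- Im w)\<^sup>2 / 2))"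
    unfolding g_def by (subst char_normal_half, simp, subst char_normal_half, simp, rule refl)
  also have "\<dots> = exp (of_real (- (cmod w)\<^sup>2 / 4))"
    unfolding mult_exp_exp by (rule arg_cong[where f=exp]) (simp add: cmod_power2 power_divide field_simps)
  finally show ?thesis by (simp only: exp_of_real)
qed

lemma csqrt_measurable [measurable]: "csqrt \<in> borel_measurable borel"
proof -
  have "csqrt = (\<lambda>z. complex_of_real (sqrt ((cmod z + Re z) / 2)) +
      \<i> * of_real ((if Im z = 0 then 1 else sgn (Im z)) * sqrt ((cmod z - Re z) / 2)))"
    by (auto simp: fun_eq_iff complex_eq_iff)
  also have "\<dots> \<in> borel_measurable borel" by measurable
  finally show ?thesis .
qed

text \<open>Given \<open>\<zeta>\<close>, the product is a rotation invariant complex Gaussian with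
  second absolute moment \<open>cmod \<zeta> / 2\<close>, so only the squared modulus of the complex
  root enters. Averaging over \<open>\<zeta>\<close> leaves its Laplace transform at
  \<open>(cmod u)\<^sup>2 / 8\<close>.\<close>

lemma gaussian_mixture_char:
  fixes \<zeta> G :: "'a \<Rightarrow> complex"
  assumes M: "prob_space M" and G: "distr M borel G = std_complex_normal"
    and ind: "prob_space.indep_var M borel \<zeta> borel G"
    and \<zeta>: "AE \<omega> in M. \<exists>r\<ge>0. \<zeta> \<omega> = of_real r"
  shows "(CLINT \<omega>|M. iexp (Re (u * (of_real (1 / sqrt 2) * csqrt (\<zeta> \<omega>) * G \<omega>)))) =
    of_real (LINT \<omega>|M. exp (- ((cmod u)\<^sup>2 / 8) * Re (\<zeta> \<omega>)))"
proof -
  interpret prob_space M by fact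
  have [measurable]: "\<zeta> \<in> borel_measurable M" "G \<in> borel_measurable M"
    using ind by (auto dest: indep_var_rv1 indep_var_rv2)
  define f where "f = (\<lambda>(x, y). iexp (Re (u * (of_real (1 / sqrt 2) * csqrt x * y))))"
  have fm[measurable]: "f \<in> borel_measurable (borel \<Otimes>\<^sub>M borel)"
    unfolding f_def case_prod_unfold by measurable
  have inner: "(CLINT \<omega>|M. f (x, G \<omega>)) = of_real (exp (- (cmod u)\<^sup>2 * cmod x / 8))" for x
  proof -
    let ?w = "u * of_real (1 / sqrt 2) * csqrt x"
    have "(CLINT \<omega>|M. f (x, G \<omega>)) = (CLINT \<omega>|M. iexp (Re (?w * G \<omega>)))"
      by (simp only: f_def prod.case mult.assoc)
    also have "\<dots> = (CLINT y|distr M borel G. iexp (Re (?w * y)))"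
      by (rule integral_distr[symmetric]) measurable
    also have "\<dots> = of_real (exp (- (cmod ?w)\<^sup>2 / 4))" unfolding G by (rule std_complex_normal_char)
    also have "(cmod ?w)\<^sup>2 = (cmod u)\<^sup>2 * cmod x / 2"
    proof -
      have "(cmod (csqrt x))\<^sup>2 = cmod x" by (metis norm_power power2_csqrt)
      then show ?thesis by (simp add: norm_mult power_mult_distrib norm_divide power_divide)
    qed
    finally show ?thesis by simp
  qed
  have "(CLINT \<omega>|M. iexp (Re (u * (of_real (1 / sqrt 2) * csqrt (\<zeta> \<omega>) * G \<omega>)))) = (CLINT \<omega>|M. f (\<zeta> \<omega>, G \<omega>))"
    by (simp only: f_def prod.case)
  also have "\<dots> = (CLINT x|distr M borel \<zeta>. CLINT \<omega>|M. f (x, G \<omega>))"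
    by (rule indep_var_integral[OF ind fm, where B=1]) (auto simp: f_def simp del: of_real_mult)
  also have "\<dots> = (CLINT \<omega>|M. of_real (exp (- (cmod u)\<^sup>2 * cmod (\<zeta> \<omega>) / 8)))"
    unfolding inner by (rule integral_distr) measurable
  also have "\<dots> = of_real (LINT \<omega>|M. exp (- (cmod u)\<^sup>2 * cmod (\<zeta> \<omega>) / 8))"
    by (rule integral_complex_of_real)
  also have "(LINT \<omega>|M. exp (- (cmod u)\<^sup>2 * cmod (\<zeta> \<omega>) / 8)) = (LINT \<omega>|M. exp (- ((cmod u)\<^sup>2 / 8) * Re (\<zeta> \<omega>)))"
  proof (rule integral_cong_AE)
    show "AE \<omega> in M. exp (- (cmod u)\<^sup>2 * cmod (\<zeta> \<omega>) / 8) = exp (- ((cmod u)\<^sup>2 / 8) * Re (\<zeta> \<omega>))"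
      using \<zeta> by eventually_elim auto
  qed measurable
  finally show ?thesis .
qed

lemma char_bound_mono:
  assumes "char_bound g m p" "q \<le> p"
  shows "char_bound g m q"
proof -
  obtain C where C: "C \<ge> 0" and b: "\<forall>\<^sub>F n in sequentially. \<forall>v. cmod v \<le> 1 \<longrightarrow> cmod (g n v - 1 - \<i> * of_real (Re (v * m n))) \<le> C * cmod v powr p"
    using assms by (auto simp: char_bound_def)
  from b have "\<forall>\<^sub>F n in sequentially. \<forall>v. cmod v \<le> 1 \<longrightarrow> cmod (g n v - 1 - \<i> * of_real (Re (v * m n))) \<le> C * cmod v powr q"
  proof eventually_elim
    case (elim n)
    show ?case
    proof (intro allI impI)
      fix v :: complex assume v: "cmod v \<le> 1"
      have "C * cmod v powr p \<le> C * cmod v powr q"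
        by (intro mult_left_mono powr_mono') (use v assms C in auto)
      then show "cmod (g n v - 1 - \<i> * of_real (Re (v * m n))) \<le> C * cmod v powr q" using elim v by fastforce
    qed
  qed
  then show ?thesis using C by (auto simp: char_bound_def)
qed

text \<open>The bound near the origin is uniform in \<open>n\<close> and the means vanish, so it
  passes to the limit function. Its purpose is continuity at 0 of the Laplace transform of the
  cascade.\<close>

lemma char_bound_limit:
  assumes cb: "char_bound g m p" and m: "m \<longlonglongrightarrow> 0" and lim: "\<And>u. (\<lambda>n. g n u) \<longlonglongrightarrow> of_real (h ((cmod u)\<^sup>2))"
    and p: "p > 0" and t: "t \<longlonglongrightarrow> 0" "\<And>k. t k \<ge> 0"
  shows "(\<lambda>k. h (t k)) \<longlonglongrightarrow> (1::real)"
proof -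
  obtain C where C: "C \<ge> 0" and b: "\<forall>\<^sub>F n in sequentially. \<forall>v. cmod v \<le> 1 \<longrightarrow> cmod (g n v - 1 - \<i> * of_real (Re (v * m n))) \<le> C * cmod v powr p"
    using cb by (auto simp: char_bound_def)
  have bound: "\<bar>h ((cmod u)\<^sup>2) - 1\<bar> \<le> C * cmod u powr p" if "cmod u \<le> 1" for u
  proof (rule tendsto_upperbound)
    have "(\<lambda>n. cmod (g n u - 1 - \<i> * of_real (Re (u * m n)))) \<longlonglongrightarrow> cmod (of_real (h ((cmod u)\<^sup>2)) - 1 - \<i> * of_real (Re (u * 0)))"
      by (intro tendsto_intros lim m)
    moreover have "cmod (of_real (h ((cmod u)\<^sup>2)) - 1 - \<i> * of_real (Re (u * 0))) = \<bar>h ((cmod u)\<^sup>2) - 1\<bar>"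
    proof -
      have "of_real (h ((cmod u)\<^sup>2)) - 1 - \<i> * of_real (Re (u * 0)) = complex_of_real (h ((cmod u)\<^sup>2) - 1)" by simp
      then show ?thesis by (simp only: norm_of_real)
    qed
    ultimately show "(\<lambda>n. cmod (g n u - 1 - \<i> * of_real (Re (u * m n)))) \<longlonglongrightarrow> \<bar>h ((cmod u)\<^sup>2) - 1\<bar>" by simp
    show "\<forall>\<^sub>F n in sequentially. cmod (g n u - 1 - \<i> * of_real (Re (u * m n))) \<le> C * cmod u powr p"
      using b by eventually_elim (use that in blast)
  qed simp
  have "(\<lambda>k. C * sqrt (t k) powr p) \<longlonglongrightarrow> C * sqrt 0 powr p"
    using p t by (intro tendsto_mult tendsto_const tendsto_powr' tendsto_real_sqrt) auto
  then have r: "(\<lambda>k. C * sqrt (t k) powr p) \<longlonglongrightarrow> 0" by simp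
  have "\<forall>\<^sub>F k in sequentially. norm (h (t k) - 1) \<le> C * sqrt (t k) powr p"
    using order_tendstoD(2)[OF t(1) zero_less_one]
  proof eventually_elim
    case (elim k)
    then show ?case using bound[of "of_real (sqrt (t k))"] t(2)[of k] by simp
  qed
  from Lim_null_comparison[OF this r] show ?thesis by (simp add: LIM_zero_iff)
qed

lemma iter_char_level:
  "j \<le> d \<Longrightarrow> iter_char (map f [j..<Suc d]) u =
     (CLINT x|std_normal_distribution. iter_char (map f [Suc j..<Suc d]) (u * exp (snd (f j) * of_real x))) ^ fst (f j)"
  by (cases "f j") (simp add: upt_conv_Cons del: upt_Suc)

text \<open>A leaf is the constant 1, so its mean and both second moments are 1. Inside the unit
  disc the cubic Taylor remainder suffices, outside it the quadratic one.\<close>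

lemma quad_expansion_iexp:
  assumes e: "0 < e" "e \<le> 1"
  shows "quad_expansion 1 e (\<lambda>v. iexp (Re v)) 1 1 1"
  unfolding quad_expansion_def
proof (intro conjI allI)
  fix v :: complex
  define y where "y = Re v"
  have q: "quad_poly 1 1 1 v = 1 + \<i> * of_real y - of_real (y\<^sup>2 / 2)"
    using Re_square[of v] by (simp add: quad_poly_def y_def add_divide_distrib)
  have yv: "\<bar>y\<bar> \<le> cmod v" unfolding y_def by (rule abs_Re_le_cmod)
  show "cmod (iexp (Re v) - quad_poly 1 1 1 v) \<le> 1 * (sqrt 1 * cmod v) powr (2 + e)"
  proof (cases "cmod v \<le> 1")
    case True
    have "cmod (iexp y - (\<Sum>k\<le>2. (\<i> * of_real y) ^ k / fact k)) \<le> \<bar>y\<bar> ^ Suc 2 / fact (Suc 2)"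
      by (rule iexp_approx1)
    also have "(\<Sum>k\<le>2. (\<i> * complex_of_real y) ^ k / fact k) = quad_poly 1 1 1 v"
      unfolding q by (simp add: numeral_2_eq_2 power2_eq_square power_mult_distrib field_simps)
    also have "\<bar>y\<bar> ^ Suc 2 / fact (Suc 2) \<le> \<bar>y\<bar> ^ 3"
    proof -
      have "\<bar>y\<bar> ^ Suc 2 = \<bar>y\<bar> ^ 3" by (simp add: numeral_3_eq_3 numeral_2_eq_2)
      moreover have "(fact (Suc 2) :: real) = 6" by (simp add: numeral_2_eq_2)
      moreover have "x / 6 \<le> x" if "0 \<le> x" for x :: real using that by simp
      ultimately show ?thesis by (metis abs_ge_zero zero_le_power)
    qed
    also have "\<dots> \<le> cmod v ^ 3" using yv by (intro power_mono) auto
    also have "\<dots> \<le> cmod v powr (2 + e)"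
    proof (cases "v = 0")
      case False
      have "cmod v ^ 3 = cmod v powr 3" using False by simp
      also have "\<dots> \<le> cmod v powr (2 + e)" using True e by (intro powr_mono') auto
      finally show ?thesis .
    qed simp
    finally show ?thesis by (simp add: y_def)
  next
    case False
    have "cmod (iexp y - (\<Sum>k\<le>1. (\<i> * of_real y) ^ k / fact k)) \<le> \<bar>y\<bar> ^ Suc 1 / fact (Suc 1)"
      by (rule iexp_approx1)
    then have 1: "cmod (iexp y - (1 + \<i> * of_real y)) \<le> y\<^sup>2 / 2" by (simp add: numeral_2_eq_2 power2_eq_square)
    have "cmod (iexp y - quad_poly 1 1 1 v) = cmod ((iexp y - (1 + \<i> * of_real y)) + of_real (y\<^sup>2 / 2))"
      unfolding q by (simp add: algebra_simps)
    also have "\<dots> \<le> y\<^sup>2 / 2 + y\<^sup>2 / 2"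
      by (rule order_trans[OF norm_triangle_ineq add_mono[OF 1]]) (simp only: norm_of_real, simp)
    also have "\<dots> = \<bar>y\<bar>\<^sup>2" by simp
    also have "\<dots> \<le> (cmod v)\<^sup>2" using yv by (intro power_mono) auto
    also have "\<dots> = cmod v powr 2" using False by simp
    also have "\<dots> \<le> cmod v powr (2 + e)" using False e by (intro powr_mono) auto
    finally show ?thesis by (simp add: y_def)
  qed
qed auto

text \<open>The assumptions of the theorem, in terms of \<open>\<kappa>\<^sub>0 j = 2 ln (\<alpha> j) = \<sigma>\<^sub>j\<^sup>2 a\<^sub>j\<close>.\<close>

locale grem =
  fixes d l :: nat and a \<sigma> \<kappa>\<^sub>0 :: "nat \<Rightarrow> real" and N :: "nat \<Rightarrow> nat \<Rightarrow> nat" and \<beta> :: complex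
  assumes a: "\<And>j. j \<in> {1..d} \<Longrightarrow> a j > 0"
    and \<kappa>\<^sub>0: "\<And>j. j \<in> {1..d} \<Longrightarrow> \<kappa>\<^sub>0 j > 0"
    and N: "\<And>j. j \<in> {1..d} \<Longrightarrow> (\<lambda>n. N n j * exp (- (n * \<kappa>\<^sub>0 j) / 2)) \<longlonglongrightarrow> 1"
    and \<sigma>: "\<And>j. j \<in> {1..d} \<Longrightarrow> \<sigma> j > 0" "\<And>j. j \<in> {1..d} \<Longrightarrow> \<kappa>\<^sub>0 j = (\<sigma> j)\<^sup>2 * a j"
    and \<sigma>_mono: "strict_mono_on {1..d} \<sigma>"
    and l: "l \<in> {1..d}"
    and Re_\<beta>: "Re \<beta> = \<sigma> l / 2" and Im_\<beta>: "Im \<beta> > \<sigma> l / 2"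
begin

definition coef :: "nat \<Rightarrow> nat \<Rightarrow> complex" where
  "coef n j = \<beta> * of_real (sqrt (real n) * sqrt (a j))"

text \<open>Belongs to the sum below a vertex of depth \<open>j - 1\<close>: index 1 is the whole
  tree, index \<open>Suc d\<close> a single leaf.\<close>

definition level_char :: "nat \<Rightarrow> nat \<Rightarrow> complex \<Rightarrow> complex" where
  "level_char n j = iter_char (map (\<lambda>i. (N n i, coef n i)) [j..<Suc d])"

lemma level_char_measurable [measurable]: "level_char n j \<in> borel_measurable borel"
  by (simp add: level_char_def del: upt_Suc)

lemma norm_level_char: "cmod (level_char n j u) \<le> 1"
  unfolding level_char_def by (rule norm_iter_char_le_1)

lemma level_char_Suc:
  "j \<le> d \<Longrightarrow> level_char n j u =
     (CLINT x|std_normal_distribution. level_char n (Suc j) (u * exp (coef n j * of_real x))) ^ N n j"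
  unfolding level_char_def by (subst iter_char_level) (auto simp del: upt_Suc)

lemma N_top: "j \<in> {1..d} \<Longrightarrow> filterlim (\<lambda>n. real (N n j)) at_top sequentially"
proof -
  assume j: "j \<in> {1..d}"
  have "filterlim (\<lambda>n. real n * (\<kappa>\<^sub>0 j / 2)) at_top sequentially"
    using \<kappa>\<^sub>0[OF j] by (intro filterlim_at_top_mult_tendsto_pos[OF tendsto_const] filterlim_real_sequentially) simp
  then have "filterlim (\<lambda>n. (N n j * exp (- (n * \<kappa>\<^sub>0 j) / 2)) * exp (real n * (\<kappa>\<^sub>0 j / 2))) at_top sequentially"
    by (intro filterlim_tendsto_pos_mult_at_top[OF N[OF j]] filterlim_compose[OF exp_at_top]) auto
  then show ?thesis by (simp add: mult_exp_exp mult.assoc)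
qed

lemma \<sigma>_less: "i \<in> {1..d} \<Longrightarrow> j \<in> {1..d} \<Longrightarrow> i < j \<Longrightarrow> \<sigma> i < \<sigma> j"
  by (rule strict_mono_onD[OF \<sigma>_mono])

text \<open>Induction from the leaves up to the children of level \<open>l\<close>. The Lyapunov
  condition of \<open>quad_expansion_step\<close> holds for all large \<open>n\<close> because
  \<open>\<sigma> j\<close> exceeds \<open>\<sigma> l\<close> strictly; one \<open>e\<close> works
  for all these levels, while the constant \<open>C\<close> changes finitely often.\<close>

lemma lower_levels:
  "\<exists>e C m A B. 0 < e \<and> e \<le> 1 \<and> C \<ge> 0 \<and>
     (\<forall>\<^sub>F n in sequentially. quad_expansion C e (level_char n (Suc l)) (m n) (A n) (B n))"
proof -
  \<comment> \<open>Chosen so that \<open>(1 + e) * (\<sigma> l)\<^sup>2\<close> is at most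
    \<open>(\<sigma> (Suc l))\<^sup>2\<close>; the condition on each lower level then has a surplus
    of \<open>e / 2\<close>. For \<open>l = d\<close> there is no lower level and 1 is a
    default.\<close>
  define e where "e = (if l < d then min 1 ((\<sigma> (Suc l) / \<sigma> l)\<^sup>2 - 1) else 1)"
  have sl: "\<sigma> l > 0" using \<sigma>(1)[OF l] .
  have e: "0 < e" "e \<le> 1"
  proof -
    have "1 < (\<sigma> (Suc l) / \<sigma> l)\<^sup>2" if "l < d"
    proof -
      have "1 < \<sigma> (Suc l) / \<sigma> l" using \<sigma>_less[of l "Suc l"] l that sl by auto
      then show ?thesis by (simp add: one_less_power)
    qed
    then show "0 < e" by (auto simp: e_def)
    show "e \<le> 1" by (simp add: e_def)
  qed
  have gap: "(2 + e) * (Re \<beta>)\<^sup>2 * a j < \<kappa>\<^sub>0 j / 2" if j: "j \<in> {Suc l..d}" for j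
  proof -
    have jd: "j \<in> {1..d}" "Suc l \<in> {1..d}" "l < d" using j l by auto
    have "(1 + e) * (\<sigma> l)\<^sup>2 \<le> (\<sigma> (Suc l) / \<sigma> l)\<^sup>2 * (\<sigma> l)\<^sup>2"
      using jd by (intro mult_right_mono) (auto simp: e_def)
    also have "\<dots> = (\<sigma> (Suc l))\<^sup>2" using sl by (simp add: power_divide)
    also have "\<dots> \<le> (\<sigma> j)\<^sup>2"
      using \<sigma>_less[of "Suc l" j] \<sigma>(1)[OF jd(2)] j jd by (cases "j = Suc l") (auto intro!: power_mono)
    finally have 1: "(1 + e) * (\<sigma> l)\<^sup>2 \<le> (\<sigma> j)\<^sup>2" .
    have "(1 + e / 2) * (\<sigma> l)\<^sup>2 < (1 + e) * (\<sigma> l)\<^sup>2" using e sl by (intro mult_strict_right_mono) auto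
    with 1 have "(1 + e / 2) * (\<sigma> l)\<^sup>2 * (a j / 2) < (\<sigma> j)\<^sup>2 * (a j / 2)"
      using a[OF jd(1)] by (intro mult_strict_right_mono) auto
    then show ?thesis unfolding Re_\<beta> \<sigma>(2)[OF jd(1)] by (simp add: power_divide field_simps)
  qed
  have "\<exists>C m A B. C \<ge> 0 \<and> (\<forall>\<^sub>F n in sequentially. quad_expansion C e (level_char n (Suc l)) (m n) (A n) (B n))"
  proof (rule inc_induct[where j=d and P="\<lambda>k. \<exists>C m A B. C \<ge> 0 \<and> (\<forall>\<^sub>F n in sequentially. quad_expansion C e (level_char n (Suc k)) (m n) (A n) (B n))"])
    show "l \<le> d" using l by simp
    have "level_char n (Suc d) = (\<lambda>v. iexp (Re v))" for n by (simp add: level_char_def fun_eq_iff)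
    then show "\<exists>C m A B. C \<ge> 0 \<and> (\<forall>\<^sub>F n in sequentially. quad_expansion C e (level_char n (Suc d)) (m n) (A n) (B n))"
      using quad_expansion_iexp[OF e] by (intro exI[of _ 1] exI[of _ "\<lambda>_. 1"]) auto
  next
    fix k assume k: "l \<le> k" "k < d" and "\<exists>C m A B. C \<ge> 0 \<and> (\<forall>\<^sub>F n in sequentially. quad_expansion C e (level_char n (Suc (Suc k))) (m n) (A n) (B n))"
    then obtain C m A B where C: "C \<ge> 0" and q: "\<forall>\<^sub>F n in sequentially. quad_expansion C e (level_char n (Suc (Suc k))) (m n) (A n) (B n)"
      by blast
    let ?j = "Suc k"
    have j: "?j \<in> {Suc l..d}" "?j \<in> {1..d}" using k by auto
    \<comment> \<open>The exponential surplus per unit of \<open>n\<close>, which absorbs the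
      deviation of \<open>N n\<close> from its asymptotic value.\<close>
    define D where "D = \<kappa>\<^sub>0 ?j / 2 - (2 + e) * (Re \<beta>)\<^sup>2 * a ?j"
    have D: "D > 0" using gap[OF j(1)] by (simp add: D_def)
    have "\<forall>\<^sub>F n in sequentially. exp ((2 + e) * (Re (coef n ?j))\<^sup>2) \<le> real (N n ?j)"
    proof -
      have "filterlim (\<lambda>n. real n * D) at_top sequentially"
        by (intro filterlim_at_top_mult_tendsto_pos[OF tendsto_const] filterlim_real_sequentially D)
      then have "filterlim (\<lambda>n. (N n ?j * exp (- (n * \<kappa>\<^sub>0 ?j) / 2)) * exp (real n * D)) at_top sequentially"
        by (intro filterlim_tendsto_pos_mult_at_top[OF N[OF j(2)]] filterlim_compose[OF exp_at_top]) auto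
      then have "\<forall>\<^sub>F n in sequentially. 1 \<le> (N n ?j * exp (- (n * \<kappa>\<^sub>0 ?j) / 2)) * exp (real n * D)"
        by (simp only: filterlim_at_top)
      then show ?thesis
      proof eventually_elim
        case (elim n)
        have E: "(2 + e) * (Re (coef n ?j))\<^sup>2 = real n * \<kappa>\<^sub>0 ?j / 2 - real n * D"
          using a[OF j(2)] by (simp add: coef_def D_def power_mult_distrib field_simps)
        have "exp ((2 + e) * (Re (coef n ?j))\<^sup>2) * 1 \<le> exp (real n * \<kappa>\<^sub>0 ?j / 2 - real n * D) * ((N n ?j * exp (- (n * \<kappa>\<^sub>0 ?j) / 2)) * exp (real n * D))"
          unfolding E using elim by (intro mult_left_mono) auto
        also have "\<dots> = N n ?j * (exp (real n * \<kappa>\<^sub>0 ?j / 2 - real n * D) * exp (- (n * \<kappa>\<^sub>0 ?j) / 2) * exp (real n * D))"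
          by (simp only: mult_ac)
        also have "exp (real n * \<kappa>\<^sub>0 ?j / 2 - real n * D) * exp (- (n * \<kappa>\<^sub>0 ?j) / 2) * exp (real n * D) = 1"
          unfolding mult_exp_exp by simp
        finally show ?case by simp
      qed
    qed
    moreover have "\<forall>\<^sub>F n in sequentially. 1 \<le> real (N n ?j)"
      using N_top[OF j(2)] by (simp only: filterlim_at_top)
    ultimately have "\<forall>\<^sub>F n in sequentially. quad_expansion (4 + C + (1 + C) * (3 + C) + (2 + C) ^ 3) e (level_char n ?j)
      (of_nat (N n ?j) * m n * exp ((coef n ?j)\<^sup>2 / 2))
      (real (N n ?j) * exp (2 * (Re (coef n ?j))\<^sup>2) * A n + (1 - 1 / real (N n ?j)) * (cmod (of_nat (N n ?j) * m n * exp ((coef n ?j)\<^sup>2 / 2)))\<^sup>2)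
      (of_nat (N n ?j) * exp (2 * (coef n ?j)\<^sup>2) * B n + (1 - 1 / of_nat (N n ?j)) * (of_nat (N n ?j) * m n * exp ((coef n ?j)\<^sup>2 / 2))\<^sup>2)"
      using q
    proof eventually_elim
      case (elim n)
      have "level_char n ?j = (\<lambda>v. (CLINT x|std_normal_distribution. level_char n (Suc ?j) (v * exp (coef n ?j * of_real x))) ^ N n ?j)"
        using j by (auto simp: fun_eq_iff level_char_Suc)
      then show ?case
        using elim by (simp only:) (rule quad_expansion_step[OF _ e C level_char_measurable norm_level_char]; simp)
    qed
    moreover have "0 \<le> 4 + C + (1 + C) * (3 + C) + (2 + C) ^ 3" using C by simp
    ultimately show "\<exists>C m A B. C \<ge> 0 \<and> (\<forall>\<^sub>F n in sequentially. quad_expansion C e (level_char n ?j) (m n) (A n) (B n))"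
      by (intro exI[of _ "4 + C + (1 + C) * (3 + C) + (2 + C) ^ 3"]) (rule exI, rule exI, rule exI, erule conjI[rotated])
  qed
  then show ?thesis using e by blast
qed

section \<open>The critical level within the tree\<close>

lemma coef_eq: "j \<in> {1..d} \<Longrightarrow> coef n j = \<beta> / of_real (\<sigma> j) * of_real (sqrt (real n * \<kappa>\<^sub>0 j))"
proof -
  assume j: "j \<in> {1..d}"
  have "sqrt (real n * \<kappa>\<^sub>0 j) = sqrt (real n) * (\<sigma> j * sqrt (a j))"
    unfolding \<sigma>(2)[OF j] real_sqrt_mult real_sqrt_abs using \<sigma>(1)[OF j] by simp
  then show ?thesis using \<sigma>(1)[OF j] by (simp add: coef_def)
qed

lemma power_exp_decay:
  assumes D: "D > 0"
  shows "(\<lambda>n. real n ^ k * exp (- D * real n)) \<longlonglongrightarrow> 0"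
proof -
  have "filterlim (\<lambda>n. real n * D) at_top sequentially"
    by (intro filterlim_at_top_mult_tendsto_pos[OF tendsto_const] filterlim_real_sequentially D)
  then have "(\<lambda>n. (real n * D) ^ k / exp (real n * D)) \<longlonglongrightarrow> 0"
    by (rule filterlim_compose[OF tendsto_power_div_exp_0])
  then have "(\<lambda>n. (1 / D ^ k) * ((real n * D) ^ k / exp (real n * D))) \<longlonglongrightarrow> 0"
    by (rule tendsto_mult_right_zero)
  moreover have "(1 / D ^ k) * ((real n * D) ^ k / exp (real n * D)) = real n ^ k * exp (- D * real n)" for n
    using D by (simp add: power_mult_distrib exp_minus field_simps)
  ultimately show ?thesis by simp
qed

lemma critical:
  "\<exists>c :: nat \<Rightarrow> real. \<exists>m. (\<forall>\<^sub>F n in sequentially. c n \<noteq> 0) \<and> rapidly_decreasing m \<and>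
     (\<forall>u. (\<lambda>n. level_char n l (u * of_real (c n))) \<longlonglongrightarrow> of_real (exp (- (cmod u)\<^sup>2 / 8))) \<and>
     char_bound (\<lambda>n u. level_char n l (u * of_real (c n))) m 2"
proof -
  obtain e C m A B where e: "0 < e" "e \<le> 1" and C: "C \<ge> 0"
    and q: "\<forall>\<^sub>F n in sequentially. quad_expansion C e (level_char n (Suc l)) (m n) (A n) (B n)"
    using lower_levels by blast
  have ld: "l \<le> d" using l by simp
  define \<kappa> where "\<kappa> n = real n * \<kappa>\<^sub>0 l" for n
  define c where "c n = 1 / sqrt (N n l * exp (\<kappa> n / 2) * A n)" for n
  define m' where "m' n = of_nat (N n l) * of_real (c n) * m n * exp ((coef n l)\<^sup>2 / 2)" for n
  \<comment> \<open>Here the imaginary part of \<open>\<beta>\<close> exceeding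
    \<open>\<sigma> l / 2\<close> enters: the Gaussian mean
    \<open>exp ((coef n l)\<^sup>2 / 2)\<close> has modulus \<open>exp (- D * n)\<close>, while the
    normalization keeps the other factors bounded.\<close>
  define D where "D = ((Im \<beta>)\<^sup>2 - (\<sigma> l / 2)\<^sup>2) * a l / 2"
  have sl: "\<sigma> l > 0" using \<sigma>(1)[OF l] .
  have D: "D > 0"
  proof -
    have "(\<sigma> l / 2)\<^sup>2 < (Im \<beta>)\<^sup>2" using Im_\<beta> sl by (intro power_strict_mono) auto
    then show ?thesis using a[OF l] by (simp add: D_def)
  qed
  have \<kappa>0: "\<kappa> n \<ge> 0" for n using \<kappa>\<^sub>0[OF l] by (simp add: \<kappa>_def)
  have \<kappa>top: "filterlim \<kappa> at_top sequentially"
    unfolding \<kappa>_def using \<kappa>\<^sub>0[OF l]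
    by (intro filterlim_at_top_mult_tendsto_pos[OF tendsto_const] filterlim_real_sequentially)
  have Reb: "Re (coef n l) = sqrt (\<kappa> n) / 2" for n
    unfolding coef_eq[OF l] \<kappa>_def[symmetric] using sl by (simp add: Re_\<beta>)
  have Imb: "Im (coef n l) = sqrt (real n) * (Im \<beta> * sqrt (a l))" for n
    by (simp add: coef_def times_complex.sel del: of_real_mult)
  have Imtop: "filterlim (\<lambda>n. Im (coef n l)) at_top sequentially"
    unfolding Imb using Im_\<beta> sl a[OF l]
    by (intro filterlim_at_top_mult_tendsto_pos[OF tendsto_const] filterlim_compose[OF sqrt_at_top] filterlim_real_sequentially) auto
  have Nt: "(\<lambda>n. N n l * exp (- \<kappa> n / 2)) \<longlonglongrightarrow> 1" using N[OF l] by (simp add: \<kappa>_def)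
  have ev: "\<forall>\<^sub>F n in sequentially. c n \<noteq> 0 \<and> cmod (m' n) \<le> 2 * exp (- D * real n)"
    using q order_tendstoD(2)[OF Nt, of 4, simplified] N_top[OF l, unfolded filterlim_at_top, rule_format, of 1]
  proof eventually_elim
    case (elim n)
    have A: "A n > 0" and mA: "(cmod (m n))\<^sup>2 \<le> A n" using elim by (auto simp: quad_expansion_def)
    have N0: "real (N n l) > 0" using elim by simp
    have e2: "(cmod (exp ((coef n l)\<^sup>2 / 2)))\<^sup>2 = exp (- 2 * D * real n)"
    proof -
      have "(cmod (exp ((coef n l)\<^sup>2 / 2)))\<^sup>2 = exp (Re ((coef n l)\<^sup>2))"
        by (simp add: exp_double[symmetric])
      also have "Re ((coef n l)\<^sup>2) = (Re (coef n l))\<^sup>2 - (Im (coef n l))\<^sup>2" by (rule Re_power2)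
      also have "\<dots> = - 2 * D * real n"
        using \<kappa>0[of n] a[OF l] unfolding Reb Imb D_def
        by (simp add: power_mult_distrib power_divide \<kappa>_def \<sigma>(2)[OF l] field_simps)
      finally show ?thesis .
    qed
    have "(cmod (m' n))\<^sup>2 = (N n l)\<^sup>2 * (c n)\<^sup>2 * (cmod (m n))\<^sup>2 * exp (- 2 * D * real n)"
      unfolding m'_def norm_mult power_mult_distrib e2 by simp
    also have "\<dots> \<le> (N n l)\<^sup>2 * (c n)\<^sup>2 * A n * exp (- 2 * D * real n)"
      using mA by (intro mult_right_mono mult_left_mono) auto
    also have "(N n l)\<^sup>2 * (c n)\<^sup>2 * A n = N n l * exp (- \<kappa> n / 2)"
      using A N0 by (simp add: c_def power_divide power2_eq_square exp_minus field_simps)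
    also have "N n l * exp (- \<kappa> n / 2) * exp (- 2 * D * real n) \<le> 4 * exp (- 2 * D * real n)"
      using elim by (intro mult_right_mono) auto
    also have "\<dots> = (2 * exp (- D * real n))\<^sup>2" by (simp add: power_mult_distrib exp_double[symmetric] mult.assoc)
    finally have "cmod (m' n) \<le> 2 * exp (- D * real n)" by (rule power2_le_imp_le) simp
    then show ?case using A N0 by (simp add: c_def)
  qed
  have rd: "rapidly_decreasing m'"
    unfolding rapidly_decreasing_def
  proof
    fix k
    have r: "(\<lambda>n. 2 * (real n ^ k * exp (- D * real n))) \<longlonglongrightarrow> 0"
      by (rule tendsto_mult_right_zero[OF power_exp_decay[OF D]])
    have "\<forall>\<^sub>F n in sequentially. norm (real n ^ k * cmod (m' n)) \<le> 2 * (real n ^ k * exp (- D * real n))"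
      using ev
    proof eventually_elim
      case (elim n)
      have "real n ^ k * cmod (m' n) \<le> real n ^ k * (2 * exp (- D * real n))"
        using elim by (intro mult_left_mono) auto
      then show ?case by simp
    qed
    from Lim_null_comparison[OF this r] show "(\<lambda>n. real n ^ k * cmod (m' n)) \<longlonglongrightarrow> 0" .
  qed
  have g: "(\<lambda>n u. level_char n l (u * of_real (c n))) =
      (\<lambda>n u. (CLINT x|std_normal_distribution. level_char n (Suc l) (u * of_real (c n) * exp (coef n l * of_real x))) ^ N n l)"
    by (simp add: level_char_Suc[OF ld])
  note crit = critical_level[OF \<kappa>top Nt Reb Imtop \<kappa>0 q e C level_char_measurable norm_level_char c_def _ rapidly_decreasing_tendsto[OF rd] g]
  have m'eq: "m' = (\<lambda>n. of_nat (N n l) * of_real (c n) * m n * exp ((coef n l)\<^sup>2 / 2))" by (simp add: m'_def fun_eq_iff)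
  show ?thesis
  proof (intro exI conjI allI)
    show "\<forall>\<^sub>F n in sequentially. c n \<noteq> 0" using ev by eventually_elim simp
    show "rapidly_decreasing m'" by (rule rd)
    show "(\<lambda>n. level_char n l (u * of_real (c n))) \<longlonglongrightarrow> of_real (exp (- (cmod u)\<^sup>2 / 8))" for u
      by (rule crit(1)[OF m'eq])
    show "char_bound (\<lambda>n u. level_char n l (u * of_real (c n))) m' 2"
      by (rule crit(2)[OF m'eq])
  qed
qed

text \<open>The arguments of the cascade hanging below a vertex of depth \<open>k - 1\<close>. The
  list stops before \<open>l\<close>: it is empty at the critical level and has all
  \<open>l - 1\<close> entries at \<open>k = 1\<close>.\<close>

definition exponents :: "nat \<Rightarrow> real list" where
  "exponents k = map (\<lambda>j. 2 * Re \<beta> / \<sigma> j) [k..<l]"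

text \<open>The threshold \<open>2 * \<sigma> k / \<sigma> l\<close> is the reciprocal of the real
  part of \<open>\<beta> / \<sigma> k\<close>. All exponents below it are kept, because the next
  step upwards needs one that still lies above the smaller threshold of level \<open>k - 1\<close>.
  The 8 stems from the Gaussian limit at the critical level.\<close>

definition level_converges :: "nat \<Rightarrow> (nat \<Rightarrow> complex) \<Rightarrow> bool" where
  "level_converges k s \<longleftrightarrow> (\<forall>\<^sub>F n in sequentially. s n \<noteq> 0) \<and> cascade_integrable (exponents k) \<and>
     (\<forall>u. (\<lambda>n. level_char n k (u * s n)) \<longlonglongrightarrow> of_real (cascade_laplace (exponents k) ((cmod u)\<^sup>2 / 8))) \<and>
     (\<forall>p. 0 < p \<and> p < 2 * \<sigma> k / \<sigma> l \<longrightarrow>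
        (\<exists>m. rapidly_decreasing m \<and> char_bound (\<lambda>n u. level_char n k (u * s n)) m p))"

lemma level_converges_step:
  assumes k: "1 \<le> k" "k < l" and s: "level_converges (Suc k) s"
  shows "\<exists>s'. level_converges k s'"
proof -
  have kd: "k \<in> {1..d}" "Suc k \<in> {1..d}" "k \<le> d" using k l by auto
  have sk: "\<sigma> k > 0" "\<sigma> l > 0" "\<sigma> k < \<sigma> (Suc k)" "\<sigma> k < \<sigma> l"
    using \<sigma>(1) \<sigma>_less kd k l by auto
  define bt where "bt = \<beta> / of_real (\<sigma> k)"
  have Rebt: "Re bt = \<sigma> l / (2 * \<sigma> k)" using sk by (simp add: bt_def Re_\<beta>)
  have Imbt: "Im bt = Im \<beta> / \<sigma> k" by (simp add: bt_def)
  interpret L: extremal_level "\<lambda>n. N n k" "\<kappa>\<^sub>0 k" bt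
  proof
    show "\<kappa>\<^sub>0 k > 0" by (rule \<kappa>\<^sub>0[OF kd(1)])
    show "(\<lambda>n. N n k * exp (- (n * \<kappa>\<^sub>0 k) / 2)) \<longlonglongrightarrow> 1" by (rule N[OF kd(1)])
    show "Re bt > 0" using sk by (simp add: Rebt)
    have "\<bar>1 - Re bt\<bar> * \<sigma> k = \<bar>\<sigma> k - \<sigma> l / 2\<bar>"
    proof -
      have "\<bar>1 - Re bt\<bar> * \<sigma> k = \<bar>(1 - Re bt) * \<sigma> k\<bar>" using sk by (simp add: abs_mult)
      also have "(1 - Re bt) * \<sigma> k = \<sigma> k - \<sigma> l / 2" using sk by (simp add: Rebt field_simps)
      finally show ?thesis .
    qed
    also have "\<dots> < Im \<beta>" using sk Im_\<beta> by (auto simp: abs_less_iff)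
    finally show "\<bar>1 - Re bt\<bar> < Im bt" using sk by (simp add: Imbt pos_less_divide_eq)
  qed
  define g where "g n v = level_char n (Suc k) (v * s n)" for n v
  define h where "h t = cascade_laplace (exponents (Suc k)) (t / 8)" for t
  \<comment> \<open>The recentring of the extremal points is absorbed into the normalization. As
    \<open>bt\<close> is complex this includes a rotation, so the normalizing factor is
    complex.\<close>
  define s' where "s' n = s n * exp (- bt * of_real (L.centre n))" for n
  have gm: "g n \<in> borel_measurable borel" for n unfolding g_def by measurable
  have g1: "cmod (g n v) \<le> 1" for n v unfolding g_def by (rule norm_level_char)
  have lim: "(\<lambda>n. g n v) \<longlonglongrightarrow> of_real (h ((cmod v)\<^sup>2))" for v
    using s by (simp add: level_converges_def g_def h_def)
  have g': "(CLINT x|std_normal_distribution. g n (u * exp (bt * of_real (sqrt (L.\<kappa> n) * x - L.centre n)))) ^ N n k = level_char n k (u * s' n)" for n u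
  proof -
    have "u * exp (bt * of_real (sqrt (L.\<kappa> n) * x - L.centre n)) * s n = u * s' n * exp (coef n k * of_real x)" for x
    proof -
      have "bt * of_real (sqrt (L.\<kappa> n) * x - L.centre n) = - bt * of_real (L.centre n) + coef n k * of_real x"
        unfolding coef_eq[OF kd(1)] by (simp add: bt_def L.\<kappa>_def algebra_simps)
      then show ?thesis by (simp only: exp_add s'_def mult_ac)
    qed
    then show ?thesis unfolding level_char_Suc[OF kd(3)] g_def by (simp only:)
  qed
  \<comment> \<open>The midpoint of two consecutive thresholds: above the first, so that
    \<open>p * Re bt > 1\<close>, and below the second, so that the hypothesis on level
    \<open>Suc k\<close> provides the bound.\<close>
  define p where "p = (2 * \<sigma> k / \<sigma> l + 2 * \<sigma> (Suc k) / \<sigma> l) / 2"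
  have pq: "2 * \<sigma> k / \<sigma> l < 2 * \<sigma> (Suc k) / \<sigma> l" using sk by (simp add: divide_strict_right_mono)
  have p: "2 * \<sigma> k / \<sigma> l < p \<and> p < 2 * \<sigma> (Suc k) / \<sigma> l" 
  proof -
    have "x < (x + y) / 2 \<and> (x + y) / 2 < y" if "x < y" for x y :: real using that by simp
    from this[OF pq] show ?thesis unfolding p_def .
  qed
  have "0 < 2 * \<sigma> k / \<sigma> l" using sk by simp
  then have "0 < p" using p by linarith
  then obtain m where m: "rapidly_decreasing m" and cb: "char_bound g m p"
    using s p unfolding level_converges_def g_def[abs_def] by blast
  have ps: "p * Re bt > 1"
  proof -
    have "2 * \<sigma> k / \<sigma> l * Re bt < p * Re bt" using p sk by (intro mult_strict_right_mono) (auto simp: Rebt)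
    moreover have "2 * \<sigma> k / \<sigma> l * Re bt = 1" using sk by (simp add: Rebt)
    ultimately show ?thesis by (simp only:)
  qed
  have qcond: "q * Re bt < 1" "q \<le> p" "q \<le> 2" if "0 < q" "q < 2 * \<sigma> k / \<sigma> l" for q
  proof -
    have "q * Re bt < 2 * \<sigma> k / \<sigma> l * Re bt" using that sk by (intro mult_strict_right_mono) (auto simp: Rebt)
    then show "q * Re bt < 1" using sk by (simp add: Rebt)
    show "q \<le> p" using that p by linarith
    have "2 * \<sigma> k / \<sigma> l \<le> 2" using sk by (simp add: pos_divide_le_eq)
    then show "q \<le> 2" using that by linarith
  qed
  note LL = L.level_limit[of g h m p, OF gm g1 lim m cb ps, unfolded g']
  \<comment> \<open>Half the threshold, a representative admissible exponent for those conclusions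
    of \<open>level_limit\<close> in which \<open>q\<close> does not occur.\<close>
  define q where "q = \<sigma> k / \<sigma> l"
  have q: "0 < q" "q < 2 * \<sigma> k / \<sigma> l"
    unfolding q_def using sk by (simp, intro divide_strict_right_mono, auto)
  define z where "z = 2 * Re \<beta> / \<sigma> k"
  have z: "z = 2 * Re bt" by (simp add: z_def bt_def)
  have ex: "exponents k = z # exponents (Suc k)"
    unfolding exponents_def z_def using k by (simp add: upt_conv_Cons)
  have int: "integrable lborel (\<lambda>x. indicator {0<..} x * (1 - cascade_laplace (exponents (Suc k)) (t * x powr - z)))"
    and eq: "(LINT x|lborel. indicator {0<..} x * (1 - cascade_laplace (exponents (Suc k)) (t * x powr - z))) =
      (LINT y|lborel. (1 - h (8 * t * exp (2 * Re bt * y))) * exp (- y))" if "t \<ge> 0" for t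
  proof -
    have e: "(1 - cascade_laplace (exponents (Suc k)) (t * exp (- y) powr - z)) * exp (- y) = (1 - h (8 * t * exp (2 * Re bt * y))) * exp (- y)" for y
      by (simp add: h_def exp_powr_real z mult.commute)
    have I: "integrable lborel (\<lambda>y. (1 - cascade_laplace (exponents (Suc k)) (t * exp (- y) powr - z)) * exp (- y))"
      unfolding e by (rule LL(1)[OF q(1) qcond[OF q]]) (use that in simp)
    have meas: "(\<lambda>x. 1 - cascade_laplace (exponents (Suc k)) (t * x powr - z)) \<in> borel_measurable borel" by measurable
    show "integrable lborel (\<lambda>x. indicator {0<..} x * (1 - cascade_laplace (exponents (Suc k)) (t * x powr - z)))"
      by (rule exp_change_of_variables(1)[OF meas I])
    show "(LINT x|lborel. indicator {0<..} x * (1 - cascade_laplace (exponents (Suc k)) (t * x powr - z))) =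
      (LINT y|lborel. (1 - h (8 * t * exp (2 * Re bt * y))) * exp (- y))"
      unfolding exp_change_of_variables(2)[OF meas I] e ..
  qed
  have "level_converges k s'"
    unfolding level_converges_def
  proof (intro conjI allI impI)
    show "\<forall>\<^sub>F n in sequentially. s' n \<noteq> 0"
      using s by (simp add: level_converges_def s'_def)
    show "cascade_integrable (exponents k)"
      using s int by (simp add: ex level_converges_def)
    show "(\<lambda>n. level_char n k (u * s' n)) \<longlonglongrightarrow> of_real (cascade_laplace (exponents k) ((cmod u)\<^sup>2 / 8))" for u
      using LL(2)[OF q(1) qcond[OF q], of u] eq[of "(cmod u)\<^sup>2 / 8"] by (simp add: ex)
    fix q assume "0 < q \<and> q < 2 * \<sigma> k / \<sigma> l"
    then show "\<exists>m. rapidly_decreasing m \<and> char_bound (\<lambda>n u. level_char n k (u * s' n)) m q"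
      using LL(3)[of q] qcond[of q] by blast
  qed
  then show ?thesis by blast
qed

lemma level_converges_1: "\<exists>s. level_converges 1 s"
proof (rule inc_induct[where j=l and P="\<lambda>k. \<exists>s. level_converges k s"])
  show "1 \<le> l" using l by simp
  obtain c m where c: "\<forall>\<^sub>F n in sequentially. (c n :: real) \<noteq> 0" and m: "rapidly_decreasing m"
    and lim: "\<And>u. (\<lambda>n. level_char n l (u * of_real (c n))) \<longlonglongrightarrow> of_real (exp (- (cmod u)\<^sup>2 / 8))"
    and cb: "char_bound (\<lambda>n u. level_char n l (u * of_real (c n))) m 2"
    using critical by blast
  have "level_converges l (\<lambda>n. of_real (c n))"
    unfolding level_converges_def
  proof (intro conjI allI impI)
    show "\<forall>\<^sub>F n in sequentially. complex_of_real (c n) \<noteq> 0" using c by simp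
    show "cascade_integrable (exponents l)" by (simp add: exponents_def)
    show "(\<lambda>n. level_char n l (u * of_real (c n))) \<longlonglongrightarrow> of_real (cascade_laplace (exponents l) ((cmod u)\<^sup>2 / 8))" for u
      using lim[of u] by (simp add: exponents_def)
    fix p assume "0 < p \<and> p < 2 * \<sigma> l / \<sigma> l"
    then have "p \<le> 2" using \<sigma>(1)[OF l] by simp
    then show "\<exists>m. rapidly_decreasing m \<and> char_bound (\<lambda>n u. level_char n l (u * of_real (c n))) m p"
      using m char_bound_mono[OF cb] by blast
  qed
  then show "\<exists>s. level_converges l s" by blast
next
  fix k assume "1 \<le> k" "k < l" "\<exists>s. level_converges (Suc k) s"
  then show "\<exists>s. level_converges k s" using level_converges_step by blast
qed

lemma grem_partition_eq: "grem_partition d a N n \<xi> \<beta> \<omega> = tree_sum d (coef n) N n \<xi> \<omega>"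
  unfolding grem_partition_def tree_sum_def grem_energy_def coef_def
proof (rule sum.cong[OF refl])
  fix e
  have "\<beta> * of_real (sqrt (real n) * (\<Sum>j=1..d. sqrt (a j) * \<xi> (take j e) \<omega>)) =
      \<beta> * (\<Sum>j=1..d. of_real (sqrt (real n) * (sqrt (a j) * \<xi> (take j e) \<omega>)))"
    unfolding sum_distrib_left of_real_sum ..
  also have "\<dots> = (\<Sum>j=1..d. \<beta> * of_real (sqrt (real n) * sqrt (a j)) * of_real (\<xi> (take j e) \<omega>))"
    unfolding sum_distrib_left by (rule sum.cong[OF refl]) simp
  finally show "exp (\<beta> * of_real (sqrt (real n) * (\<Sum>j=1..d. sqrt (a j) * \<xi> (take j e) \<omega>))) =
      exp (\<Sum>j=1..d. \<beta> * of_real (sqrt (real n) * sqrt (a j)) * of_real (\<xi> (take j e) \<omega>))"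
    by (rule arg_cong)
qed

end

theorem theorem2p37:
  fixes d l :: nat and a \<alpha> :: "nat \<Rightarrow> real" and N :: "nat \<Rightarrow> nat \<Rightarrow> nat" and \<beta> :: complex
  assumes "\<And>j. j \<in> {1..d} \<Longrightarrow> a j > 0"
    and "\<And>j. j \<in> {1..d} \<Longrightarrow> \<alpha> j > 1"
    and "\<And>j. j \<in> {1..d} \<Longrightarrow> (\<lambda>n. real (N n j) / \<alpha> j ^ n) \<longlonglongrightarrow> 1"
    and "strict_mono_on {1..d} (grem_sigma a \<alpha>)"
    and "l \<in> {1..d}"
    and "Re \<beta> = grem_sigma a \<alpha> l / 2"
    and "Im \<beta> > grem_sigma a \<alpha> l / 2"
  shows "\<exists>r :: nat \<Rightarrow> complex.
    \<forall>(M :: nat \<Rightarrow> 'a measure) (\<xi> :: nat \<Rightarrow> nat list \<Rightarrow> 'a \<Rightarrow> real)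
     (M' :: 'b measure) (P :: nat list \<Rightarrow> 'b \<Rightarrow> real) (G :: 'b \<Rightarrow> complex).
      (\<forall>n. grem_disorder d N n (M n) (\<xi> n)) \<and>
      poisson_cascade (l - 1) M' P \<and>
      distr M' borel G = std_complex_normal \<and>
      prob_space.indep_var M'
        borel (poisson_cascade_zeta (l - 1) P (\<lambda>j. of_real (2 * Re \<beta> / grem_sigma a \<alpha> j)))
        borel G
      \<longrightarrow> converges_in_distribution
            M (\<lambda>n \<omega>. grem_partition d a N n (\<xi> n) \<beta> \<omega> / exp (r n))
            M' (\<lambda>\<omega>. of_real (1 / sqrt 2)
                 * csqrt (poisson_cascade_zeta (l - 1) P (\<lambda>j. of_real (2 * Re \<beta> / grem_sigma a \<alpha> j)) \<omega>)
                 * G \<omega>)"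
proof -
  let ?\<sigma> = "grem_sigma a \<alpha>"
  interpret grem d l a ?\<sigma> "\<lambda>j. 2 * ln (\<alpha> j)" N \<beta>
  proof
    fix j assume j: "j \<in> {1..d}"
    show "a j > 0" "2 * ln (\<alpha> j) > 0" using assms(1,2)[OF j] by auto
    then show "?\<sigma> j > 0" "2 * ln (\<alpha> j) = (?\<sigma> j)\<^sup>2 * a j" by (auto simp: grem_sigma_def)
    have "N n j * exp (- (n * (2 * ln (\<alpha> j))) / 2) = real (N n j) / \<alpha> j ^ n" for n
    proof -
      have e: "exp (n * ln (\<alpha> j)) = \<alpha> j ^ n" using assms(2)[OF j] by (simp add: exp_of_nat_mult)
      have "- (n * (2 * ln (\<alpha> j))) / 2 = - (n * ln (\<alpha> j))" by simp
      then show ?thesis by (simp only: exp_minus e divide_inverse)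
    qed
    then show "(\<lambda>n. N n j * exp (- (n * (2 * ln (\<alpha> j))) / 2)) \<longlonglongrightarrow> 1" using assms(3)[OF j] by simp
  qed (fact assms)+
  obtain s where s: "level_converges 1 s" using level_converges_1 by blast
  \<comment> \<open>Chosen before any probability space is fixed, since \<open>s\<close> depends
    only on the deterministic recursion. Division by \<open>exp (r n)\<close> is multiplication by
    \<open>s n\<close> as soon as \<open>s n\<close> is nonzero, which holds for all large
    \<open>n\<close>.\<close>
  define r where "r n = - Ln (s n)" for n
  have l1: "l = Suc (l - 1)" using assms(5) by simp
  define z where "z j = 2 * Re \<beta> / ?\<sigma> j" for j
  have exps: "exponents 1 = map z [1..<Suc (l - 1)]" unfolding exponents_def z_def using l1 by simp
  have ci: "cascade_integrable (map z [1..<Suc (l - 1)])" using s unfolding level_converges_def exps by blast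
  have lim: "(\<lambda>n. level_char n 1 (u * s n)) \<longlonglongrightarrow> of_real (cascade_laplace (map z [1..<Suc (l - 1)]) ((cmod u)\<^sup>2 / 8))" for u
    using s unfolding level_converges_def exps by blast
  have cl1: "(\<lambda>k. cascade_laplace (map z [1..<Suc (l - 1)]) (1 / real (Suc k))) \<longlonglongrightarrow> 1"
  proof -
    have "1 \<in> {1..d}" using assms(5) by auto
    then have p: "0 < ?\<sigma> 1 / ?\<sigma> l" using \<sigma>(1) assms(5) by simp
    then have "?\<sigma> 1 / ?\<sigma> l < 2 * ?\<sigma> 1 / ?\<sigma> l" by simp
    then obtain m where m: "rapidly_decreasing m" "char_bound (\<lambda>n u. level_char n 1 (u * s n)) m (?\<sigma> 1 / ?\<sigma> l)"
      using s p unfolding level_converges_def by blast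
    \<comment> \<open>The limiting characteristic function involves the Laplace transform at one
      eighth of the squared modulus, so the arguments are enlarged by 8 to reach
      \<open>1 / real (Suc k)\<close>.\<close>
    have "(\<lambda>k. 8 * (1 / real (Suc k))) \<longlonglongrightarrow> 8 * 0"
      by (intro tendsto_mult tendsto_const LIMSEQ_Suc[OF lim_1_over_n])
    then have t: "(\<lambda>k. 8 * (1 / real (Suc k))) \<longlonglongrightarrow> 0" by simp
    have "(\<lambda>k. cascade_laplace (map z [1..<Suc (l - 1)]) (8 * (1 / real (Suc k)) / 8)) \<longlonglongrightarrow> 1"
      by (rule char_bound_limit[where h="\<lambda>t. cascade_laplace (map z [1..<Suc (l - 1)]) (t / 8)",
            OF m(2) rapidly_decreasing_tendsto[OF m(1)] lim p t]) simp
    moreover have "8 * (1 / real (Suc k)) / 8 = 1 / real (Suc k)" for k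
      by (rule nonzero_mult_div_cancel_left) simp
    ultimately show ?thesis by (simp only:)
  qed
  show ?thesis
  proof (intro exI[of _ r] allI impI, elim conjE)
    fix M :: "nat \<Rightarrow> 'a measure" and \<xi> :: "nat \<Rightarrow> nat list \<Rightarrow> 'a \<Rightarrow> real"
      and M' :: "'b measure" and P :: "nat list \<Rightarrow> 'b \<Rightarrow> real" and G :: "'b \<Rightarrow> complex"
    let ?\<zeta> = "poisson_cascade_zeta (l - 1) P (\<lambda>j. of_real (2 * Re \<beta> / ?\<sigma> j))"
    assume dis: "\<forall>n. grem_disorder d N n (M n) (\<xi> n)" and P: "poisson_cascade (l - 1) M' P"
      and G: "distr M' borel G = std_complex_normal" and ind: "prob_space.indep_var M' borel ?\<zeta> borel G"
    interpret M': prob_space M' using P by (simp add: poisson_cascade_def)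
    have M: "prob_space (M n)" for n using dis by (simp add: grem_disorder_def)
    have \<zeta>m[measurable]: "?\<zeta> \<in> borel_measurable M'" and Gm[measurable]: "G \<in> borel_measurable M'"
      using ind by (auto dest: M'.indep_var_rv1 M'.indep_var_rv2)
    note zl = poisson_cascade_zeta_laplace[OF P ci cl1, unfolded z_def, OF \<zeta>m]
    have tm: "tree_sum d (coef n) N n (\<xi> n) \<in> borel_measurable (M n)"
      and tc: "(CLINT \<omega>|M n. iexp (Re (u * tree_sum d (coef n) N n (\<xi> n) \<omega>))) = level_char n 1 u" for n u
    proof -
      have *: "prob_space.indep_vars (M n) (\<lambda>_. borel) (\<xi> n) (\<Union>j\<in>{1..d}. grem_indices N n j)"
        "\<And>e. e \<in> (\<Union>j\<in>{1..d}. grem_indices N n j) \<Longrightarrow> distributed (M n) lborel (\<xi> n e) std_normal_density"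
        using dis unfolding grem_disorder_def by blast+
      show "tree_sum d (coef n) N n (\<xi> n) \<in> borel_measurable (M n)"
        by (rule tree_sum_char(1)[OF M *])
      show "(CLINT \<omega>|M n. iexp (Re (u * tree_sum d (coef n) N n (\<xi> n) \<omega>))) = level_char n 1 u"
        unfolding level_char_def by (rule tree_sum_char(2)[OF M *])
    qed
    show "converges_in_distribution M (\<lambda>n \<omega>. grem_partition d a N n (\<xi> n) \<beta> \<omega> / exp (r n))
            M' (\<lambda>\<omega>. of_real (1 / sqrt 2) * csqrt (?\<zeta> \<omega>) * G \<omega>)"
    proof (rule converges_in_distribution_of_complex_char[OF M M'.prob_space_axioms])
      show "(\<lambda>\<omega>. grem_partition d a N n (\<xi> n) \<beta> \<omega> / exp (r n)) \<in> borel_measurable (M n)" for n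
        unfolding grem_partition_eq using tm by measurable
      show "(\<lambda>\<omega>. of_real (1 / sqrt 2) * csqrt (?\<zeta> \<omega>) * G \<omega>) \<in> borel_measurable M'" by measurable
      fix u
      have "(CLINT \<omega>|M'. iexp (Re (u * (of_real (1 / sqrt 2) * csqrt (?\<zeta> \<omega>) * G \<omega>)))) =
          of_real (cascade_laplace (map z [1..<Suc (l - 1)]) ((cmod u)\<^sup>2 / 8))"
        unfolding gaussian_mixture_char[OF M'.prob_space_axioms G ind zl(1)] z_def
        by (subst zl(2)) simp_all
      moreover have "(\<lambda>n. CLINT \<omega>|M n. iexp (Re (u * (grem_partition d a N n (\<xi> n) \<beta> \<omega> / exp (r n))))) \<longlonglongrightarrow>
          of_real (cascade_laplace (map z [1..<Suc (l - 1)]) ((cmod u)\<^sup>2 / 8))"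
      proof (rule Lim_transform_eventually[OF lim])
        have "\<forall>\<^sub>F n in sequentially. s n \<noteq> 0" using s by (simp add: level_converges_def)
        then show "\<forall>\<^sub>F n in sequentially. level_char n 1 (u * s n) = (CLINT \<omega>|M n. iexp (Re (u * (grem_partition d a N n (\<xi> n) \<beta> \<omega> / exp (r n)))))"
        proof eventually_elim
          case (elim n)
          have "u * (x / exp (r n)) = u * s n * x" for x
          proof -
            have "exp (r n) = inverse (s n)" using elim by (simp add: r_def exp_minus)
            then show ?thesis by (simp add: divide_inverse_commute mult_ac)
          qed
          then show ?case unfolding grem_partition_eq by (simp only: tc)
        qed
      qed
      ultimately show "(\<lambda>n. CLINT \<omega>|M n. iexp (Re (u * (grem_partition d a N n (\<xi> n) \<beta> \<omega> / exp (r n))))) \<longlonglongrightarrow>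
          (CLINT \<omega>|M'. iexp (Re (u * (of_real (1 / sqrt 2) * csqrt (?\<zeta> \<omega>) * G \<omega>))))"
        by simp
    qed
  qed
qed

end
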